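(* Let $q$ be a primitive root of unity of even order $N=2n>2$ and let $0\le i,j<N$. The dimensions of the simple $\mathrm u_q(\mathfrak{sl}_{2,\mathbb I})$-modules are $$\dim L(i,j)=\begin{cases}2i+1,&\text{if } j=0,\\ 2j+1,&\text{if } i=0,\\ 4(i+j),&\text{if } i,j\ne0,\ 1<i+j\le N,\\ 4(i+j-N),&\text{if } i,j\neq0,\ N<i+j<2N,\end{cases}$$ and their quantum dimensions are $$\dim_qL(i,j)=\begin{cases}(-1)^i,&\text{if } j=0,\\(-1)^j,&\text{if } i=0,\\0,&\text{if } i,j\ne0.\end{cases}$$
   Context: $\Bbbk$ is an algebraically closed field of characteristic zero. $\mathrm u_q=\mathrm u_q(\mathfrak{sl}_{2,\mathbb I})$, $\mathbb I=\{1,2\}$, is the Hopf algebra over $\Bbbk$ generated by $x_1,x_2,y_1,y_2,\kappa_1,\kappa_2$ with relations $\kappa_1\kappa_2=\kappa_2\kappa_1$, $\kappa_i^N=1$, $\kappa_ix_j=q^{\delta_{ij}}x_j\kappa_i$, $\kappa_iy_j=q^{-\delta_{ij}}y_j\kappa_i$, $x_1^2=x_2^2=0$, $(x_1x_2)^N=-(x_2x_1)^N$, $y_1^2=y_2^2=0$, $(y_1y_2)^N=-(y_2y_1)^N$, $y_1x_1+x_1y_1=1-\kappa_2$, $y_2x_2+x_2y_2=1-\kappa_1$, $y_2x_1=q\,x_1y_2$, $y_1x_2=x_2y_1$, and coproduct $\Delta(\kappa_i)=\kappa_i\otimes\kappa_i$, $\Delta(x_1)=x_1\otimes1+\kappa_1^n\kappa_2\otimes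 x_1$, $\Delta(x_2)=x_2\otimes1+\kappa_2^n\otimes x_2$, $\Delta(y_1)=y_1\otimes1+\kappa_1^n\otimes y_1$, $\Delta(y_2)=y_2\otimes1+\kappa_1\kappa_2^n\otimes y_2$. Let $\mathrm u_q^+$ be the subalgebra generated by $x_1,x_2,\kappa_1,\kappa_2$. For $(i,j)\in(\mathbb Z/N)^2$, the standard module is $M(i,j)=\mathrm u_q\otimes_{\mathrm u_q^+}\Bbbk_{(i,j)}$, where $\Bbbk_{(i,j)}$ is one-dimensional with $\kappa_1,\kappa_2$ acting by $q^i,q^j$ and $x_1,x_2$ by zero; $L(i,j)$ is its unique simple quotient. Quantum dimension: $\mathrm u_q$ is quasitriangular with Drinfeld element $u$ and ribbon twist $\theta_V(v)=\nu u^{-1}v$, $\nu=\kappa_1^n\kappa_2^n$. The associated pivotal structure is $j_V=\phi_V\theta_V$, with $\phi_V$ the Drinfeld isomorphism (action of $u$ followed by the canonical isomorphism $V\to V^{**}$ of vector spaces), and $\dim_qV=\mathrm{ev}_{V^*}(j_V\otimes\mathrm{id}_{V^*})\mathrm{coev}_V\in\Bbbk$; so $j_V$ is the action of $\nu$ followed by $V\cong V^{**}$. *)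

theory Defs
  imports
    "Jordan_Normal_Form.VS_Connect"
    "HOL-Algebra.QuotRing"
    "HOL-Algebra.Generated_Rings"
    "HOL-Algebra.Free_Abelian_Groups"
    "HOL-Computational_Algebra.Polynomial"
begin

section \<open>The algebra \<open>u\<^sub>q(sl\<^sub>2\<^sub>,\<^sub>I)\<close>, \<open>I = {1,2}\<close>\<close>

datatype idx = I1 | I2

datatype gen = Gx idx | Gy idx | Gk idx

text \<open>Words in the generators form the free monoid, written additively so that the
  convolution product on \<^type>\<open>poly_mapping\<close> is the product of the free algebra.\<close>

datatype word = Word (letters: "gen list")

instantiation word :: monoid_add
begin

definition zero_word :: word where "0 = Word []"

definition plus_word :: "word \<Rightarrow> word \<Rightarrow> word" where
  "v + w = Word (letters v @ letters w)"

instance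
  by standard (simp_all add: zero_word_def plus_word_def)

end

type_synonym 'k free_alg = "word \<Rightarrow>\<^sub>0 'k"

definition scal :: "'k::field \<Rightarrow> 'k free_alg" where
  "scal c = Poly_Mapping.single 0 c"

definition gx :: "idx \<Rightarrow> 'k::field free_alg" where
  "gx a = Poly_Mapping.single (Word [Gx a]) 1"

definition gy :: "idx \<Rightarrow> 'k::field free_alg" where
  "gy a = Poly_Mapping.single (Word [Gy a]) 1"

definition gk :: "idx \<Rightarrow> 'k::field free_alg" where
  "gk a = Poly_Mapping.single (Word [Gk a]) 1"

text \<open>A relation \<open>l = r\<close> is recorded as the element \<open>l - r\<close>.\<close>

definition uq_relations :: "'k::field \<Rightarrow> nat \<Rightarrow> 'k free_alg set" where
  "uq_relations q N =
     {gk I1 * gk I2 - gk I2 * gk I1}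
   \<union> {gk a ^ N - 1 | a. True}
   \<union> {gk a * gx b - scal (if a = b then q else 1) * gx b * gk a | a b. True}
   \<union> {gk a * gy b - scal (if a = b then inverse q else 1) * gy b * gk a | a b. True}
   \<union> {gx a ^ 2 | a. True}
   \<union> {(gx I1 * gx I2) ^ N + (gx I2 * gx I1) ^ N}
   \<union> {gy a ^ 2 | a. True}
   \<union> {(gy I1 * gy I2) ^ N + (gy I2 * gy I1) ^ N}
   \<union> {gy I1 * gx I1 + gx I1 * gy I1 - (1 - gk I2),
      gy I2 * gx I2 + gx I2 * gy I2 - (1 - gk I1),
      gy I2 * gx I1 - scal q * gx I1 * gy I2,
      gy I1 * gx I2 - gx I2 * gy I1}"

definition uq_ideal :: "'k::field \<Rightarrow> nat \<Rightarrow> 'k free_alg set" where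
  "uq_ideal q N = genideal class_ring (uq_relations q N)"

definition uq :: "'k::field \<Rightarrow> nat \<Rightarrow> 'k free_alg set ring" where
  "uq q N = class_ring Quot (uq_ideal q N)"

definition uq_class :: "'k::field \<Rightarrow> nat \<Rightarrow> 'k free_alg \<Rightarrow> 'k free_alg set" where
  "uq_class q N a = uq_ideal q N +>\<^bsub>class_ring\<^esub> a"

text \<open>Adjoining the scalars to the generating set makes the generated subring a
  \<open>k\<close>-subalgebra.\<close>

definition uq_plus :: "'k::field \<Rightarrow> nat \<Rightarrow> 'k free_alg set set" where
  "uq_plus q N =
     generate_ring (uq q N) (uq_class q N ` (range scal \<union> {gx I1, gx I2, gk I1, gk I2}))"


section \<open>Left modules\<close>

text \<open>Left modules over a noncommutative ring are carried by the record type
  \<open>module\<close>; its inherited ring fields \<open>mult\<close> and \<open>one\<close> have no meaning for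
  a module and are set to \<^const>\<open>undefined\<close>.\<close>

definition quotient_module ::
  "('a, 'v, 'm) module_scheme \<Rightarrow> 'v set \<Rightarrow> ('a, 'v set) module" where
  "quotient_module M W =
     \<lparr>carrier = a_rcosets\<^bsub>M\<^esub> W, mult = undefined, one = undefined, ring.zero = W, add = set_add M,
      smult = (\<lambda>a C. \<Union>v\<in>C. W +>\<^bsub>M\<^esub> (a \<odot>\<^bsub>M\<^esub> v))\<rparr>"

definition simple_module :: "('a, 'r) ring_scheme \<Rightarrow> ('a, 'v, 'm) module_scheme \<Rightarrow> bool" where
  "simple_module R M \<longleftrightarrow>
     carrier M \<noteq> {\<zero>\<^bsub>M\<^esub>} \<and>
     (\<forall>W. Module.submodule W R M \<longrightarrow> W = {\<zero>\<^bsub>M\<^esub>} \<or> W = carrier M)"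

text \<open>For a subring \<open>B\<close> of \<open>A\<close> and a left \<open>B\<close>-module \<open>V\<close>, the tensor product
  \<open>A \<otimes>\<^sub>B V\<close> is the free abelian group on pairs \<open>(a, v)\<close>
  modulo biadditivity and \<open>B\<close>-balancedness; \<open>A\<close> acts by left multiplication on the
  first factor.\<close>

definition tensor_relations ::
  "('a, 'r) ring_scheme \<Rightarrow> 'a set \<Rightarrow> ('a, 'v, 'm) module_scheme \<Rightarrow> ('a \<times> 'v \<Rightarrow>\<^sub>0 int) set" where
  "tensor_relations A B V =
     {frag_of (a \<oplus>\<^bsub>A\<^esub> a', v) - frag_of (a, v) - frag_of (a', v) | a a' v.
        a \<in> carrier A \<and> a' \<in> carrier A \<and> v \<in> carrier V}
   \<union> {frag_of (a, v \<oplus>\<^bsub>V\<^esub> v') - frag_of (a, v) - frag_of (a, v') | a v v'.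
        a \<in> carrier A \<and> v \<in> carrier V \<and> v' \<in> carrier V}
   \<union> {frag_of (a \<otimes>\<^bsub>A\<^esub> b, v) - frag_of (a, b \<odot>\<^bsub>V\<^esub> v) | a b v.
        a \<in> carrier A \<and> b \<in> B \<and> v \<in> carrier V}"

definition induced_module ::
  "('a, 'r) ring_scheme \<Rightarrow> 'a set \<Rightarrow> ('a, 'v, 'm) module_scheme
     \<Rightarrow> ('a, ('a \<times> 'v \<Rightarrow>\<^sub>0 int) set) module" where
  "induced_module A B V =
     (let F = free_Abelian_group (carrier A \<times> carrier V);
          T = generate F (tensor_relations A B V)
      in \<lparr>carrier = rcosets\<^bsub>F\<^esub> T, mult = undefined, one = undefined, ring.zero = T, add = set_mult F,
          smult = (\<lambda>a C. \<Union>c\<in>C.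
            T #>\<^bsub>F\<^esub> frag_extend (\<lambda>(a', v). frag_of (a \<otimes>\<^bsub>A\<^esub> a', v)) c)\<rparr>)"


section \<open>Standard and simple modules\<close>

text \<open>The action of \<open>u\<^sub>q\<^sup>+\<close> on the one-dimensional module \<open>k\<^sub>(\<^sub>i\<^sub>,\<^sub>j\<^sub>)\<close> is
  a character, determined by its values on the generators.\<close>

definition borel_char ::
  "'k::field \<Rightarrow> nat \<Rightarrow> nat \<Rightarrow> nat \<Rightarrow> 'k free_alg set \<Rightarrow> 'k" where
  "borel_char q N i j = (THE \<chi>.
     \<chi> \<in> extensional (uq_plus q N) \<and>
     \<chi> \<in> Ring.ring_hom ((uq q N)\<lparr>carrier := uq_plus q N\<rparr>) class_ring \<and>
     (\<forall>c. \<chi> (uq_class q N (scal c)) = c) \<and>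
     (\<forall>a. \<chi> (uq_class q N (gx a)) = 0) \<and>
     \<chi> (uq_class q N (gk I1)) = q ^ i \<and>
     \<chi> (uq_class q N (gk I2)) = q ^ j)"

definition borel_module ::
  "'k::field \<Rightarrow> nat \<Rightarrow> nat \<Rightarrow> nat \<Rightarrow> ('k free_alg set, 'k) module" where
  "borel_module q N i j =
     \<lparr>carrier = UNIV, mult = undefined, one = undefined, ring.zero = 0, add = (+),
      smult = (\<lambda>b c. borel_char q N i j b * c)\<rparr>"

definition standard_module ::
  "'k::field \<Rightarrow> nat \<Rightarrow> nat \<Rightarrow> nat \<Rightarrow>
     ('k free_alg set, ('k free_alg set \<times> 'k \<Rightarrow>\<^sub>0 int) set) module" where
  "standard_module q N i j = induced_module (uq q N) (uq_plus q N) (borel_module q N i j)"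

definition simple_quotient ::
  "'k::field \<Rightarrow> nat \<Rightarrow> nat \<Rightarrow> nat \<Rightarrow>
     ('k free_alg set, ('k free_alg set \<times> 'k \<Rightarrow>\<^sub>0 int) set set) module" where
  "simple_quotient q N i j =
     (let M = standard_module q N i j
      in quotient_module M
           (THE W. Module.submodule W (uq q N) M \<and> simple_module (uq q N) (quotient_module M W)))"


section \<open>Dimension and quantum dimension\<close>

text \<open>Restriction of scalars along \<open>k \<rightarrow> u\<^sub>q\<close>.\<close>

definition underlying_space ::
  "'k::field \<Rightarrow> nat \<Rightarrow> ('k free_alg set, 'v, 'm) module_scheme \<Rightarrow> ('k, 'v) module" where
  "underlying_space q N V =
     \<lparr>carrier = carrier V, mult = undefined, one = undefined, ring.zero = \<zero>\<^bsub>V\<^esub>, add = add V,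
      smult = (\<lambda>c v. uq_class q N (scal c) \<odot>\<^bsub>V\<^esub> v)\<rparr>"

definition uq_fin_dim ::
  "'k::field \<Rightarrow> nat \<Rightarrow> ('k free_alg set, 'v, 'm) module_scheme \<Rightarrow> bool" where
  "uq_fin_dim q N V \<longleftrightarrow> vectorspace.fin_dim class_ring (underlying_space q N V)"

definition uq_dim ::
  "'k::field \<Rightarrow> nat \<Rightarrow> ('k free_alg set, 'v, 'm) module_scheme \<Rightarrow> nat" where
  "uq_dim q N V = vectorspace.dim class_ring (underlying_space q N V)"

definition ground_space :: "('k, 'k::field) module" where
  "ground_space =
     \<lparr>carrier = UNIV, mult = (*), one = 1, ring.zero = 0, add = (+), smult = (*)\<rparr>"

definition dual_space :: "('k::field, 'v, 'm) module_scheme \<Rightarrow> ('v \<Rightarrow> 'k) set" where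
  "dual_space V = LinearCombinations.module_hom class_ring V ground_space \<inter> extensional (carrier V)"

definition dual_vector ::
  "('k::field, 'v, 'm) module_scheme \<Rightarrow> 'v set \<Rightarrow> 'v \<Rightarrow> 'v \<Rightarrow> 'k" where
  "dual_vector V B b =
     (THE f. f \<in> dual_space V \<and> (\<forall>b'\<in>B. f b' = (if b' = b then 1 else 0)))"

text \<open>\<open>\<nu> = \<kappa>\<^sub>1\<^sup>n \<kappa>\<^sub>2\<^sup>n\<close> with \<open>N = 2n\<close>.\<close>

definition uq_nu :: "'k::field \<Rightarrow> nat \<Rightarrow> 'k free_alg set" where
  "uq_nu q N = uq_class q N (gk I1 ^ (N div 2) * gk I2 ^ (N div 2))"

text \<open>The pivotal structure \<open>j\<^sub>V = \<phi>\<^sub>V \<theta>\<^sub>V : V \<rightarrow> V\<^sup>*\<^sup>*\<close>: in the composite, the Drinfeld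
  element \<open>u\<close> of \<open>\<phi>\<^sub>V\<close> cancels against \<open>\<theta>\<^sub>V = \<nu> u\<inverse>\<close>, leaving the action of \<open>\<nu>\<close>
  followed by the canonical map \<open>v \<mapsto> (f \<mapsto> f v)\<close>.\<close>

definition pivotal ::
  "'k::field \<Rightarrow> nat \<Rightarrow> ('k free_alg set, 'v, 'm) module_scheme \<Rightarrow> 'v \<Rightarrow> ('v \<Rightarrow> 'k) \<Rightarrow> 'k" where
  "pivotal q N V v =
     restrict (\<lambda>f. f (uq_nu q N \<odot>\<^bsub>V\<^esub> v)) (dual_space (underlying_space q N V))"

text \<open>As \<open>coev\<^sub>V(1) = \<Sum>\<^sub>b b \<otimes> b\<^sup>*\<close> for any basis and its dual basis, and
  \<open>ev\<close> on \<open>V\<^sup>*\<^sup>* \<otimes> V\<^sup>*\<close> is \<open>F \<otimes> f \<mapsto> F f\<close>, the composite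
  \<open>ev (j\<^sub>V \<otimes> id) coev\<^sub>V\<close> is \<open>\<Sum>\<^sub>b j\<^sub>V(b)(b\<^sup>*)\<close>; it does not depend on the basis.\<close>

definition uq_qdim ::
  "'k::field \<Rightarrow> nat \<Rightarrow> ('k free_alg set, 'v, 'm) module_scheme \<Rightarrow> 'k" where
  "uq_qdim q N V =
     (let S = underlying_space q N V;
          B = (SOME B. finite B \<and> vectorspace.basis class_ring S B)
      in \<Sum>b\<in>B. pivotal q N V b (dual_vector S B b))"

end

theory Submission
  imports Defs
begin

text \<open>The standard module is \<open>A/J\<^sub>0\<close> for the free algebra \<open>A\<close> and a left ideal \<open>J\<^sub>0\<close>, and it is spanned
  by alternating words in \<open>y\<^sub>1, y\<^sub>2\<close> applied to the highest weight vector. An explicit action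
  on the span of these words of length at most \<open>2N\<close> shows that \<open>J\<^sub>0\<close> is proper. Let \<open>J\<close> consist
  of the \<open>a\<close> such that no \<open>b a\<close> has the highest weight vector as a component of its value on that
  vector. A left ideal containing \<open>J\<^sub>0\<close> but not contained in \<open>J\<close> has an element \<open>1 + n\<close>
  with \<open>n\<close> a combination of nonempty, hence nilpotent, words in the \<open>y\<^sub>i\<close>, so it is everything;
  thus \<open>L = A/J\<close>. The corresponding radical is found degree by degree: whether a vector of degree
  \<open>2l\<close> is detected by \<open>x\<^sub>1\<close> and \<open>x\<^sub>2\<close> is decided by the determinant
  \<open>(1 - q\<^sup>-\<^sup>l)(1 - q\<^sup>i\<^sup>+\<^sup>j\<^sup>-\<^sup>l)\<close>. Finally \<open>\<nu>\<close> acts on degree \<open>m\<close> by \<open>(-1)\<^sup>i\<^sup>+\<^sup>j\<^sup>+\<^sup>m\<close>, and the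
  trace is an alternating sum.\<close>

section \<open>Cyclic modules as quotients by left ideals\<close>

text \<open>Both \<open>borel_char\<close> and \<open>simple_quotient\<close> rest on definite
  descriptions, so nothing can be computed before a character of the Borel part and a unique maximal
  submodule are known to exist. The relations might a priori force the generator of the standard
  module to vanish; excluding this takes a concrete module in which a highest weight vector
  survives. In that model its annihilator K is a proper left ideal: it supplies the character, and
  it contains J_0. In the other direction, the commutation relations reduce every element modulo J_0
  to words in y_1 and y_2. The two facts together allow J to be defined through coefficients in the
  model, so that membership in J becomes a system of linear equations on coordinates. The case
  distinction comes from the factors 1 - q^j and 1 - q^i: on the highest weight vector v, x_1 sends
  y_1 v to (1 - q^j) v and x_2 sends y_2 v to (1 - q^i) v. If one factor is zero, the corresponding
  vector is singular and at most one word per degree survives in L. If neither is, both words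
  survive in every degree between 0 and the first degree in which the determinant vanishes.\<close>

definition left_ideal :: "'a::ring_1 set \<Rightarrow> bool" where
  "left_ideal J \<longleftrightarrow> 0 \<in> J \<and> (\<forall>a\<in>J. \<forall>b\<in>J. a + b \<in> J) \<and> (\<forall>c. \<forall>a\<in>J. c * a \<in> J)"

lemma left_idealD:
  assumes "left_ideal J"
  shows left_ideal_zero: "0 \<in> J"
    and left_ideal_add: "a \<in> J \<Longrightarrow> b \<in> J \<Longrightarrow> a + b \<in> J"
    and left_ideal_mult: "a \<in> J \<Longrightarrow> c * a \<in> J"
    and left_ideal_uminus: "a \<in> J \<Longrightarrow> - a \<in> J"
    and left_ideal_diff: "a \<in> J \<Longrightarrow> b \<in> J \<Longrightarrow> a - b \<in> J"
proof -
  show "0 \<in> J" and add: "a \<in> J \<Longrightarrow> b \<in> J \<Longrightarrow> a + b \<in> J"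
    and mult: "a \<in> J \<Longrightarrow> c * a \<in> J" for a b c
    using assms by (auto simp: left_ideal_def)
  show uminus: "a \<in> J \<Longrightarrow> - a \<in> J" for a
    using mult[of a "-1"] by simp
  show "a \<in> J \<Longrightarrow> b \<in> J \<Longrightarrow> a - b \<in> J"
    using add[of a "- b"] uminus[of b] by simp
qed

lemma left_ideal_eq_UNIV:
  assumes "left_ideal J" and "1 \<in> J"
  shows "J = UNIV"
  using left_ideal_mult[OF assms] by auto

text \<open>The module \<open>M\<close> over \<open>A/I\<close>, with \<open>cl\<close> the projection of \<open>A\<close>, is \<open>A/J\<close> via \<open>\<pi>\<close>.\<close>

definition presents :: "('a::ring_1 \<Rightarrow> 'r) \<Rightarrow> ('a \<Rightarrow> 'v) \<Rightarrow> ('r, 'v, 'm) module_scheme \<Rightarrow> 'a set \<Rightarrow> bool" where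
  "presents cl \<pi> M J \<longleftrightarrow>
     carrier M = range \<pi> \<and>
     (\<forall>a b. \<pi> a = \<pi> b \<longleftrightarrow> a - b \<in> J) \<and>
     (\<forall>a b. \<pi> a \<oplus>\<^bsub>M\<^esub> \<pi> b = \<pi> (a + b)) \<and>
     \<zero>\<^bsub>M\<^esub> = \<pi> 0 \<and>
     (\<forall>c a. cl c \<odot>\<^bsub>M\<^esub> \<pi> a = \<pi> (c * a))"

context
  fixes cl :: "'a::ring_1 \<Rightarrow> 'r" and \<pi> and M :: "('r, 'v, 'm) module_scheme" (structure) and J
  assumes pres: "presents cl \<pi> M J"
begin

lemma presentsD:
  shows presents_carrier: "carrier M = range \<pi>"
    and presents_eq_iff: "\<pi> a = \<pi> b \<longleftrightarrow> a - b \<in> J"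
    and presents_add: "\<pi> a \<oplus> \<pi> b = \<pi> (a + b)"
    and presents_zero: "\<zero> = \<pi> 0"
    and presents_smult: "cl c \<odot> \<pi> a = \<pi> (c * a)"
  using pres by (auto simp: presents_def)

lemma presents_left_ideal: "left_ideal J"
proof -
  have mem: "a \<in> J \<longleftrightarrow> \<pi> a = \<pi> 0" for a
    using presents_eq_iff[of a 0] by simp
  have "\<pi> (a + b) = \<pi> 0" if "\<pi> a = \<pi> 0" "\<pi> b = \<pi> 0" for a b
    using presents_add[of a b] presents_add[of 0 0] that by simp
  moreover have "\<pi> (c * a) = \<pi> 0" if "\<pi> a = \<pi> 0" for a c
    using presents_smult[of c a] presents_smult[of c 0] that by simp
  ultimately show ?thesis
    by (auto simp: left_ideal_def mem)
qed

lemma presents_abelian_group: "abelian_group M"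
proof (rule abelian_groupI)
  fix x assume "x \<in> carrier M"
  then obtain a where "x = \<pi> a" by (auto simp: presents_carrier)
  then show "\<exists>y\<in>carrier M. y \<oplus> x = \<zero>"
    by (intro bexI[of _ "\<pi> (- a)"]) (auto simp: presents_add presents_zero presents_carrier)
qed (auto simp: presents_carrier presents_add presents_zero algebra_simps)

lemma presents_uminus: "\<ominus> \<pi> a = \<pi> (- a)"
  using presents_abelian_group
  by (intro abelian_group.minus_equality) (auto simp: presents_add presents_zero presents_carrier)

lemma presents_submodule_image:
  assumes R: "carrier R = range cl" and "left_ideal J'"
  shows "Module.submodule (\<pi> ` J') R M"
  unfolding Module.submodule_def Module.submodule_axioms_def
proof (intro conjI allI impI)
  interpret abelian_group M by (rule presents_abelian_group)
  show "subgroup (\<pi> ` J') (add_monoid M)"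
  proof (rule group.subgroupI[OF a_group])
    show "\<pi> ` J' \<subseteq> carrier (add_monoid M)"
      by (auto simp: presents_carrier)
    show "\<pi> ` J' \<noteq> {}"
      using left_ideal_zero[OF assms(2)] by auto
    show "inv\<^bsub>add_monoid M\<^esub> a \<in> \<pi> ` J'" if "a \<in> \<pi> ` J'" for a
      using that left_ideal_uminus[OF assms(2)] presents_uminus by (auto simp: a_inv_def)
    show "a \<otimes>\<^bsub>add_monoid M\<^esub> b \<in> \<pi> ` J'" if "a \<in> \<pi> ` J'" "b \<in> \<pi> ` J'" for a b
      using that left_ideal_add[OF assms(2)] by (auto simp: presents_add)
  qed
  show "a \<odot> x \<in> \<pi> ` J'" if "a \<in> carrier R" "x \<in> \<pi> ` J'" for a x
    using that left_ideal_mult[OF assms(2)] by (auto simp: R presents_smult)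
qed

text \<open>A left ideal above the kernel J is a union of cosets of J, so pulling its image back
  adds no elements.\<close>

lemma presents_vimage_image:
  assumes "left_ideal J'" and "J \<subseteq> J'"
  shows "\<pi> -` (\<pi> ` J') = J'"
proof -
  have "b \<in> J'" if "a \<in> J'" "b - a \<in> J" for a b
    using left_ideal_add[OF assms(1), of "b - a" a] that assms(2) by auto
  then show ?thesis
    by (auto simp: presents_eq_iff)
qed

lemma presents_submodule_vimage:
  assumes R: "carrier R = range cl" and W: "Module.submodule W R M"
  shows "left_ideal (\<pi> -` W)" and "J \<subseteq> \<pi> -` W" and "\<pi> ` (\<pi> -` W) = W"
proof -
  interpret subgroup W "add_monoid M"
    using W by (simp add: Module.submodule_def)
  have smult: "cl c \<odot> x \<in> W" if "x \<in> W" for c x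
    using W that R by (auto simp: Module.submodule_def Module.submodule_axioms_def)
  have zero: "\<pi> 0 \<in> W" using one_closed by (simp add: presents_zero)
  have add: "x \<in> W \<Longrightarrow> y \<in> W \<Longrightarrow> x \<oplus> y \<in> W" for x y
    using m_closed by simp
  show "left_ideal (\<pi> -` W)"
    unfolding left_ideal_def using zero
    by (auto simp flip: presents_add presents_smult intro: add smult)
  show "J \<subseteq> \<pi> -` W"
    using presents_eq_iff[of _ 0] zero by fastforce
  show "\<pi> ` (\<pi> -` W) = W"
    using subset by (auto simp: presents_carrier)
qed

text \<open>The third isomorphism theorem: a quotient of \<open>A/J\<close> is again cyclic,
  presented by the preimage of W. This keeps all later questions inside A, although the carrier
  types of iterated quotients change.\<close>

lemma presents_quotient:
  assumes R: "carrier R = range cl" and W: "Module.submodule W R M"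
  shows "presents cl (\<lambda>a. W +> \<pi> a) (quotient_module M W) (\<pi> -` W)"
proof -
  interpret abelian_group M by (rule presents_abelian_group)
  interpret abelian_subgroup W M
    using W by (intro abelian_subgroupI3)
      (auto simp: Module.submodule_def additive_subgroup_def presents_abelian_group)
  note J' = presents_submodule_vimage[OF R W]
  have carr: "\<pi> a \<in> carrier M" for a by (simp add: presents_carrier)
  have mem: "\<pi> b \<in> W +> \<pi> a \<longleftrightarrow> b - a \<in> \<pi> -` W" for a b
    using a_rcos_module[of "\<pi> a" "\<pi> b"] carr by (simp add: presents_uminus presents_add)
  have eq: "W +> \<pi> a = W +> \<pi> b \<longleftrightarrow> a - b \<in> \<pi> -` W" for a b
    using mem[where a = b and b = a] a_repr_independence[of "\<pi> a" W "\<pi> b"] a_rcos_self[of "\<pi> a"] carr a_subgroup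
    by metis
  \<comment> \<open>The action on a coset is a union over its elements; it collapses because all the
    cosets in the union coincide.\<close>
  have "(\<Union>v\<in>W +> \<pi> a. W +> (cl c \<odot> v)) = W +> \<pi> (c * a)" for c a
  proof -
    have "W +> (cl c \<odot> v) = W +> \<pi> (c * a)" if v: "v \<in> W +> \<pi> a" for v
    proof -
      from v a_rcosetsI[of W "\<pi> a"] a_rcosets_carrier carr a_subset have "v \<in> carrier M" by blast
      then obtain b where b: "v = \<pi> b" by (auto simp: presents_carrier)
      with v mem have "b - a \<in> \<pi> -` W" by simp
      then have "c * (b - a) \<in> \<pi> -` W" by (rule left_ideal_mult[OF J'(1)])
      then show ?thesis by (simp add: b presents_smult eq algebra_simps)
    qed
    then show ?thesis using a_rcos_self[OF carr, of a] by blast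
  qed
  moreover have "W +> \<pi> 0 = W"
    using a_rcos_const[of "\<pi> 0"] presents_zero zero_closed by (metis additive_subgroup.zero_closed is_additive_subgroup)
  ultimately show ?thesis
    unfolding presents_def quotient_module_def
    using eq carr by (auto simp: A_RCOSETS_def' presents_carrier a_rcos_sum presents_add presents_smult)
qed

text \<open>Taking preimages matches the submodules of \<open>A/J\<close> with the left ideals above
  J, so simplicity is maximality of J.\<close>

lemma presents_simple_iff:
  assumes R: "carrier R = range cl"
  shows "simple_module R M \<longleftrightarrow>
    J \<noteq> UNIV \<and> (\<forall>J'. left_ideal J' \<longrightarrow> J \<subseteq> J' \<longrightarrow> J' = J \<or> J' = UNIV)"
proof -
  have JW: "J = \<pi> -` {\<zero>}"
    using presents_eq_iff[of _ 0] by (auto simp: presents_zero)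
  have UW: "UNIV = \<pi> -` carrier M" by (auto simp: presents_carrier)
  have inj: "W = W' \<longleftrightarrow> \<pi> -` W = \<pi> -` W'" if "W \<subseteq> carrier M" "W' \<subseteq> carrier M" for W W'
    using that by (metis image_vimage_eq inf.absorb1 presents_carrier)
  have z: "{\<zero>} \<subseteq> carrier M" by (auto simp: presents_carrier presents_zero)
  have sub: "W \<subseteq> carrier M" if "Module.submodule W R M" for W
    using presents_submodule_vimage(3)[OF R that] by (auto simp: presents_carrier)
  have "(\<forall>W. Module.submodule W R M \<longrightarrow> W = {\<zero>} \<or> W = carrier M) \<longleftrightarrow>
        (\<forall>J'. left_ideal J' \<longrightarrow> J \<subseteq> J' \<longrightarrow> J' = J \<or> J' = UNIV)"
  proof (intro iffI allI impI)
    fix J' assume *: "\<forall>W. Module.submodule W R M \<longrightarrow> W = {\<zero>} \<or> W = carrier M"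
      and J': "left_ideal J'" "J \<subseteq> J'"
    from * presents_submodule_image[OF R J'(1)]
    have "\<pi> ` J' = {\<zero>} \<or> \<pi> ` J' = carrier M" by blast
    then have "\<pi> -` (\<pi> ` J') = \<pi> -` {\<zero>} \<or> \<pi> -` (\<pi> ` J') = \<pi> -` carrier M" by metis
    then show "J' = J \<or> J' = UNIV" using JW UW presents_vimage_image[OF J'] by simp
  next
    fix W assume *: "\<forall>J'. left_ideal J' \<longrightarrow> J \<subseteq> J' \<longrightarrow> J' = J \<or> J' = UNIV"
      and W: "Module.submodule W R M"
    have "\<pi> -` W = J \<or> \<pi> -` W = UNIV"
      using * presents_submodule_vimage[OF R W] by simp
    then show "W = {\<zero>} \<or> W = carrier M"
      using inj[OF sub[OF W] z] inj[OF sub[OF W] order_refl] JW UW by simp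
  qed
  moreover have "carrier M \<noteq> {\<zero>} \<longleftrightarrow> J \<noteq> UNIV"
    using inj[OF order_refl z] JW UW by (simp add: eq_commute[of UNIV])
  ultimately show ?thesis
    unfolding simple_module_def by (simp only:)
qed

end

text \<open>The definite description of W needs uniqueness. If the quotient by V is simple, the
  preimage of V is maximal among proper left ideals; \<open>unique\<close> places it inside
  \<open>J'\<close>, and maximality then forces equality.\<close>

lemma presents_unique_simple_quotient:
  fixes cl :: "'a::ring_1 \<Rightarrow> 'r" and M :: "('r, 'v, 'm) module_scheme" (structure)
  assumes pres: "presents cl \<pi> M J"
    and R: "carrier R = range cl"
    and J': "left_ideal J'" "J \<subseteq> J'" "J' \<noteq> UNIV"
    and unique: "\<And>K. left_ideal K \<Longrightarrow> J \<subseteq> K \<Longrightarrow> K \<noteq> UNIV \<Longrightarrow> K \<subseteq> J'"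
  defines "W \<equiv> THE W. Module.submodule W R M \<and> simple_module R (quotient_module M W)"
  shows "presents cl (\<lambda>a. W +> \<pi> a) (quotient_module M W) J'"
proof -
  have sub: "Module.submodule (\<pi> ` J') R M"
    by (rule presents_submodule_image[OF pres R J'(1)])
  have simple_iff: "simple_module R (quotient_module M W) \<longleftrightarrow> \<pi> -` W \<noteq> UNIV \<and>
      (\<forall>K. left_ideal K \<longrightarrow> \<pi> -` W \<subseteq> K \<longrightarrow> K = \<pi> -` W \<or> K = UNIV)"
    if "Module.submodule W R M" for W
    using presents_simple_iff[OF presents_quotient[OF pres R that] R] .
  have "W = \<pi> ` J'"
    unfolding W_def
  proof (rule the_equality)
    show "Module.submodule (\<pi> ` J') R M \<and> simple_module R (quotient_module M (\<pi> ` J'))"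
      using sub J' unique by (subst simple_iff) (auto simp: presents_vimage_image[OF pres])
    fix V assume V: "Module.submodule V R M \<and> simple_module R (quotient_module M V)"
    then have V': "Module.submodule V R M" by simp
    note v = presents_submodule_vimage[OF pres R V']
    have "\<pi> -` V \<noteq> UNIV" and max: "\<forall>K. left_ideal K \<longrightarrow> \<pi> -` V \<subseteq> K \<longrightarrow> K = \<pi> -` V \<or> K = UNIV"
      using V simple_iff[OF V'] by auto
    then have "\<pi> -` V \<subseteq> J'" using unique v by blast
    with max J' have "J' = \<pi> -` V" by blast
    then show "V = \<pi> ` J'" using v(3) by simp
  qed
  then show ?thesis
    using presents_quotient[OF pres R sub] by (simp add: presents_vimage_image[OF pres J'(1,2)])
qed

section \<open>Dimension and trace of a diagonal operator\<close>

lemma ground_space_simps [simp]: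
  "carrier ground_space = UNIV" "add ground_space = (+)" "smult ground_space = (*)"
  "\<zero>\<^bsub>ground_space\<^esub> = 0"
  by (simp_all add: ground_space_def)

lemma module_hom_ground_zero:
  fixes V :: "('k::field, 'v, 'm) module_scheme"
  assumes "vectorspace class_ring V" and f: "f \<in> LinearCombinations.module_hom class_ring V ground_space"
  shows "f \<zero>\<^bsub>V\<^esub> = 0"
proof -
  interpret vectorspace "class_ring :: 'k ring" V by fact
  show ?thesis
    using LinearCombinations.module_hom_smult[OF f, of 0 "\<zero>\<^bsub>V\<^esub>"] smult_r_null[of 0]
    by (simp add: class_ring_simps)
qed

lemma module_hom_lincomb:
  fixes V :: "('k::field, 'v, 'm) module_scheme"
  assumes vs: "vectorspace class_ring V" and f: "f \<in> LinearCombinations.module_hom class_ring V ground_space"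
    and "finite A" and "A \<subseteq> carrier V"
  shows "f (module.lincomb V a A) = (\<Sum>v\<in>A. a v * f v)"
proof -
  interpret vectorspace "class_ring :: 'k ring" V by fact
  note [simp] = class_ring_simps
  show ?thesis
    using assms(3,4) unfolding lincomb_def
  proof (induction A rule: finite_induct)
    case empty
    then show ?case using module_hom_ground_zero[OF vs f] by simp
  next
    case (insert v A)
    then have closed: "a w \<odot>\<^bsub>V\<^esub> w \<in> carrier V" if "w \<in> insert v A" for w
      using that by (intro smult_closed) auto
    then have "(\<Oplus>\<^bsub>V\<^esub>w\<in>insert v A. a w \<odot>\<^bsub>V\<^esub> w) = (a v \<odot>\<^bsub>V\<^esub> v) \<oplus>\<^bsub>V\<^esub> (\<Oplus>\<^bsub>V\<^esub>w\<in>A. a w \<odot>\<^bsub>V\<^esub> w)"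
      using insert.hyps by (intro M.finsum_insert) auto
    moreover have "(\<Oplus>\<^bsub>V\<^esub>w\<in>A. a w \<odot>\<^bsub>V\<^esub> w) \<in> carrier V"
      using closed by (intro M.finsum_closed) auto
    moreover have "f (a v \<odot>\<^bsub>V\<^esub> v) = a v * f v"
      using LinearCombinations.module_hom_smult[OF f, of "a v" v] insert.prems by simp
    ultimately show ?case
      using insert LinearCombinations.module_hom_add[OF f closed] by simp
  qed
qed

text \<open>Coordinates with respect to a basis are unique, hence linear, and so they are the
  functionals that the description in \<open>dual_vector\<close> selects.\<close>

lemma dual_vector_basis:
  fixes V :: "('k::field, 'v, 'm) module_scheme"
  assumes vs: "vectorspace class_ring V" and finB: "finite B"
    and basis: "vectorspace.basis class_ring V B"
  shows dual_vector_in: "b \<in> B \<Longrightarrow> dual_vector V B b \<in> LinearCombinations.module_hom class_ring V ground_space"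
    and dual_vector_extensional: "b \<in> B \<Longrightarrow> dual_vector V B b \<in> dual_space V"
    and dual_vector_lincomb: "x \<in> carrier V \<Longrightarrow> module.lincomb V (\<lambda>b. dual_vector V B b x) B = x"
proof -
  interpret vectorspace "class_ring :: 'k ring" V by fact
  note [simp] = class_ring_simps
  have B: "B \<subseteq> carrier V" using basis by (simp add: basis_def)
  have ex1: "\<exists>!a. a \<in> B \<rightarrow>\<^sub>E UNIV \<and> lincomb a B = v" if "v \<in> carrier V" for v
    using basis_criterion[OF finB B, THEN iffD1, OF basis] that by simp
  \<comment> \<open>The coordinate tuple of v. Its linearity and its values on B all follow from
    \<open>c_eq\<close>: any tuple that represents v agrees with \<open>c v\<close> on B.\<close>
  define c where "c v = (THE a. a \<in> B \<rightarrow>\<^sub>E UNIV \<and> lincomb a B = v)" for v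
  have c: "lincomb (c v) B = v" "c v \<in> B \<rightarrow>\<^sub>E UNIV" if "v \<in> carrier V" for v
    using theI'[OF ex1[OF that]] unfolding c_def by auto
  have c_eq: "c v b = a b" if "lincomb a B = v" "b \<in> B" for v a b
  proof -
    have v: "v \<in> carrier V" using that B by auto
    have "lincomb (restrict a B) B = v"
      using that(1) B lincomb_cong[OF refl B, of "restrict a B" a] by simp
    then have "c v = restrict a B"
      using ex1[OF v] c[OF v] by (metis PiE_restrict UNIV_I restrict_PiE_iff)
    then show ?thesis using that(2) by simp
  qed
  have c_add: "c (v \<oplus>\<^bsub>V\<^esub> w) b = c v b + c w b" if "v \<in> carrier V" "w \<in> carrier V" "b \<in> B" for v w b
    using that lincomb_sum[OF finB B, of "c v" "c w"] by (intro c_eq) (auto simp: c)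
  have c_smult: "c (t \<odot>\<^bsub>V\<^esub> v) b = t * c v b" if "v \<in> carrier V" "b \<in> B" for t v b
    using that lincomb_smult[OF B, of "c v" t] by (intro c_eq) (auto simp: c)
  have c_basis: "c b' b = (if b' = b then 1 else 0)" if "b \<in> B" "b' \<in> B" for b b'
  proof (rule c_eq)
    have b': "b' \<in> carrier V" using that B by auto
    have "lincomb (\<lambda>b. if b' = b then 1 else 0) B
        = (\<Oplus>\<^bsub>V\<^esub>b\<in>B. if b' = b then b else \<zero>\<^bsub>V\<^esub>)"
      unfolding lincomb_def using B b' smult_one smult_l_null
      by (intro M.finsum_cong') auto
    also have "\<dots> = b'" using M.finsum_singleton[OF that(2) finB, of "\<lambda>b. b"] B by auto
    finally show "lincomb (\<lambda>b. if b' = b then 1 else 0) B = b'" .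
  qed (use that in auto)
  have dual: "dual_vector V B b = restrict (\<lambda>v. c v b) (carrier V)"
    and dual_in: "restrict (\<lambda>v. c v b) (carrier V) \<in> dual_space V" if "b \<in> B" for b
  proof -
    show in_dual: "restrict (\<lambda>v. c v b) (carrier V) \<in> dual_space V"
      using that by (auto simp: dual_space_def LinearCombinations.module_hom_def c_add c_smult)
    show "dual_vector V B b = restrict (\<lambda>v. c v b) (carrier V)"
      unfolding dual_vector_def
    proof (rule the_equality)
      show "restrict (\<lambda>v. c v b) (carrier V) \<in> dual_space V \<and>
          (\<forall>b'\<in>B. restrict (\<lambda>v. c v b) (carrier V) b' = (if b' = b then 1 else 0))"
        using in_dual B that by (auto simp: c_basis)
      fix f assume f: "f \<in> dual_space V \<and> (\<forall>b'\<in>B. f b' = (if b' = b then 1 else 0))"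
      have "f v = c v b" if v: "v \<in> carrier V" for v
      proof -
        have "f v = f (lincomb (c v) B)" using c[OF v] by simp
        also have "\<dots> = (\<Sum>b'\<in>B. c v b' * f b')"
          using f finB B by (intro module_hom_lincomb[OF vs]) (auto simp: dual_space_def)
        also have "\<dots> = (\<Sum>b'\<in>B. if b' = b then c v b' else 0)"
          using f by (intro sum.cong) auto
        finally show ?thesis using finB \<open>b \<in> B\<close> by simp
      qed
      then show "f = restrict (\<lambda>v. c v b) (carrier V)"
        using f by (intro extensionalityI[of _ "carrier V"]) (auto simp: dual_space_def)
    qed
  qed
  show "b \<in> B \<Longrightarrow> dual_vector V B b \<in> dual_space V"
    using dual dual_in by simp
  then show "b \<in> B \<Longrightarrow> dual_vector V B b \<in> LinearCombinations.module_hom class_ring V ground_space"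
    by (simp add: dual_space_def)
  show "lincomb (\<lambda>b. dual_vector V B b x) B = x" if x: "x \<in> carrier V"
  proof -
    have "lincomb (\<lambda>b. dual_vector V B b x) B = lincomb (c x) B"
      using x B by (intro lincomb_cong) (auto simp: dual)
    then show ?thesis using c[OF x] by simp
  qed
qed

section \<open>Dimension and trace of \<open>A/J\<close> from coordinate functionals\<close>

lemma
  shows scal_0 [simp]: "scal 0 = 0" and scal_1 [simp]: "scal 1 = 1"
    and scal_add: "scal (s + t) = scal s + scal t"
    and scal_mult: "scal (s * t) = scal s * scal t"
    and scal_uminus: "scal (- s) = - scal s"
  by (simp_all add: scal_def single_add mult_single single_uminus)

text \<open>The functionals \<open>l p\<close> are the coordinates on \<open>M = A/J\<close> with respect to the basis formed by
  the classes of the elements \<open>u p\<close>.\<close>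

lemma presents_dimension:
  fixes q :: "'k::field" and M :: "('k free_alg set, 'v, 'm) module_scheme"
    and l :: "'p \<Rightarrow> 'k free_alg \<Rightarrow> 'k"
  assumes pres: "presents (uq_class q N) \<pi> M J"
    and finP: "finite P"
    and l_add: "\<And>p a b. l p (a + b) = l p a + l p b"
    and l_scal: "\<And>p c a. l p (scal c * a) = c * l p a"
    and J: "J = {a. \<forall>p\<in>P. l p a = 0}"
    and u: "\<And>p p'. p \<in> P \<Longrightarrow> p' \<in> P \<Longrightarrow> l p (u p') = (if p = p' then 1 else 0)"
  shows "vectorspace class_ring (underlying_space q N M)"
    and "uq_fin_dim q N M"
    and "uq_dim q N M = card P"
    and "(\<And>p a. p \<in> P \<Longrightarrow> l p (gk I1 ^ (N div 2) * gk I2 ^ (N div 2) * a) = e p * l p a) \<Longrightarrow>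
        uq_qdim q N M = (\<Sum>p\<in>P. e p)"
proof -
  define S where "S = underlying_space q N M"
  note presD = presentsD[OF pres]
  have carr: "carrier S = range \<pi>" and add: "\<pi> a \<oplus>\<^bsub>S\<^esub> \<pi> b = \<pi> (a + b)"
    and zero: "\<zero>\<^bsub>S\<^esub> = \<pi> 0" and smult: "c \<odot>\<^bsub>S\<^esub> \<pi> a = \<pi> (scal c * a)" for a b c
    by (simp_all add: S_def underlying_space_def presD)
  show vs: "vectorspace class_ring (underlying_space q N M)"
    unfolding S_def[symmetric]
  proof (rule vs_criteria[OF class_field])
    show "\<forall>v\<in>carrier S. \<exists>neg_v\<in>carrier S. v \<oplus>\<^bsub>S\<^esub> neg_v = \<zero>\<^bsub>S\<^esub>"
    proof
      fix v assume "v \<in> carrier S"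
      then obtain a where "v = \<pi> a" by (auto simp: carr)
      then show "\<exists>neg_v\<in>carrier S. v \<oplus>\<^bsub>S\<^esub> neg_v = \<zero>\<^bsub>S\<^esub>"
        by (intro bexI[of _ "\<pi> (- a)"]) (auto simp: carr add zero)
    qed
  qed (auto simp: carr add zero smult scal_mult scal_add algebra_simps)
  then interpret vectorspace "class_ring :: 'k ring" S by (simp add: S_def)
  note [simp] = class_ring_simps
  have l_diff: "l p (a - b) = l p a - l p b" for p a b
    using l_add[of p a "- b"] l_scal[of p "-1" b] by (simp add: scal_uminus)
  have l_sum: "l p (sum g A) = (\<Sum>x\<in>A. l p (g x))" for p and g :: "'z \<Rightarrow> 'k free_alg" and A
    using l_scal[of p 0 0] by (induction A rule: infinite_finite_induct) (auto simp: l_add)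
  have pi_eq: "\<pi> a = \<pi> b \<longleftrightarrow> (\<forall>p\<in>P. l p a = l p b)" for a b
    by (simp add: presD J l_diff)
  \<comment> \<open>The functional induced by \<open>l p\<close> on the quotient. For p in P the
    choice of preimage is harmless, because \<open>l p\<close> vanishes on J.\<close>
  define \<psi> where "\<psi> p x = l p (inv_into UNIV \<pi> x)" for p x
  have \<psi>: "\<psi> p (\<pi> a) = l p a" if "p \<in> P" for p a
    using f_inv_into_f[of "\<pi> a" \<pi> UNIV] that by (auto simp: \<psi>_def pi_eq)
  have \<psi>_hom: "\<psi> p \<in> LinearCombinations.module_hom class_ring S ground_space" if "p \<in> P" for p
    using that by (auto simp: LinearCombinations.module_hom_def carr add smult \<psi> l_add l_scal)
  define U where "U = (\<lambda>p. \<pi> (u p)) ` P"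
  have inj: "inj_on (\<lambda>p. \<pi> (u p)) P"
    using u by (intro inj_onI) (metis pi_eq zero_neq_one)
  have inv: "inv_into P (\<lambda>p. \<pi> (u p)) (\<pi> (u p)) = p" if "p \<in> P" for p
    using inv_into_f_f[OF inj that] by simp
  have U: "U \<subseteq> carrier S" "finite U" using finP by (auto simp: U_def carr)
  \<comment> \<open>The functionals \<open>\<psi> p\<close> separate the points of S, so a vector is
    recovered from its values under them.\<close>
  have expand: "lincomb a U = x" if a: "\<forall>p\<in>P. a (\<pi> (u p)) = \<psi> p x" and x: "x \<in> carrier S" for a x
  proof -
    obtain y z where y: "lincomb a U = \<pi> y" and z: "x = \<pi> z"
      using x U lincomb_closed[of U a] by (auto simp: carr)
    have "l p y = l p z" if p: "p \<in> P" for p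
    proof -
      have "l p y = \<psi> p (lincomb a U)" by (simp add: y \<psi> p)
      also have "\<dots> = (\<Sum>v\<in>U. a v * \<psi> p v)"
        using U by (intro module_hom_lincomb \<psi>_hom p) (unfold_locales, auto)
      also have "\<dots> = (\<Sum>p'\<in>P. if p = p' then a (\<pi> (u p')) else 0)"
        unfolding U_def using inj p by (subst sum.reindex) (auto simp: \<psi> u intro!: sum.cong)
      also have "\<dots> = a (\<pi> (u p))" using finP p by simp
      also have "\<dots> = \<psi> p x" using a p by simp
      finally show ?thesis by (simp add: z \<psi> p)
    qed
    then show ?thesis by (simp add: y z pi_eq)
  qed
  have basisU: "basis U"
    unfolding basis_def
  proof (intro conjI)
    show "lin_indpt U"
    proof (rule finite_lin_indpt2[OF U(2,1)])
      fix a assume a: "lincomb a U = \<zero>\<^bsub>S\<^esub>"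
      have "a (\<pi> (u p)) = 0" if p: "p \<in> P" for p
      proof -
        have "0 = \<psi> p (lincomb a U)"
          using l_scal[of p 0 0] p by (simp add: a zero \<psi>)
        also have "\<dots> = (\<Sum>v\<in>U. a v * \<psi> p v)"
          using U by (intro module_hom_lincomb \<psi>_hom p) (unfold_locales, auto)
        also have "\<dots> = (\<Sum>p'\<in>P. if p = p' then a (\<pi> (u p')) else 0)"
          unfolding U_def using inj p by (subst sum.reindex) (auto simp: \<psi> u intro!: sum.cong)
        finally show ?thesis using finP p by simp
      qed
      then show "\<forall>v\<in>U. a v = \<zero>\<^bsub>class_ring\<^esub>" by (auto simp: U_def)
    qed
    have "x \<in> span U" if x: "x \<in> carrier S" for x
    proof -
      let ?a = "\<lambda>v. \<psi> (inv_into P (\<lambda>p. \<pi> (u p)) v) x"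
      have L: "lincomb ?a U = x"
        using x inv by (intro expand) auto
      show ?thesis
        unfolding span_def
        by (rule CollectI, rule exI[of _ ?a], rule exI[of _ U]) (use L U in auto)
    qed
    then show "gen_set U" using span_is_subset2[OF U(1)] by auto
    show "U \<subseteq> carrier S" by fact
  qed
  show fin_dim: "uq_fin_dim q N M"
    using basisU U by (auto simp: uq_fin_dim_def fin_dim_def basis_def simp flip: S_def)
  show "uq_dim q N M = card P"
    using dim_basis[OF U(2) basisU] card_image[OF inj] by (simp add: uq_dim_def U_def flip: S_def)
  assume e: "\<And>p a. p \<in> P \<Longrightarrow> l p (gk I1 ^ (N div 2) * gk I2 ^ (N div 2) * a) = e p * l p a"
  define B where "B = (SOME B. finite B \<and> basis B)"
  have B: "finite B" "basis B"
    using someI_ex[OF finite_basis_exists] fin_dim by (auto simp: B_def uq_fin_dim_def simp flip: S_def)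
  then have Bc: "B \<subseteq> carrier S" by (simp add: basis_def)
  note dual = dual_vector_basis[OF vs[folded S_def] B]
  have nu: "uq_nu q N \<odot>\<^bsub>M\<^esub> b \<in> carrier S"
    "\<And>p. p \<in> P \<Longrightarrow> \<psi> p (uq_nu q N \<odot>\<^bsub>M\<^esub> b) = e p * \<psi> p b" if b: "b \<in> carrier S" for b
  proof -
    obtain a where "b = \<pi> a" using b by (auto simp: carr)
    then show "uq_nu q N \<odot>\<^bsub>M\<^esub> b \<in> carrier S"
      "\<And>p. p \<in> P \<Longrightarrow> \<psi> p (uq_nu q N \<odot>\<^bsub>M\<^esub> b) = e p * \<psi> p b"
      by (simp_all add: carr uq_nu_def presD(5) \<psi> e)
  qed
  \<comment> \<open>B is an arbitrary basis, while the coordinates are adapted to U. The image of b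
    under \<open>uq_nu\<close> is expanded in U, where it just scales each coordinate by
    \<open>e p\<close>. Once the sums are exchanged, the sum over B is \<open>\<psi> p\<close>
    applied to the expansion of the class of \<open>u p\<close> in B, which is 1.\<close>
  have "uq_qdim q N M = (\<Sum>b\<in>B. dual_vector S B b (uq_nu q N \<odot>\<^bsub>M\<^esub> b))"
    unfolding uq_qdim_def Let_def pivotal_def S_def[symmetric] B_def[symmetric]
    using dual by (intro sum.cong) auto
  also have "\<dots> = (\<Sum>b\<in>B. \<Sum>p\<in>P. e p * \<psi> p b * dual_vector S B b (\<pi> (u p)))"
  proof (intro sum.cong refl)
    fix b assume b: "b \<in> B"
    then have bc: "b \<in> carrier S" using Bc by auto
    define a where "a v = (let p = inv_into P (\<lambda>p. \<pi> (u p)) v in e p * \<psi> p b)" for v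
    have a: "a (\<pi> (u p)) = e p * \<psi> p b" if "p \<in> P" for p
      using inv that by (simp add: a_def)
    have "uq_nu q N \<odot>\<^bsub>M\<^esub> b = lincomb a U"
      using nu[OF bc] a by (intro expand[symmetric]) auto
    also have "dual_vector S B b \<dots> = (\<Sum>v\<in>U. a v * dual_vector S B b v)"
      using U dual(1)[OF b] by (intro module_hom_lincomb) (unfold_locales, auto)
    also have "\<dots> = (\<Sum>p\<in>P. e p * \<psi> p b * dual_vector S B b (\<pi> (u p)))"
      unfolding U_def using inj by (subst sum.reindex) (auto simp: a intro!: sum.cong)
    finally show "dual_vector S B b (uq_nu q N \<odot>\<^bsub>M\<^esub> b) = \<dots>" .
  qed
  also have "\<dots> = (\<Sum>p\<in>P. e p * (\<Sum>b\<in>B. dual_vector S B b (\<pi> (u p)) * \<psi> p b))"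
    by (subst sum.swap) (simp add: sum_distrib_left mult_ac)
  also have "\<dots> = (\<Sum>p\<in>P. e p)"
  proof (intro sum.cong refl)
    fix p assume p: "p \<in> P"
    have "(\<Sum>b\<in>B. dual_vector S B b (\<pi> (u p)) * \<psi> p b)
        = \<psi> p (lincomb (\<lambda>b. dual_vector S B b (\<pi> (u p))) B)"
      using B Bc by (intro module_hom_lincomb[symmetric] \<psi>_hom p) (unfold_locales, auto)
    also have "\<dots> = 1" using dual(3)[of "\<pi> (u p)"] p by (simp add: carr \<psi> u)
    finally show "e p * (\<Sum>b\<in>B. dual_vector S B b (\<pi> (u p)) * \<psi> p b) = e p" by simp
  qed
  finally show "uq_qdim q N M = (\<Sum>p\<in>P. e p)" .
qed

section \<open>The quotient algebra\<close>

lemma poly_mapping_single_induct [case_names single add]: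
  fixes a :: "'a \<Rightarrow>\<^sub>0 'b::comm_monoid_add"
  assumes single: "\<And>w c. P (Poly_Mapping.single w c)"
    and add: "\<And>a b. P a \<Longrightarrow> P b \<Longrightarrow> P (a + b)"
  shows "P a"
proof (induction a rule: update_induct)
  case const
  then show ?case using single[of undefined 0] by simp
next
  case (update f k c)
  have "Poly_Mapping.update k c f = Poly_Mapping.single k c + f"
    using update.hyps
    by (intro poly_mapping_eqI) (auto simp: lookup_update lookup_add lookup_single in_keys_iff when_def)
  then show ?case using add[OF single update.IH] by simp
qed

lemma scal_commute: "scal c * a = a * scal c" for a :: "'k::field free_alg"
proof (induction a rule: poly_mapping_single_induct)
  case (single w s)
  then show ?case by (simp add: scal_def mult_single mult.commute)
qed (simp add: algebra_simps)

lemma uq_ideal_ideal: "ideal (uq_ideal q N) class_ring"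
  unfolding uq_ideal_def by (rule ring.genideal_ideal[OF class_ring.ring_axioms]) simp

lemma uq_relations_subset: "uq_relations q N \<subseteq> uq_ideal q N"
  unfolding uq_ideal_def by (rule ring.genideal_self[OF class_ring.ring_axioms]) simp

lemma uq_ideal_left_ideal: "left_ideal (uq_ideal q N)"
proof -
  interpret ideal "uq_ideal q N" class_ring by (rule uq_ideal_ideal)
  show ?thesis
    unfolding left_ideal_def using zero_closed a_closed I_l_closed by (auto simp: class_ring_simps)
qed

lemma uq_ideal_right: "a \<in> uq_ideal q N \<Longrightarrow> a * c \<in> uq_ideal q N"
  using ideal.I_r_closed[OF uq_ideal_ideal, of a q N c] by simp

lemma uq_ideal_minimal:
  fixes q :: "'k::field"
  assumes "left_ideal K" and "\<And>a c. a \<in> K \<Longrightarrow> a * c \<in> K" and "uq_relations q N \<subseteq> K"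
  shows "uq_ideal q N \<subseteq> K"
  unfolding uq_ideal_def
proof (rule ring.genideal_minimal[OF class_ring.ring_axioms])
  show "ideal K class_ring"
  proof (rule idealI[OF class_ring.ring_axioms])
    have inv: "inv\<^bsub>add_monoid class_ring\<^esub> a = - a" for a :: "'k free_alg"
      unfolding a_inv_def[symmetric] by (simp add: class_ring_simps)
    show "subgroup K (add_monoid class_ring)"
    proof (rule group.subgroupI[OF abelian_group.a_group[OF class_ring.abelian_group_axioms]])
      show "inv\<^bsub>add_monoid class_ring\<^esub> a \<in> K" if "a \<in> K" for a
        unfolding inv using that by (rule left_ideal_uminus[OF assms(1)])
    qed (use left_idealD[OF assms(1)] in auto)
  qed (use left_idealD[OF assms(1)] assms(2) in auto)
qed fact

lemma
  shows uq_carrier: "carrier (uq q N) = range (uq_class q N)"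
    and uq_class_eq_iff: "uq_class q N a = uq_class q N b \<longleftrightarrow> a - b \<in> uq_ideal q N"
    and uq_class_mem_iff: "a \<in> uq_class q N b \<longleftrightarrow> a - b \<in> uq_ideal q N"
    and uq_class_add: "uq_class q N a \<oplus>\<^bsub>uq q N\<^esub> uq_class q N b = uq_class q N (a + b)"
    and uq_class_mult: "uq_class q N a \<otimes>\<^bsub>uq q N\<^esub> uq_class q N b = uq_class q N (a * b)"
    and uq_class_one: "\<one>\<^bsub>uq q N\<^esub> = uq_class q N 1"
    and uq_ring: "ring (uq q N)"
    and uq_class_uminus: "\<ominus>\<^bsub>uq q N\<^esub> uq_class q N a = uq_class q N (- a)"
proof -
  interpret ideal "uq_ideal q N" class_ring by (rule uq_ideal_ideal)
  show carr: "carrier (uq q N) = range (uq_class q N)"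
    by (auto simp: uq_def FactRing_def A_RCOSETS_def' uq_class_def)
  show mem: "a \<in> uq_class q N b \<longleftrightarrow> a - b \<in> uq_ideal q N" for a b
    using a_rcos_module[of b a] by (simp add: uq_class_def class_ring_simps)
  show "uq_class q N a = uq_class q N b \<longleftrightarrow> a - b \<in> uq_ideal q N"
    using mem[of a b] abelian_group.a_repr_independence[OF class_ring.abelian_group_axioms, of a "uq_ideal q N" b] a_rcos_self[of a] a_subgroup
    unfolding uq_class_def by auto
  show add: "uq_class q N a \<oplus>\<^bsub>uq q N\<^esub> uq_class q N b = uq_class q N (a + b)" for a b
    using ring_hom_add[OF rcos_ring_hom, of a b] by (simp add: uq_def uq_class_def)
  show "uq_class q N a \<otimes>\<^bsub>uq q N\<^esub> uq_class q N b = uq_class q N (a * b)"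
    using ring_hom_mult[OF rcos_ring_hom, of a b] by (simp add: uq_def uq_class_def)
  show "\<one>\<^bsub>uq q N\<^esub> = uq_class q N 1"
    using ring_hom_one[OF rcos_ring_hom] by (simp add: uq_def uq_class_def)
  show ring: "ring (uq q N)"
    using quotient_is_ring by (simp add: uq_def)
  interpret U: ring "uq q N" by fact
  have zero: "\<zero>\<^bsub>uq q N\<^esub> = uq_class q N 0"
    using add[of 0 0] carr U.add.r_cancel_one[of "uq_class q N 0" "uq_class q N 0"] by simp
  show "\<ominus>\<^bsub>uq q N\<^esub> uq_class q N a = uq_class q N (- a)"
    by (rule U.minus_equality) (auto simp: add zero carr)
qed

lemma uq_plus_cases:
  assumes "C \<in> uq_plus q N"
  obtains a where "C = uq_class q N a"
proof -
  have "uq_plus q N \<subseteq> carrier (uq q N)"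
    unfolding uq_plus_def
    by (rule ring.generate_ring_incl[OF uq_ring]) (auto simp: uq_carrier)
  then show ?thesis using assms that by (auto simp: uq_carrier)
qed

lemma uq_plus_gens:
  shows "uq_class q N (scal c) \<in> uq_plus q N" "uq_class q N (gx a) \<in> uq_plus q N"
    and "uq_class q N (gk a) \<in> uq_plus q N"
  unfolding uq_plus_def by (cases a; auto intro: generate_ring.incl)+

section \<open>Standard modules\<close>

text \<open>\<open>K\<close> plays the role of the annihilator of a highest weight vector.\<close>

locale highest_weight =
  fixes q :: "'k::field" and N i j :: nat and K :: "'k free_alg set"
  assumes left_ideal: "left_ideal K"
    and proper: "1 \<notin> K"
    and ideal_subset: "uq_ideal q N \<subseteq> K"
    and gx_mem: "gx a \<in> K"
    and gk1_mem: "gk I1 - scal (q ^ i) \<in> K"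
    and gk2_mem: "gk I2 - scal (q ^ j) \<in> K"
begin

lemmas K_simps = left_idealD[OF left_ideal]

section \<open>The character of the Borel part\<close>

lemma scal_mem_iff: "scal s \<in> K \<longleftrightarrow> s = 0"
proof
  assume "scal s \<in> K"
  then have *: "scal (inverse s) * scal s \<in> K" by (rule K_simps)
  show "s = 0"
  proof (rule ccontr)
    assume "s \<noteq> 0"
    then show False using * proper by (simp flip: scal_mult)
  qed
qed (simp add: K_simps(1))

lemma eigenvalue_unique:
  assumes "a - scal s \<in> K" and "a - scal t \<in> K"
  shows "s = t"
proof -
  have "scal (s - t) = (a - scal t) - (a - scal s)"
    using scal_add[of s "- t"] by (simp add: scal_uminus)
  then have "scal (s - t) \<in> K" using K_simps(5)[OF assms(2,1)] by simp
  then show ?thesis by (simp add: scal_mem_iff)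
qed

text \<open>The scalar by which C acts on the class of 1 in \<open>A/K\<close>. It is unique because
  K is proper, and independent of the representative because K contains
  \<open>uq_ideal q N\<close>.\<close>

definition eigenvalue :: "'k free_alg set \<Rightarrow> 'k" where
  "eigenvalue C = (THE t. \<exists>a\<in>C. a - scal t \<in> K)"

lemma mem_class_cong: "uq_class q N a = uq_class q N b \<Longrightarrow> a - c \<in> K \<Longrightarrow> b - c \<in> K"
  using ideal_subset K_simps(5)[of "a - c" "a - b"] by (auto simp: uq_class_eq_iff)

lemma eigenvalueI:
  assumes "a - scal t \<in> K"
  shows "eigenvalue (uq_class q N a) = t"
  unfolding eigenvalue_def
proof (rule the_equality)
  show "\<exists>b\<in>uq_class q N a. b - scal t \<in> K"
    using assms left_ideal_zero[OF uq_ideal_left_ideal]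
    by (intro bexI[of _ a]) (auto simp: uq_class_mem_iff)
  fix s assume "\<exists>b\<in>uq_class q N a. b - scal s \<in> K"
  then obtain b where "uq_class q N b = uq_class q N a" "b - scal s \<in> K"
    by (auto simp: uq_class_mem_iff uq_class_eq_iff)
  then have "a - scal s \<in> K" by (rule mem_class_cong)
  then show "s = t" using assms eigenvalue_unique by blast
qed

text \<open>The elements acting on the highest weight vector by a scalar form a subring containing
  the generators of the Borel part. In the product case K absorbs factors on the left only, so the
  scalar has to be moved across by \<open>scal_commute\<close>.\<close>

lemma uq_plus_eigenvector:
  assumes "uq_class q N a \<in> uq_plus q N"
  shows "a - scal (eigenvalue (uq_class q N a)) \<in> K"
proof -
  have "\<exists>t. \<exists>b. C = uq_class q N b \<and> b - scal t \<in> K" if "C \<in> uq_plus q N" for C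
    using that unfolding uq_plus_def
  proof (induction rule: generate_ring.induct)
    case one
    show ?case using K_simps(1) by (intro exI[of _ 1]) (auto simp: uq_class_one)
  next
    case (incl h)
    then consider c where "h = uq_class q N (scal c)" | a where "h = uq_class q N (gx a)"
      | "h = uq_class q N (gk I1)" | "h = uq_class q N (gk I2)" by auto
    then show ?case
    proof cases
      case 1 then show ?thesis using K_simps(1) by (metis diff_self)
    next
      case 2 then show ?thesis using gx_mem by (metis diff_zero scal_0)
    qed (use gk1_mem gk2_mem in blast)+
  next
    case (a_inv C)
    then obtain t b where "C = uq_class q N b" "b - scal t \<in> K" by auto
    then show ?case using K_simps(4)[of "b - scal t"]
      by (intro exI[of _ "- t"] exI[of _ "- b"]) (auto simp: uq_class_uminus scal_uminus)
  next
    case (eng_add C D)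
    then obtain s t a b where "C = uq_class q N a" "a - scal s \<in> K" "D = uq_class q N b" "b - scal t \<in> K"
      by auto
    then show ?case using K_simps(2)[of "a - scal s" "b - scal t"]
      by (intro exI[of _ "s + t"] exI[of _ "a + b"]) (auto simp: uq_class_add scal_add algebra_simps)
  next
    case (eng_mult C D)
    then obtain s t a b where C: "C = uq_class q N a" "a - scal s \<in> K"
      and D: "D = uq_class q N b" "b - scal t \<in> K"
      by auto
    have "a * b - scal (t * s) = a * (b - scal t) + scal t * (a - scal s)"
      by (simp add: scal_mult scal_commute[of t a] scal_commute[of s "scal t"] algebra_simps)
    also have "\<dots> \<in> K" using C D K_simps by blast
    finally show ?case
      by (intro exI[of _ "t * s"] exI[of _ "a * b"]) (auto simp: C D uq_class_mult)
  qed
  from this[OF assms] obtain t b where "uq_class q N b = uq_class q N a" "b - scal t \<in> K"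
    by metis
  then have "a - scal t \<in> K" by (rule mem_class_cong)
  then show ?thesis by (simp add: eigenvalueI)
qed

text \<open>Existence of the character comes from K; uniqueness is an induction over the generated
  subring.\<close>

lemma borel_char_eq: "borel_char q N i j = restrict eigenvalue (uq_plus q N)"
proof -
  let ?B = "(uq q N)\<lparr>carrier := uq_plus q N\<rparr>"
  let ?char = "\<lambda>\<chi>. \<chi> \<in> extensional (uq_plus q N) \<and>
     \<chi> \<in> Ring.ring_hom ?B class_ring \<and>
     (\<forall>c. \<chi> (uq_class q N (scal c)) = c) \<and>
     (\<forall>a. \<chi> (uq_class q N (gx a)) = 0) \<and>
     \<chi> (uq_class q N (gk I1)) = q ^ i \<and>
     \<chi> (uq_class q N (gk I2)) = q ^ j"
  have closed: "C \<oplus>\<^bsub>uq q N\<^esub> D \<in> uq_plus q N" "C \<otimes>\<^bsub>uq q N\<^esub> D \<in> uq_plus q N"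
    "\<ominus>\<^bsub>uq q N\<^esub> C \<in> uq_plus q N" "\<one>\<^bsub>uq q N\<^esub> \<in> uq_plus q N"
    if "C \<in> uq_plus q N" "D \<in> uq_plus q N" for C D
    using that unfolding uq_plus_def by (auto intro: generate_ring.intros)
  have hom: "restrict eigenvalue (uq_plus q N) \<in> Ring.ring_hom ?B class_ring"
  proof (rule ring_hom_memI)
    fix C D assume CD: "C \<in> carrier ?B" "D \<in> carrier ?B"
    from CD(1) obtain a where a: "C = uq_class q N a" by (auto elim: uq_plus_cases)
    from CD(2) obtain b where b: "D = uq_class q N b" by (auto elim: uq_plus_cases)
    have aK: "a - scal (eigenvalue C) \<in> K" and bK: "b - scal (eigenvalue D) \<in> K"
      using CD uq_plus_eigenvector a b by auto
    have "a * b - scal (eigenvalue C * eigenvalue D) =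
        a * (b - scal (eigenvalue D)) + scal (eigenvalue D) * (a - scal (eigenvalue C))"
      by (simp add: scal_mult scal_commute[of "eigenvalue D"] algebra_simps)
    also have "\<dots> \<in> K" using aK bK K_simps by blast
    finally have "eigenvalue (C \<otimes>\<^bsub>uq q N\<^esub> D) = eigenvalue C * eigenvalue D"
      unfolding a b uq_class_mult by (rule eigenvalueI)
    then show "restrict eigenvalue (uq_plus q N) (C \<otimes>\<^bsub>?B\<^esub> D) =
        restrict eigenvalue (uq_plus q N) C \<otimes>\<^bsub>class_ring\<^esub> restrict eigenvalue (uq_plus q N) D"
      using CD closed by simp
    have "a + b - scal (eigenvalue C + eigenvalue D) \<in> K"
      using K_simps(2)[OF aK bK] by (simp add: scal_add algebra_simps)
    then have "eigenvalue (C \<oplus>\<^bsub>uq q N\<^esub> D) = eigenvalue C + eigenvalue D"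
      unfolding a b uq_class_add by (rule eigenvalueI)
    then show "restrict eigenvalue (uq_plus q N) (C \<oplus>\<^bsub>?B\<^esub> D) =
        restrict eigenvalue (uq_plus q N) C \<oplus>\<^bsub>class_ring\<^esub> restrict eigenvalue (uq_plus q N) D"
      using CD closed by simp
  next
    have "eigenvalue (uq_class q N 1) = 1" using K_simps(1) by (intro eigenvalueI) simp
    moreover have "uq_class q N 1 \<in> uq_plus q N" using uq_plus_gens(1)[of q N 1] by simp
    ultimately show "restrict eigenvalue (uq_plus q N) \<one>\<^bsub>?B\<^esub> = \<one>\<^bsub>class_ring\<^esub>"
      by (simp add: uq_class_one)
  qed simp
  have gens: "eigenvalue (uq_class q N (scal c)) = c" "eigenvalue (uq_class q N (gx a)) = 0"
    "eigenvalue (uq_class q N (gk I1)) = q ^ i" "eigenvalue (uq_class q N (gk I2)) = q ^ j" for c a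
    using K_simps(1) gx_mem gk1_mem gk2_mem by (auto intro!: eigenvalueI)
  show ?thesis
    unfolding borel_char_def
  proof (rule the_equality)
    show "?char (restrict eigenvalue (uq_plus q N))"
      using hom by (simp add: gens uq_plus_gens)
    fix \<chi> assume \<chi>: "?char \<chi>"
    then have \<chi>_hom: "\<chi> \<in> Ring.ring_hom ?B class_ring" by simp
    have add: "\<chi> (C \<oplus>\<^bsub>uq q N\<^esub> D) = \<chi> C + \<chi> D" and mult: "\<chi> (C \<otimes>\<^bsub>uq q N\<^esub> D) = \<chi> C * \<chi> D"
      if "C \<in> uq_plus q N" "D \<in> uq_plus q N" for C D
      using ring_hom_add[OF \<chi>_hom, of C D] ring_hom_mult[OF \<chi>_hom, of C D] that by simp_all
    have one: "\<chi> \<one>\<^bsub>uq q N\<^esub> = 1" using ring_hom_one[OF \<chi>_hom] by simp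
    have uminus: "\<chi> (\<ominus>\<^bsub>uq q N\<^esub> C) = - \<chi> C" if "C \<in> uq_plus q N" for C
    proof -
      obtain a where a: "C = uq_class q N a" using uq_plus_cases \<open>C \<in> uq_plus q N\<close> by blast
      have "\<chi> (\<ominus>\<^bsub>uq q N\<^esub> C) + \<chi> C = \<chi> (uq_class q N 0)"
        using add[OF closed(3)[OF that that] that] by (simp add: a uq_class_uminus uq_class_add)
      also have "uq_class q N 0 = uq_class q N (scal 0)" by simp
      also have "\<chi> \<dots> = 0" using \<chi> by blast
      finally show ?thesis by (simp add: eq_neg_iff_add_eq_0)
    qed
    note res = ring_hom_add[OF hom] ring_hom_mult[OF hom] ring_hom_one[OF hom]
    have "\<chi> C = eigenvalue C" if "C \<in> uq_plus q N" for C
    proof -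
      have "C \<in> uq_plus q N \<and> \<chi> C = eigenvalue C"
        using that unfolding uq_plus_def
      proof (induction rule: generate_ring.induct)
        case one
        have "eigenvalue (uq_class q N 1) = 1" using K_simps(1) by (intro eigenvalueI) simp
        then show ?case using \<open>\<chi> \<one>\<^bsub>uq q N\<^esub> = 1\<close>
          by (intro conjI generate_ring.one) (simp add: uq_class_one)
      next
        case (incl h)
        then show ?case using \<chi> gens by (auto intro: generate_ring.incl)
      next
        case (a_inv C)
        then have C: "C \<in> uq_plus q N" "\<chi> C = eigenvalue C" by (auto simp: uq_plus_def)
        obtain a where a: "C = uq_class q N a" using uq_plus_cases C by blast
        have "- a - scal (- eigenvalue C) \<in> K"
          using K_simps(4)[OF uq_plus_eigenvector[of a]] C a by (simp add: scal_uminus)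
        then have "eigenvalue (\<ominus>\<^bsub>uq q N\<^esub> C) = - eigenvalue C"
          unfolding a uq_class_uminus by (rule eigenvalueI)
        then show ?case using C closed(3)[OF C(1) C(1)] uminus by (simp add: uq_plus_def)
      next
        case (eng_add C D)
        then have C: "C \<in> uq_plus q N" "\<chi> C = eigenvalue C" "D \<in> uq_plus q N" "\<chi> D = eigenvalue D"
          by (auto simp: uq_plus_def)
        then show ?case using add[of C D] res(1)[of C D] closed(1)[of C D] by (simp add: uq_plus_def)
      next
        case (eng_mult C D)
        then have C: "C \<in> uq_plus q N" "\<chi> C = eigenvalue C" "D \<in> uq_plus q N" "\<chi> D = eigenvalue D"
          by (auto simp: uq_plus_def)
        then show ?case using mult[of C D] res(2)[of C D] closed(2)[of C D] by (simp add: uq_plus_def)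
      qed
      then show ?thesis by simp
    qed
    then show "\<chi> = restrict eigenvalue (uq_plus q N)"
      using \<chi> by (intro extensionalityI[of _ "uq_plus q N"]) auto
  qed
qed

section \<open>The tensor product as a cyclic module\<close>

abbreviation "FG \<equiv> free_Abelian_group (carrier (uq q N) \<times> (UNIV :: 'k set))"

definition "tensor_rels =
  generate FG (tensor_relations (uq q N) (uq_plus q N) (borel_module q N i j))"

text \<open>The symbol of the pure tensor of a and t, before passing to the quotient.\<close>

definition fr :: "'k free_alg \<Rightarrow> 'k \<Rightarrow> ('k free_alg set \<times> 'k \<Rightarrow>\<^sub>0 int)" where
  "fr a t = frag_of (uq_class q N a, t)"

definition tensor_class where "tensor_class a = tensor_rels #>\<^bsub>FG\<^esub> fr a 1"

text \<open>The left ideal J_0: those a for which the tensor of a and 1 is zero.\<close>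

definition standard_ideal :: "'k free_alg set" where
  "standard_ideal = {a. fr a 1 \<in> tensor_rels}"

lemma fr_carrier: "Poly_Mapping.keys (fr a t) \<subseteq> carrier (uq q N) \<times> UNIV"
  by (auto simp: fr_def uq_carrier)

lemma tensor_relations_eq:
  "tensor_relations (uq q N) (uq_plus q N) (borel_module q N i j) =
     {fr (a + b) t - fr a t - fr b t | a b t. True} \<union>
     {fr a (s + t) - fr a s - fr a t | a s t. True} \<union>
     {fr (a * b) t - fr a (eigenvalue (uq_class q N b) * t) | a b t. uq_class q N b \<in> uq_plus q N}"
proof -
  have "{frag_of (C \<oplus>\<^bsub>uq q N\<^esub> D, t) - frag_of (C, t) - frag_of (D, t) | C D t.
      C \<in> carrier (uq q N) \<and> D \<in> carrier (uq q N) \<and> t \<in> carrier (borel_module q N i j)} =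
    {fr (a + b) t - fr a t - fr b t | a b t. True}"
    unfolding fr_def uq_class_add[symmetric] by (auto simp: borel_module_def uq_carrier)
  moreover have "{frag_of (C, s \<oplus>\<^bsub>borel_module q N i j\<^esub> t) - frag_of (C, s) - frag_of (C, t) | C s t.
      C \<in> carrier (uq q N) \<and> s \<in> carrier (borel_module q N i j) \<and> t \<in> carrier (borel_module q N i j)} =
    {fr a (s + t) - fr a s - fr a t | a s t. True}"
    unfolding fr_def by (auto simp: borel_module_def uq_carrier)
  moreover have "{frag_of (C \<otimes>\<^bsub>uq q N\<^esub> B, t) - frag_of (C, B \<odot>\<^bsub>borel_module q N i j\<^esub> t) | C B t.
      C \<in> carrier (uq q N) \<and> B \<in> uq_plus q N \<and> t \<in> carrier (borel_module q N i j)} =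
    {fr (a * b) t - fr a (eigenvalue (uq_class q N b) * t) | a b t. uq_class q N b \<in> uq_plus q N}"
    (is "?L = ?R")
  proof
    show "?L \<subseteq> ?R"
    proof
      fix x assume "x \<in> ?L"
      then obtain C B t where x: "x = frag_of (C \<otimes>\<^bsub>uq q N\<^esub> B, t) - frag_of (C, B \<odot>\<^bsub>borel_module q N i j\<^esub> t)"
        and C: "C \<in> carrier (uq q N)" and B: "B \<in> uq_plus q N" by blast
      from C obtain a where "C = uq_class q N a" by (auto simp: uq_carrier)
      moreover from B obtain b where "B = uq_class q N b" by (rule uq_plus_cases)
      ultimately have "x = fr (a * b) t - fr a (eigenvalue (uq_class q N b) * t)"
        "uq_class q N b \<in> uq_plus q N"
        using x B by (simp_all add: borel_module_def borel_char_eq fr_def uq_class_mult)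
      then show "x \<in> ?R" by blast
    qed
    show "?R \<subseteq> ?L"
    proof
      fix x assume "x \<in> ?R"
      then obtain a b t where x: "x = fr (a * b) t - fr a (eigenvalue (uq_class q N b) * t)"
        and b: "uq_class q N b \<in> uq_plus q N" by blast
      then have "x = frag_of (uq_class q N a \<otimes>\<^bsub>uq q N\<^esub> uq_class q N b, t)
          - frag_of (uq_class q N a, uq_class q N b \<odot>\<^bsub>borel_module q N i j\<^esub> t)"
        by (simp add: borel_module_def borel_char_eq fr_def uq_class_mult)
      moreover have "t \<in> carrier (borel_module q N i j)" by (simp add: borel_module_def)
      moreover have "uq_class q N a \<in> carrier (uq q N)" by (simp add: uq_carrier)
      ultimately show "x \<in> ?L" using b by blast
    qed
  qed
  ultimately show ?thesis unfolding tensor_relations_def by (simp only:)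
qed

lemma tensor_relations_carrier:
  "tensor_relations (uq q N) (uq_plus q N) (borel_module q N i j) \<subseteq> carrier FG"
proof -
  have "Poly_Mapping.keys (x - y) \<subseteq> carrier (uq q N) \<times> UNIV"
    if "Poly_Mapping.keys x \<subseteq> carrier (uq q N) \<times> UNIV" "Poly_Mapping.keys y \<subseteq> carrier (uq q N) \<times> UNIV"
    for x y :: "'k free_alg set \<times> 'k \<Rightarrow>\<^sub>0 int"
    using keys_diff[of x y] that by blast
  then show ?thesis
    unfolding tensor_relations_eq using fr_carrier by fastforce
qed

lemma tensor_rels_subgroup: "subgroup tensor_rels FG"
  unfolding tensor_rels_def
  by (rule group.generate_is_subgroup[OF group_free_Abelian_group tensor_relations_carrier])

lemma tensor_rels_carrier: "x \<in> tensor_rels \<Longrightarrow> Poly_Mapping.keys x \<subseteq> carrier (uq q N) \<times> UNIV"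
  using subgroup.mem_carrier[OF tensor_rels_subgroup] by simp

lemma
  shows tensor_rels_zero: "0 \<in> tensor_rels"
    and tensor_rels_add: "x \<in> tensor_rels \<Longrightarrow> y \<in> tensor_rels \<Longrightarrow> x + y \<in> tensor_rels"
    and tensor_rels_uminus: "x \<in> tensor_rels \<Longrightarrow> - x \<in> tensor_rels"
    and tensor_rels_diff: "x \<in> tensor_rels \<Longrightarrow> y \<in> tensor_rels \<Longrightarrow> x - y \<in> tensor_rels"
proof -
  show "0 \<in> tensor_rels"
    using subgroup.one_closed[OF tensor_rels_subgroup] by simp
  show add: "x \<in> tensor_rels \<Longrightarrow> y \<in> tensor_rels \<Longrightarrow> x + y \<in> tensor_rels" for x y
    using subgroup.m_closed[OF tensor_rels_subgroup, of x y] by simp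
  show uminus: "x \<in> tensor_rels \<Longrightarrow> - x \<in> tensor_rels" for x
    using subgroup.m_inv_closed[OF tensor_rels_subgroup, of x] tensor_rels_carrier[of x] by simp
  show "x \<in> tensor_rels \<Longrightarrow> y \<in> tensor_rels \<Longrightarrow> x - y \<in> tensor_rels"
    using add[of x "- y"] uminus[of y] by simp
qed

lemma
  shows fr_add_left: "fr (a + b) t - fr a t - fr b t \<in> tensor_rels"
    and fr_add_right: "fr a (s + t) - fr a s - fr a t \<in> tensor_rels"
    and fr_balanced: "uq_class q N b \<in> uq_plus q N \<Longrightarrow>
      fr (a * b) t - fr a (eigenvalue (uq_class q N b) * t) \<in> tensor_rels"
  unfolding tensor_rels_def tensor_relations_eq by (rule generate.incl; blast)+

lemma eigenvalue_scal: "eigenvalue (uq_class q N (scal t)) = t"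
  using K_simps(1) by (intro eigenvalueI) simp

lemma fr_zero_left: "fr 0 t \<in> tensor_rels"
  using tensor_rels_uminus[OF fr_add_left[of 0 0 t]] by simp

lemma tensor_coset_eq_iff:
  assumes "Poly_Mapping.keys x \<subseteq> carrier (uq q N) \<times> UNIV" "Poly_Mapping.keys y \<subseteq> carrier (uq q N) \<times> UNIV"
  shows "tensor_rels #>\<^bsub>FG\<^esub> x = tensor_rels #>\<^bsub>FG\<^esub> y \<longleftrightarrow> x - y \<in> tensor_rels"
    and "x \<in> tensor_rels #>\<^bsub>FG\<^esub> y \<longleftrightarrow> x - y \<in> tensor_rels"
proof -
  have mem: "x \<in> tensor_rels #>\<^bsub>FG\<^esub> y \<longleftrightarrow> x - y \<in> tensor_rels" for x y
    by (force simp: r_coset_def)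
  then show "x \<in> tensor_rels #>\<^bsub>FG\<^esub> y \<longleftrightarrow> x - y \<in> tensor_rels" .
  show "tensor_rels #>\<^bsub>FG\<^esub> x = tensor_rels #>\<^bsub>FG\<^esub> y \<longleftrightarrow> x - y \<in> tensor_rels"
    using group.repr_independence[OF group_free_Abelian_group _ _ tensor_rels_subgroup, of x y] assms
      mem[of x x] mem[of x y] tensor_rels_zero by auto
qed

lemma fr_mult_extend:
  "frag_extend (\<lambda>(a', v). frag_of (uq_class q N c \<otimes>\<^bsub>uq q N\<^esub> a', v)) (fr a t) = fr (c * a) t"
  by (simp add: fr_def uq_class_mult)

text \<open>Multiplication from the left does not interfere with the balancing, which takes place on
  the right of a, so it maps relations to relations and descends to the quotient.\<close>

lemma tensor_rels_extend:
  assumes "x \<in> tensor_rels"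
  shows "frag_extend (\<lambda>(a', v). frag_of (uq_class q N c \<otimes>\<^bsub>uq q N\<^esub> a', v)) x \<in> tensor_rels"
    (is "?ext x \<in> _")
proof -
  have rel: "?ext x \<in> tensor_rels"
    if "x \<in> tensor_relations (uq q N) (uq_plus q N) (borel_module q N i j)" for x
    using that fr_add_left[of "c * _" "c * _"] fr_add_right fr_balanced[of _ "c * _"]
    unfolding tensor_relations_eq
    by (auto simp: frag_extend_diff fr_mult_extend distrib_left mult.assoc)
  have "Poly_Mapping.keys x \<subseteq> carrier (uq q N) \<times> UNIV \<and> ?ext x \<in> tensor_rels"
    using assms unfolding tensor_rels_def
  proof (induction rule: generate.induct)
    case one
    then show ?case using tensor_rels_zero by (simp add: tensor_rels_def)
  next
    case (incl h)
    then show ?case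
      using rel[OF incl] subsetD[OF tensor_relations_carrier incl] by (simp add: tensor_rels_def)
  next
    case (inv h)
    then show ?case
      using rel[OF inv] tensor_rels_uminus subsetD[OF tensor_relations_carrier inv]
      by (simp add: tensor_rels_def frag_extend_minus)
  next
    case (eng g h)
    then show ?case
      using tensor_rels_add[of "?ext g" "?ext h"] keys_add[of g h]
      by (auto simp: tensor_rels_def frag_extend_add)
  qed
  then show ?thesis by simp
qed

text \<open>Scalars lie in the Borel part, so the tensor of a and t equals that of a t and 1, and
  differences of tensors with second factor 1 are again of this form. Hence the module is
  cyclic.\<close>

lemma tensor_represent:
  assumes "Poly_Mapping.keys x \<subseteq> carrier (uq q N) \<times> UNIV"
  shows "\<exists>a. x - fr a 1 \<in> tensor_rels"
  using assms
proof (induction x rule: free_Abelian_group_induct[consumes 1])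
  case 1
  show ?case using tensor_rels_uminus[OF fr_zero_left] by (intro exI[of _ 0]) simp
next
  case (2 x y)
  then obtain a b where "x - fr a 1 \<in> tensor_rels" "y - fr b 1 \<in> tensor_rels" by blast
  from tensor_rels_add[OF tensor_rels_diff[OF this] fr_add_left]
  have "(x - fr a 1) - (y - fr b 1) + (fr (a - b + b) 1 - fr (a - b) 1 - fr b 1) \<in> tensor_rels" .
  then show ?case by (intro exI[of _ "a - b"]) (simp add: algebra_simps)
next
  case (3 x)
  then obtain a t where x: "x = (uq_class q N a, t)" by (auto simp: uq_carrier)
  have "fr (a * scal t) 1 - fr a (t * 1) \<in> tensor_rels"
    using fr_balanced[OF uq_plus_gens(1), of a t 1] by (simp only: eigenvalue_scal)
  from tensor_rels_uminus[OF this] show ?case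
    by (intro exI[of _ "a * scal t"]) (simp add: x fr_def)
qed

lemma standard_module_presents:
  "presents (uq_class q N) tensor_class (standard_module q N i j) standard_ideal"
proof -
  interpret comm_group FG by (rule abelian_free_Abelian_group)
  interpret normal tensor_rels FG
    by (rule subgroup_imp_normal[OF tensor_rels_subgroup])
  have M: "standard_module q N i j =
      \<lparr>carrier = rcosets\<^bsub>FG\<^esub> tensor_rels, mult = undefined, one = undefined,
        ring.zero = tensor_rels, add = set_mult FG,
        smult = (\<lambda>a C. \<Union>c\<in>C. tensor_rels #>\<^bsub>FG\<^esub>
          frag_extend (\<lambda>(a', v). frag_of (a \<otimes>\<^bsub>uq q N\<^esub> a', v)) c)\<rparr>"
    by (simp add: standard_module_def induced_module_def Let_def tensor_rels_def borel_module_def)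
  have eq_iff: "tensor_class a = tensor_class b \<longleftrightarrow> a - b \<in> standard_ideal" for a b
  proof -
    have rel: "fr a 1 - fr (a - b) 1 - fr b 1 \<in> tensor_rels"
      using fr_add_left[of "a - b" b 1] by simp
    have "fr a 1 - fr b 1 \<in> tensor_rels \<longleftrightarrow> fr (a - b) 1 \<in> tensor_rels"
      using tensor_rels_diff[OF _ rel, of "fr a 1 - fr b 1"] tensor_rels_add[OF _ rel, of "fr (a - b) 1"]
      by auto
    then show ?thesis
      using tensor_coset_eq_iff(1)[OF fr_carrier fr_carrier, of a 1 b 1]
      by (simp add: tensor_class_def standard_ideal_def)
  qed
  have carrier: "rcosets\<^bsub>FG\<^esub> tensor_rels = range tensor_class"
  proof
    show "rcosets\<^bsub>FG\<^esub> tensor_rels \<subseteq> range tensor_class"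
    proof
      fix C assume "C \<in> rcosets\<^bsub>FG\<^esub> tensor_rels"
      then obtain x where x: "Poly_Mapping.keys x \<subseteq> carrier (uq q N) \<times> UNIV" "C = tensor_rels #>\<^bsub>FG\<^esub> x"
        by (auto simp: RCOSETS_def)
      with tensor_represent obtain a where "x - fr a 1 \<in> tensor_rels" by blast
      then show "C \<in> range tensor_class"
        using tensor_coset_eq_iff(1)[OF x(1) fr_carrier] x(2) by (auto simp: tensor_class_def)
    qed
    show "range tensor_class \<subseteq> rcosets\<^bsub>FG\<^esub> tensor_rels"
      using fr_carrier by (force simp: RCOSETS_def tensor_class_def)
  qed
  have add: "tensor_class a <#>\<^bsub>FG\<^esub> tensor_class b = tensor_class (a + b)" for a b
  proof -
    have "tensor_class a <#>\<^bsub>FG\<^esub> tensor_class b = tensor_rels #>\<^bsub>FG\<^esub> (fr a 1 + fr b 1)"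
      using rcos_sum[of "fr a 1" "fr b 1"] fr_carrier by (simp add: tensor_class_def)
    also have "\<dots> = tensor_class (a + b)"
      using tensor_rels_uminus[OF fr_add_left[of a b 1]] keys_add[of "fr a 1" "fr b 1"] fr_carrier
      unfolding tensor_class_def by (subst tensor_coset_eq_iff) (auto simp: algebra_simps)
    finally show ?thesis .
  qed
  have zero: "tensor_rels = tensor_class 0"
    using coset_join2[OF _ tensor_rels_subgroup fr_zero_left] fr_carrier by (simp add: tensor_class_def)
  have smult: "(\<Union>x\<in>tensor_class a. tensor_rels #>\<^bsub>FG\<^esub>
      frag_extend (\<lambda>(a', v). frag_of (uq_class q N c \<otimes>\<^bsub>uq q N\<^esub> a', v)) x) = tensor_class (c * a)"
    (is "(\<Union>x\<in>_. tensor_rels #>\<^bsub>FG\<^esub> ?ext x) = _") for c a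
  proof -
    have eq: "tensor_rels #>\<^bsub>FG\<^esub> ?ext x = tensor_class (c * a)" if "x \<in> tensor_class a" for x
    proof -
      have "tensor_class a \<subseteq> carrier FG"
        unfolding tensor_class_def by (rule r_coset_subset_G[OF subset]) (simp add: fr_carrier)
      from this that have "x \<in> carrier FG" by (rule subsetD)
      then have x: "Poly_Mapping.keys x \<subseteq> carrier (uq q N) \<times> UNIV" by simp
      then have "x - fr a 1 \<in> tensor_rels"
        using that tensor_coset_eq_iff(2)[OF x fr_carrier] by (simp add: tensor_class_def)
      from tensor_rels_extend[OF this, of c] have d: "?ext x - fr (c * a) 1 \<in> tensor_rels"
        by (simp add: frag_extend_diff fr_mult_extend)
      have keys: "Poly_Mapping.keys (?ext x) \<subseteq> carrier (uq q N) \<times> UNIV"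
        using keys_add[of "?ext x - fr (c * a) 1" "fr (c * a) 1"] tensor_rels_carrier[OF d]
          fr_carrier[of "c * a" 1] by auto
      show ?thesis
        unfolding tensor_class_def using d tensor_coset_eq_iff(1)[OF keys fr_carrier] by simp
    qed
    have "fr a 1 \<in> tensor_class a"
      unfolding tensor_class_def using tensor_coset_eq_iff(2)[OF fr_carrier fr_carrier, of a 1 a 1]
        tensor_rels_zero by simp
    with eq show ?thesis by blast
  qed
  show ?thesis
    unfolding presents_def M
    using eq_iff carrier add zero smult by simp
qed

lemma standard_ideal_left_ideal: "left_ideal standard_ideal"
  by (rule presents_left_ideal[OF standard_module_presents])

lemma uq_ideal_subset_standard: "uq_ideal q N \<subseteq> standard_ideal"
proof
  fix a assume "a \<in> uq_ideal q N"
  then have "uq_class q N a = uq_class q N 0" by (simp add: uq_class_eq_iff)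
  then show "a \<in> standard_ideal"
    using fr_zero_left[of 1] by (simp add: standard_ideal_def fr_def)
qed

text \<open>With t the eigenvalue of b, the tensors of b with 1 and of \<open>scal t\<close> with 1
  both equal the tensor of 1 with t.\<close>

lemma standard_ideal_eigenvector:
  assumes "uq_class q N b \<in> uq_plus q N"
  shows "b - scal (eigenvalue (uq_class q N b)) \<in> standard_ideal"
proof -
  let ?t = "eigenvalue (uq_class q N b)"
  have "fr b 1 - fr 1 ?t \<in> tensor_rels" "fr (scal ?t) 1 - fr 1 ?t \<in> tensor_rels"
    using fr_balanced[OF assms, of 1 1] fr_balanced[OF uq_plus_gens(1), of 1 ?t 1]
    by (simp_all add: eigenvalue_scal)
  from tensor_rels_diff[OF tensor_rels_diff[OF this] fr_add_left]
  have "(fr b 1 - fr 1 ?t) - (fr (scal ?t) 1 - fr 1 ?t)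
      - (fr (b - scal ?t + scal ?t) 1 - fr (b - scal ?t) 1 - fr (scal ?t) 1) \<in> tensor_rels"  .
  then show ?thesis by (simp add: standard_ideal_def)
qed

lemma standard_ideal_gens:
  shows "gx a \<in> standard_ideal" "gk I1 - scal (q ^ i) \<in> standard_ideal"
    and "gk I2 - scal (q ^ j) \<in> standard_ideal"
  using standard_ideal_eigenvector[OF uq_plus_gens(2), of a]
    standard_ideal_eigenvector[OF uq_plus_gens(3), of I1]
    standard_ideal_eigenvector[OF uq_plus_gens(3), of I2]
    eigenvalueI[of "gx a" 0] eigenvalueI[OF gk1_mem] eigenvalueI[OF gk2_mem] gx_mem
  by simp_all

text \<open>The tensor product maps to \<open>A/K\<close> by sending the class of \<open>(a, t)\<close> to that of \<open>t a\<close>.\<close>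

lemma standard_ideal_subset: "standard_ideal \<subseteq> K"
proof
  \<comment> \<open>The map should start from classes, yet its values are needed in A. A chosen
    representative is additive and multiplicative only up to \<open>uq_ideal q N\<close>, an error
    that K absorbs.\<close>
  define rep where "rep C = (SOME a. uq_class q N a = C)" for C
  have rep: "rep (uq_class q N a) - a \<in> uq_ideal q N" for a
    using someI[of "\<lambda>b. uq_class q N b = uq_class q N a" a] by (simp add: rep_def uq_class_eq_iff)
  define g where "g = (\<lambda>(C, t). scal t * rep C)"
  define G where "G x = (\<Sum>k\<in>Poly_Mapping.keys x. of_int (Poly_Mapping.lookup x k) * g k)" for x
  have G_add: "G (x + y) = G x + G y" for x y
    unfolding G_def by (rule setsum_keys_plus_distrib) (auto simp: algebra_simps)
  have G_zero: "G 0 = 0" by (simp add: G_def)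
  have G_uminus: "G (- x) = - G x" for x
    using G_add[of x "- x"] G_zero by (simp add: eq_neg_iff_add_eq_0 add.commute)
  have G_diff: "G (x - y) = G x - G y" for x y
    using G_add[of x "- y"] G_uminus[of y] by simp
  have G_fr: "G (fr a t) = scal t * rep (uq_class q N a)" for a t
    by (simp add: G_def fr_def g_def)
  note I = left_idealD[OF uq_ideal_left_ideal]
  have rel: "G x \<in> K"
    if x: "x \<in> tensor_relations (uq q N) (uq_plus q N) (borel_module q N i j)" for x
  proof -
    consider a b t where "x = fr (a + b) t - fr a t - fr b t"
      | a s t where "x = fr a (s + t) - fr a s - fr a t"
      | a b t where "x = fr (a * b) t - fr a (eigenvalue (uq_class q N b) * t)" "uq_class q N b \<in> uq_plus q N"
      using x unfolding tensor_relations_eq by blast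
    then show ?thesis
    proof cases
      case (1 a b t)
      have "G x = scal t * ((rep (uq_class q N (a + b)) - (a + b))
          - (rep (uq_class q N a) - a) - (rep (uq_class q N b) - b))"
        unfolding 1 G_diff G_fr by (simp add: algebra_simps)
      also have "\<dots> \<in> uq_ideal q N"
        by (rule I(3)[OF I(5)[OF I(5)[OF rep rep] rep]])
      finally show ?thesis using ideal_subset by blast
    next
      case (2 a s t)
      then have "G x = 0"
        unfolding 2 G_diff G_fr by (simp add: scal_add algebra_simps)
      then show ?thesis using K_simps(1) by simp
    next
      case (3 a b t)
      let ?e = "eigenvalue (uq_class q N b)"
      have e: "scal (?e * t) = scal t * scal ?e" "a * scal ?e = scal ?e * a"
        using scal_commute[of ?e a] by (simp_all only: mult.commute[of ?e t] scal_mult)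
      have "G x = scal t * (rep (uq_class q N (a * b)) - a * b) + scal t * (a * (b - scal ?e))
          - scal t * (scal ?e * (rep (uq_class q N a) - a))"
        unfolding 3 G_diff G_fr right_diff_distrib e mult.assoc by simp
      moreover have "scal t * (rep (uq_class q N (a * b)) - a * b) \<in> K"
        "scal t * (scal ?e * (rep (uq_class q N a) - a)) \<in> K"
        using I(3)[OF rep] I(3)[OF I(3)[OF rep]] ideal_subset by auto
      moreover have "scal t * (a * (b - scal ?e)) \<in> K"
        by (rule K_simps(3)[OF K_simps(3)[OF uq_plus_eigenvector[OF 3(2)]]])
      ultimately show ?thesis using K_simps(2,5) by simp
    qed
  qed
  have G_mem: "G x \<in> K" if "x \<in> tensor_rels" for x
  proof -
    have "Poly_Mapping.keys x \<subseteq> carrier (uq q N) \<times> UNIV \<and> G x \<in> K"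
      using that unfolding tensor_rels_def
    proof (induction rule: generate.induct)
      case one
      then show ?case using G_zero K_simps(1) by simp
    next
      case (incl h)
      then show ?case
        using rel[OF incl] subsetD[OF tensor_relations_carrier incl] by simp
    next
      case (inv h)
      then show ?case
        using rel[OF inv] subsetD[OF tensor_relations_carrier inv] K_simps(4)
        by (simp add: G_uminus)
    next
      case (eng g h)
      then show ?case
        using K_simps(2)[of "G g" "G h"] keys_add[of g h] by (auto simp: G_add)
    qed
    then show ?thesis by simp
  qed
  fix a assume "a \<in> standard_ideal"
  then have "rep (uq_class q N a) \<in> K"
    using G_mem[of "fr a 1"] by (simp add: standard_ideal_def G_fr)
  then have "rep (uq_class q N a) - (rep (uq_class q N a) - a) \<in> K"
    using rep[of a] ideal_subset K_simps(5) by blast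
  then show "a \<in> K" by simp
qed

end

lemma sum_in_closed:
  assumes "0 \<in> S" and "\<And>a b. a \<in> S \<Longrightarrow> b \<in> S \<Longrightarrow> a + b \<in> S" and "\<And>x. x \<in> A \<Longrightarrow> g x \<in> S"
  shows "sum g A \<in> S"
  using assms(3) by (induction A rule: infinite_finite_induct) (auto simp: assms(1,2))

section \<open>Representations of the free algebra on functions\<close>

definition word_act :: "(gen \<Rightarrow> ('p \<Rightarrow> 'k) \<Rightarrow> ('p \<Rightarrow> 'k)) \<Rightarrow> word \<Rightarrow> ('p \<Rightarrow> 'k) \<Rightarrow> ('p \<Rightarrow> 'k::field)" where
  "word_act G w = foldr G (letters w)"

definition alg_act :: "(gen \<Rightarrow> ('p \<Rightarrow> 'k) \<Rightarrow> ('p \<Rightarrow> 'k)) \<Rightarrow> 'k free_alg \<Rightarrow> ('p \<Rightarrow> 'k) \<Rightarrow> ('p \<Rightarrow> 'k::field)" where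
  "alg_act G a f p = (\<Sum>w\<in>Poly_Mapping.keys a. Poly_Mapping.lookup a w * word_act G w f p)"

locale linear_operators =
  fixes G :: "gen \<Rightarrow> ('p \<Rightarrow> 'k::field) \<Rightarrow> ('p \<Rightarrow> 'k)"
  assumes G_add: "G g (\<lambda>p. f p + h p) = (\<lambda>p. G g f p + G g h p)"
    and G_scale: "G g (\<lambda>p. c * f p) = (\<lambda>p. c * G g f p)"
begin

abbreviation "act \<equiv> alg_act G"

lemma word_act_add: "word_act G w (\<lambda>p. f p + h p) = (\<lambda>p. word_act G w f p + word_act G w h p)"
proof -
  have "foldr G ls (\<lambda>p. f p + h p) = (\<lambda>p. foldr G ls f p + foldr G ls h p)" for ls
    by (induction ls) (simp_all add: G_add)
  then show ?thesis by (simp add: word_act_def)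
qed

lemma word_act_scale: "word_act G w (\<lambda>p. c * f p) = (\<lambda>p. c * word_act G w f p)"
proof -
  have "foldr G ls (\<lambda>p. c * f p) = (\<lambda>p. c * foldr G ls f p)" for ls
    by (induction ls) (simp_all add: G_scale)
  then show ?thesis by (simp add: word_act_def)
qed

lemma word_act_plus: "word_act G (v + w) f = word_act G v (word_act G w f)"
  by (simp add: word_act_def plus_word_def)

lemma act_single: "act (Poly_Mapping.single w c) f = (\<lambda>p. c * word_act G w f p)"
  by (rule ext) (simp add: alg_act_def)

lemma act_add: "act (a + b) f = (\<lambda>p. act a f p + act b f p)"
  unfolding alg_act_def
  by (rule ext, rule setsum_keys_plus_distrib) (auto simp: algebra_simps)

lemma act_vec_add: "act a (\<lambda>p. f p + h p) = (\<lambda>p. act a f p + act a h p)"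
  by (rule ext) (simp add: alg_act_def word_act_add sum.distrib algebra_simps)

lemma act_vec_scale: "act a (\<lambda>p. c * f p) = (\<lambda>p. c * act a f p)"
  by (rule ext) (simp add: alg_act_def word_act_scale sum_distrib_left algebra_simps)

lemma act_mult: "act (a * b) f = act a (act b f)"
proof (induction a rule: poly_mapping_single_induct)
  case (single v c)
  show ?case
  proof (induction b rule: poly_mapping_single_induct)
    case (single w d)
    show ?case
      by (simp add: mult_single act_single word_act_plus word_act_scale mult.assoc)
  next
    case (add a b)
    then show ?case by (simp add: distrib_left act_add act_vec_add)
  qed
next
  case (add a b)
  then show ?case by (simp add: distrib_right act_add)
qed

lemma act_scal: "act (scal c) f = (\<lambda>p. c * f p)"
  by (simp add: scal_def act_single word_act_def zero_word_def)

lemma act_one: "act 1 f = f"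
  using act_scal[of 1 f] by simp

lemma act_zero: "act 0 f = (\<lambda>p. 0)"
  using act_scal[of 0 f] by simp

lemma act_vec_zero: "act a (\<lambda>p. 0) = (\<lambda>p. 0)"
  using act_vec_scale[of a 0 "\<lambda>p. 0"] by simp

lemma act_uminus: "act (- a) f = (\<lambda>p. - act a f p)"
  using act_mult[of "scal (-1)" a f] unfolding act_scal by (simp add: scal_uminus)

lemma act_diff: "act (a - b) f = (\<lambda>p. act a f p - act b f p)"
  using act_add[of a "- b" f] by (simp add: act_uminus)

lemma act_power: "act (a ^ k) f = (act a ^^ k) f"
  by (induction k) (simp_all add: act_one act_mult)

lemma act_gens:
  shows act_gx: "act (gx a) f = G (Gx a) f" and act_gy: "act (gy a) f = G (Gy a) f"
    and act_gk: "act (gk a) f = G (Gk a) f"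
  by (simp_all add: gx_def gy_def gk_def act_single word_act_def)

lemma act_closed:
  assumes "\<And>g f. f \<in> V \<Longrightarrow> G g f \<in> V"
    and add: "\<And>f h. f \<in> V \<Longrightarrow> h \<in> V \<Longrightarrow> (\<lambda>p. f p + h p) \<in> V"
    and scale: "\<And>c f. f \<in> V \<Longrightarrow> (\<lambda>p. c * f p) \<in> V"
    and "f \<in> V"
  shows "act a f \<in> V"
proof (induction a rule: poly_mapping_single_induct)
  case (single w c)
  have "foldr G ls f \<in> V" for ls
    by (induction ls) (simp_all add: assms)
  then show ?case by (simp add: act_single word_act_def scale)
next
  case (add a b)
  then show ?case by (simp add: act_add assms(2))
qed

lemmas act_simps = act_add act_diff act_mult act_scal act_one act_power act_gens

end

section \<open>The Verma module in coordinates\<close>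

text \<open>\<open>(I1, m)\<close> and \<open>(I2, m)\<close> index the coefficients of the alternating words
  \<open>y\<^sub>1y\<^sub>2y\<^sub>1\<dots>\<close> and \<open>y\<^sub>2y\<^sub>1y\<^sub>2\<dots>\<close> of length \<open>m\<close> applied to the highest weight vector. The empty
  word is counted as \<open>(I1, 0)\<close>, and the two words of length \<open>2N\<close>, which are opposite, as \<open>(I1, 2N)\<close>.\<close>

type_synonym 'k vec = "idx \<times> nat \<Rightarrow> 'k"

locale verma =
  fixes q :: "'k::field" and N i j :: nat
  assumes N_even: "even N" and N_gt: "N > 2" and q_N: "q ^ N = 1"
    and q_primitive: "\<And>m. 0 < m \<Longrightarrow> m < N \<Longrightarrow> q ^ m \<noteq> 1"
    and i_less: "i < N" and j_less: "j < N"
begin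

abbreviation "r \<equiv> inverse q"
abbreviation "c \<equiv> q ^ i"
abbreviation "d \<equiv> q ^ j"

definition vecs :: "'k vec set" where
  "vecs = {f. (\<forall>m>2 * N. f (I1, m) = 0) \<and> f (I2, 0) = 0 \<and> (\<forall>m\<ge>2 * N. f (I2, m) = 0)}"

text \<open>Obtained by commuting x_1 to the right through an alternating word. Removing an inner
  y_1 would bring two letters y_2 together, so only a y_1 at either end contributes. At the front it
  leaves 1 - \<kappa>_2 acting on the rest of the word. At the back it leaves 1 - d, after a sign
  for each y_1 and a factor \<open>r\<close> for each y_2 passed.\<close>

definition x1 :: "'k vec \<Rightarrow> 'k vec" where
  "x1 f = (\<lambda>(s, m). if m \<ge> 2 * N then 0 else case s of
     I1 \<Rightarrow> if even m then (-1) ^ (m div 2) * r ^ (m div 2) * (1 - d) * f (I1, Suc m) else 0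
   | I2 \<Rightarrow> if m = 0 then 0 else if even m then (1 - d * r ^ (m div 2)) * f (I1, Suc m)
       else (1 - d * r ^ Suc (m div 2)) * f (I1, Suc m)
         + (-1) ^ (m div 2) * r ^ Suc (m div 2) * (1 - d) * f (I2, Suc m))"

text \<open>The same computation with the indices exchanged; x_2 passes y_1 without a factor, so the
  contribution of the last letter carries a sign but no power of \<open>r\<close>.\<close>

definition x2 :: "'k vec \<Rightarrow> 'k vec" where
  "x2 f = (\<lambda>(s, m). if m \<ge> 2 * N then 0 else case s of
     I1 \<Rightarrow> if even m then (1 - c * r ^ (m div 2)) * f (I2, Suc m)
       else (1 - c * r ^ Suc (m div 2)) * f (I2, Suc m) + (-1) ^ (m div 2) * (1 - c) * f (I1, Suc m)
   | I2 \<Rightarrow> if m = 0 then 0 else if even m then (-1) ^ (m div 2) * (1 - c) * f (I2, Suc m) else 0)"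

definition y1 :: "'k vec \<Rightarrow> 'k vec" where
  "y1 f = (\<lambda>(s, m). case s of
     I1 \<Rightarrow> if m = 0 \<or> m > 2 * N then 0 else if m = 1 then f (I1, 0) else f (I2, m - 1)
   | I2 \<Rightarrow> 0)"

text \<open>The word (y_2 y_1)^N is stored as minus the coordinate \<open>(I1, 2 * N)\<close>,
  whence the sign.\<close>

definition y2 :: "'k vec \<Rightarrow> 'k vec" where
  "y2 f = (\<lambda>(s, m). case s of
     I1 \<Rightarrow> if m = 2 * N then - f (I1, m - 1) else 0
   | I2 \<Rightarrow> if m = 0 \<or> m \<ge> 2 * N then 0 else f (I1, m - 1))"

text \<open>The exponent counts the letters y_1 of the word, each contributing a factor
  \<open>r\<close>; in \<open>k2\<close> it counts the letters y_2.\<close>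

definition k1 :: "'k vec \<Rightarrow> 'k vec" where
  "k1 f = (\<lambda>(s, m). c * r ^ (case s of I1 \<Rightarrow> Suc m div 2 | I2 \<Rightarrow> m div 2) * f (s, m))"

definition k2 :: "'k vec \<Rightarrow> 'k vec" where
  "k2 f = (\<lambda>(s, m). d * r ^ (case s of I1 \<Rightarrow> m div 2 | I2 \<Rightarrow> Suc m div 2) * f (s, m))"

fun gop :: "gen \<Rightarrow> 'k vec \<Rightarrow> 'k vec" where
  "gop (Gx I1) = x1" | "gop (Gx I2) = x2"
| "gop (Gy I1) = y1" | "gop (Gy I2) = y2"
| "gop (Gk I1) = k1" | "gop (Gk I2) = k2"

lemmas op_defs = x1_def x2_def y1_def y2_def k1_def k2_def

sublocale linear_operators gop
proof
  show "gop g (\<lambda>p. f p + h p) = (\<lambda>p. gop g f p + gop g h p)" for g f h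
    by (cases g rule: gop.cases) (auto simp: op_defs fun_eq_iff algebra_simps split: idx.splits)
  show "gop g (\<lambda>p. c * f p) = (\<lambda>p. c * gop g f p)" for g f c
    by (cases g rule: gop.cases) (auto simp: op_defs fun_eq_iff algebra_simps split: idx.splits)
qed

lemma q_nonzero: "q \<noteq> 0"
  using q_N N_gt by (auto simp: power_0_left)

lemma r_N: "r ^ N = 1"
  using q_N by (simp add: power_inverse)

text \<open>Prepares the checks in the top degrees, where indices N - 1 and N meet: the sign uses
  that N is even, and the last equation is r^N = 1.\<close>

lemma N_pred:
  obtains k where "N = Suc k" "(-1) ^ k = (-1 :: 'k)" "r * r ^ k = 1"
proof (cases N)
  case (Suc k)
  then have "odd k" using N_even by simp
  then show ?thesis using that[OF Suc] r_N Suc by simp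
qed (use N_gt in simp)

lemma c_N: "c ^ N = 1" and d_N: "d ^ N = 1"
  using q_N by (simp_all flip: power_mult add: mult.commute[of _ N]) (simp_all add: power_mult)

lemma gop_vecs: "f \<in> vecs \<Longrightarrow> gop g f \<in> vecs"
  using N_gt by (cases g rule: gop.cases) (auto simp: op_defs vecs_def)

lemma vecs_add: "f \<in> vecs \<Longrightarrow> h \<in> vecs \<Longrightarrow> (\<lambda>p. f p + h p) \<in> vecs"
  and vecs_scale: "f \<in> vecs \<Longrightarrow> (\<lambda>p. t * f p) \<in> vecs"
  by (auto simp: vecs_def)

lemma act_vecs: "f \<in> vecs \<Longrightarrow> act a f \<in> vecs"
  by (rule act_closed[OF gop_vecs vecs_add vecs_scale])

text \<open>The operators depend on the parity of the degree. Named constants for the two parities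
  let \<open>op_coords\<close> rewrite without arithmetic on \<open>div\<close>.\<close>

definition ev :: "nat \<Rightarrow> nat" where "ev l = 2 * l"
definition od :: "nat \<Rightarrow> nat" where "od l = Suc (2 * l)"

lemma even_odd_cases:
  obtains l where "m = ev l" | l where "m = od l"
  unfolding ev_def od_def by (cases "even m") (auto elim: evenE oddE)

lemma all_idx_iff: "(\<forall>s. P s) \<longleftrightarrow> P I1 \<and> P I2"
  by (metis idx.exhaust)

lemma vec_eqI:
  fixes f h :: "'k vec"
  assumes "\<And>s l. f (s, ev l) = h (s, ev l)" and "\<And>s l. f (s, od l) = h (s, od l)"
  shows "f = h"
proof
  fix p :: "idx \<times> nat"
  obtain s m where p: "p = (s, m)" by fastforce
  show "f p = h p"
    using assms by (cases m rule: even_odd_cases) (auto simp: p)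
qed

text \<open>Degree 0 is split off because \<open>(I2, 0)\<close> is a dummy coordinate and several
  formulas have an exception there.\<close>

lemma vec_eqI':
  fixes f h :: "'k vec"
  assumes "f (I1, ev 0) = h (I1, ev 0)" "\<And>l. f (I1, ev (Suc l)) = h (I1, ev (Suc l))"
    and "\<And>l. f (I1, od l) = h (I1, od l)"
    and "f (I2, ev 0) = h (I2, ev 0)" "\<And>l. f (I2, ev (Suc l)) = h (I2, ev (Suc l))"
    and "\<And>l. f (I2, od l) = h (I2, od l)"
  shows "f = h"
proof (rule vec_eqI)
  show "f (s, ev l) = h (s, ev l)" for s l by (cases s; cases l) (auto simp: assms)
  show "f (s, od l) = h (s, od l)" for s l by (cases s) (auto simp: assms)
qed

lemma vecs_coords:
  assumes "f \<in> vecs"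
  shows "N < l \<Longrightarrow> f (I1, ev l) = 0" and "N \<le> l \<Longrightarrow> f (I1, od l) = 0"
    and "f (I2, ev 0) = 0" and "N \<le> l \<Longrightarrow> f (I2, ev l) = 0" and "N \<le> l \<Longrightarrow> f (I2, od l) = 0"
  using assms by (auto simp: vecs_def ev_def od_def)

lemma op_coords:
  shows "x1 f (I1, ev l) = (if l < N then (-1) ^ l * r ^ l * (1 - d) * f (I1, od l) else 0)"
    and "x1 f (I1, od l) = 0"
    and "x1 f (I2, ev l) = (if 0 < l \<and> l < N then (1 - d * r ^ l) * f (I1, od l) else 0)"
    and "x1 f (I2, od l) = (if l < N then (1 - d * r ^ Suc l) * f (I1, ev (Suc l))
           + (-1) ^ l * r ^ Suc l * (1 - d) * f (I2, ev (Suc l)) else 0)"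
    and "x2 f (I1, ev l) = (if l < N then (1 - c * r ^ l) * f (I2, od l) else 0)"
    and "x2 f (I1, od l) = (if l < N then (1 - c * r ^ Suc l) * f (I2, ev (Suc l))
           + (-1) ^ l * (1 - c) * f (I1, ev (Suc l)) else 0)"
    and "x2 f (I2, ev l) = (if 0 < l \<and> l < N then (-1) ^ l * (1 - c) * f (I2, od l) else 0)"
    and "x2 f (I2, od l) = 0"
    and "y1 f (I1, ev l) = (if l = 0 \<or> l > N then 0 else f (I2, od (l - 1)))"
    and "y1 f (I1, od l) = (if l \<ge> N then 0 else if l = 0 then f (I1, ev 0) else f (I2, ev l))"
    and "y1 f (I2, ev l) = 0" and "y1 f (I2, od l) = 0"
    and "y2 f (I1, ev l) = (if l = N then - f (I1, od (l - 1)) else 0)"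
    and "y2 f (I1, od l) = 0"
    and "y2 f (I2, ev l) = (if l = 0 \<or> l \<ge> N then 0 else f (I1, od (l - 1)))"
    and "y2 f (I2, od l) = (if l \<ge> N then 0 else f (I1, ev l))"
    and "k1 f (I1, ev l) = c * r ^ l * f (I1, ev l)" and "k1 f (I1, od l) = c * r ^ Suc l * f (I1, od l)"
    and "k1 f (I2, ev l) = c * r ^ l * f (I2, ev l)" and "k1 f (I2, od l) = c * r ^ l * f (I2, od l)"
    and "k2 f (I1, ev l) = d * r ^ l * f (I1, ev l)" and "k2 f (I1, od l) = d * r ^ l * f (I1, od l)"
    and "k2 f (I2, ev l) = d * r ^ l * f (I2, ev l)" and "k2 f (I2, od l) = d * r ^ Suc l * f (I2, od l)"
proof -
  have pred: "l \<noteq> 0 \<Longrightarrow> 2 * l - Suc 0 = Suc (2 * (l - Suc 0))" for l by (cases l) auto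
  have odd: "Suc (2 * l) \<noteq> 2 * N" by presburger
  show "x1 f (I1, ev l) = (if l < N then (-1) ^ l * r ^ l * (1 - d) * f (I1, od l) else 0)"
    "x1 f (I1, od l) = 0"
    "x1 f (I2, ev l) = (if 0 < l \<and> l < N then (1 - d * r ^ l) * f (I1, od l) else 0)"
    "x1 f (I2, od l) = (if l < N then (1 - d * r ^ Suc l) * f (I1, ev (Suc l))
           + (-1) ^ l * r ^ Suc l * (1 - d) * f (I2, ev (Suc l)) else 0)"
    by (simp_all add: x1_def ev_def od_def)
  show "x2 f (I1, ev l) = (if l < N then (1 - c * r ^ l) * f (I2, od l) else 0)"
    "x2 f (I1, od l) = (if l < N then (1 - c * r ^ Suc l) * f (I2, ev (Suc l))
           + (-1) ^ l * (1 - c) * f (I1, ev (Suc l)) else 0)"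
    "x2 f (I2, ev l) = (if 0 < l \<and> l < N then (-1) ^ l * (1 - c) * f (I2, od l) else 0)"
    "x2 f (I2, od l) = 0"
    by (simp_all add: x2_def ev_def od_def)
  show "y1 f (I1, ev l) = (if l = 0 \<or> l > N then 0 else f (I2, od (l - 1)))"
    "y1 f (I1, od l) = (if l \<ge> N then 0 else if l = 0 then f (I1, ev 0) else f (I2, ev l))"
    "y1 f (I2, ev l) = 0" "y1 f (I2, od l) = 0"
    using pred[of l] by (auto simp: y1_def ev_def od_def)
  show "y2 f (I1, ev l) = (if l = N then - f (I1, od (l - 1)) else 0)"
    "y2 f (I1, od l) = 0"
    "y2 f (I2, ev l) = (if l = 0 \<or> l \<ge> N then 0 else f (I1, od (l - 1)))"
    "y2 f (I2, od l) = (if l \<ge> N then 0 else f (I1, ev l))"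
    using pred[of l] pred[of N] N_gt odd by (auto simp: y2_def ev_def od_def)
qed (simp_all add: k1_def k2_def ev_def od_def)

section \<open>The defining relations hold in the model\<close>

lemma k_commute: "k1 (k2 f) = k2 (k1 f)"
  by (rule ext) (auto simp: op_defs)

lemma k_power:
  shows "(k1 ^^ t) f = (\<lambda>(s, m). (c * r ^ (case s of I1 \<Rightarrow> Suc m div 2 | I2 \<Rightarrow> m div 2)) ^ t * f (s, m))"
    and "(k2 ^^ t) f = (\<lambda>(s, m). (d * r ^ (case s of I1 \<Rightarrow> m div 2 | I2 \<Rightarrow> Suc m div 2)) ^ t * f (s, m))"
  by (induction t) (auto simp: op_defs fun_eq_iff algebra_simps)

lemma k_power_N: "(k1 ^^ N) f = f" "(k2 ^^ N) f = f"
proof -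
  have "(r ^ t) ^ N = 1" for t
    using r_N by (metis mult.commute power_mult power_one)
  then show "(k1 ^^ N) f = f" "(k2 ^^ N) f = f"
    by (auto simp: k_power power_mult_distrib c_N d_N fun_eq_iff)
qed

lemma r_Suc: "q * r ^ Suc l = r ^ l" "q * (r * t) = t"
  using q_nonzero by simp_all

lemma k_x:
  assumes "f \<in> vecs"
  shows "k1 (x1 f) = (\<lambda>p. q * x1 (k1 f) p)" and "k1 (x2 f) = x2 (k1 f)"
    and "k2 (x1 f) = x1 (k2 f)" and "k2 (x2 f) = (\<lambda>p. q * x2 (k2 f) p)"
  by (rule vec_eqI'; simp add: op_coords algebra_simps r_Suc)+

lemma k_y:
  assumes "f \<in> vecs"
  shows "k1 (y1 f) = (\<lambda>p. r * y1 (k1 f) p)" and "k1 (y2 f) = y2 (k1 f)"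
    and "k2 (y1 f) = y1 (k2 f)" and "k2 (y2 f) = (\<lambda>p. r * y2 (k2 f) p)"
proof -
  obtain k where k: "N = Suc k" "(-1) ^ k = (-1 :: 'k)" "r * r ^ k = 1"
    by (rule N_pred)
  note v = vecs_coords[OF assms, unfolded k(1)] op_coords[unfolded k(1)] k le_less_Suc_eq
  show "k1 (y1 f) = (\<lambda>p. r * y1 (k1 f) p)" "k1 (y2 f) = y2 (k1 f)"
    "k2 (y1 f) = y1 (k2 f)" "k2 (y2 f) = (\<lambda>p. r * y2 (k2 f) p)"
    by (rule vec_eqI'; simp add: v)+
qed

lemma x_square:
  assumes "f \<in> vecs"
  shows "x1 (x1 f) = (\<lambda>p. 0)" and "x2 (x2 f) = (\<lambda>p. 0)"
proof -
  obtain k where k: "N = Suc k" "(-1) ^ k = (-1 :: 'k)" "r * r ^ k = 1"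
    by (rule N_pred)
  note v = vecs_coords[OF assms, unfolded k(1)] op_coords[unfolded k(1)] k le_less_Suc_eq
  show "x1 (x1 f) = (\<lambda>p. 0)" "x2 (x2 f) = (\<lambda>p. 0)"
    by (rule vec_eqI'; simp add: v)+
qed

lemma y_square:
  assumes "f \<in> vecs"
  shows "y1 (y1 f) = (\<lambda>p. 0)" and "y2 (y2 f) = (\<lambda>p. 0)"
proof -
  obtain k where k: "N = Suc k" "(-1) ^ k = (-1 :: 'k)" "r * r ^ k = 1"
    by (rule N_pred)
  note v = vecs_coords[OF assms, unfolded k(1)] op_coords[unfolded k(1)] k le_less_Suc_eq
  show "y1 (y1 f) = (\<lambda>p. 0)" "y2 (y2 f) = (\<lambda>p. 0)"
    by (rule vec_eqI'; simp add: v)+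
qed

text \<open>These are the rules from which \<open>x1\<close> and \<open>x2\<close> were computed, so
  in low degrees they hold by construction. In the top degrees r^N = 1 and the parity of N reconcile
  the two expressions for the top word.\<close>

lemma y_x:
  assumes "f \<in> vecs"
  shows "(\<lambda>p. y1 (x1 f) p + x1 (y1 f) p) = (\<lambda>p. f p - k2 f p)"
    and "(\<lambda>p. y2 (x2 f) p + x2 (y2 f) p) = (\<lambda>p. f p - k1 f p)"
    and "y2 (x1 f) = (\<lambda>p. q * x1 (y2 f) p)"
    and "y1 (x2 f) = x2 (y1 f)"
proof -
  obtain k where k: "N = Suc k" "(-1) ^ k = (-1 :: 'k)" "r * r ^ k = 1"
    by (rule N_pred)
  note v = vecs_coords[OF assms, unfolded k(1)] op_coords[unfolded k(1)] k le_less_Suc_eq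
  show "(\<lambda>p. y1 (x1 f) p + x1 (y1 f) p) = (\<lambda>p. f p - k2 f p)"
    by (rule vec_eqI'; simp add: v algebra_simps)
  show "(\<lambda>p. y2 (x2 f) p + x2 (y2 f) p) = (\<lambda>p. f p - k1 f p)"
    by (rule vec_eqI'; simp add: v algebra_simps)
  \<comment> \<open>At the coordinate \<open>(I2, od k)\<close>, of degree 2N - 1, one side carries
    r^(N-1) and the other q.\<close>
  have "r ^ k = q" using k(3) q_nonzero by (simp add: field_simps)
  then show "y2 (x1 f) = (\<lambda>p. q * x1 (y2 f) p)"
    by (intro vec_eqI'; simp add: v algebra_simps r_Suc)
  show "y1 (x2 f) = x2 (y1 f)"
    by (rule vec_eqI'; simp add: v algebra_simps)
qed

lemma y_raise:
  assumes "\<And>s m. m < t \<Longrightarrow> f (s, m) = 0" and "m < Suc t"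
  shows "y1 f (s, m) = 0" and "y2 f (s, m) = 0"
  using assms(2) N_gt by (cases s; auto simp: y1_def y2_def intro!: assms(1))+

lemma x_lower:
  assumes "\<And>s m. m > t \<Longrightarrow> f (s, m) = 0" and "Suc m > t"
  shows "x1 f (s, m) = 0" and "x2 f (s, m) = 0"
  using assms by (cases s; simp add: x1_def x2_def)+

lemma funpow_comp_Suc: "((\<lambda>v. g (h v)) ^^ Suc k) f = g (((\<lambda>v. h (g v)) ^^ k) (h f))"
  by (induction k) simp_all

text \<open>The two paths through degree 2(l + 1) add up to the determinant from the overview. It is
  the same for both orders of x_1 and x_2, which makes their powers comparable in
  \<open>x_x_power\<close>.\<close>

lemma x_x_step:
  assumes "Suc l < N"
  shows "x2 (x1 f) (I1, od l) = (1 - r ^ Suc l) * (1 - c * d * r ^ Suc l) * f (I1, od (Suc l))"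
    and "x1 (x2 f) (I2, od l) = (1 - r ^ Suc l) * (1 - c * d * r ^ Suc l) * f (I2, od (Suc l))"
proof -
  have "(-1) ^ l * ((-1) ^ l * t) = t" for t :: 'k
    by (simp flip: mult.assoc power_add mult_2)
  then show "x2 (x1 f) (I1, od l) = (1 - r ^ Suc l) * (1 - c * d * r ^ Suc l) * f (I1, od (Suc l))"
    "x1 (x2 f) (I2, od l) = (1 - r ^ Suc l) * (1 - c * d * r ^ Suc l) * f (I2, od (Suc l))"
    using assms by (simp_all add: op_coords algebra_simps)
qed

lemma x_x_power:
  assumes "l + k < N"
  shows "\<exists>P. \<forall>f. ((\<lambda>v. x2 (x1 v)) ^^ k) f (I1, od l) = P * f (I1, od (l + k)) \<and>
    ((\<lambda>v. x1 (x2 v)) ^^ k) f (I2, od l) = P * f (I2, od (l + k))"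
  using assms
proof (induction k arbitrary: l)
  case 0
  then show ?case by (intro exI[of _ 1]) simp
next
  case (Suc k)
  then obtain P where "\<forall>f. ((\<lambda>v. x2 (x1 v)) ^^ k) f (I1, od (Suc l)) = P * f (I1, od (Suc l + k)) \<and>
    ((\<lambda>v. x1 (x2 v)) ^^ k) f (I2, od (Suc l)) = P * f (I2, od (Suc l + k))"
    by (metis add_Suc_shift)
  then show ?case
    using Suc.prems x_x_step[of l]
    by (intro exI[of _ "(1 - r ^ Suc l) * (1 - c * d * r ^ Suc l) * P"]) simp
qed

text \<open>The powers lower the degree by 2N, so only the top coefficient matters, and it lands in
  \<open>(I1, 0)\<close>. Writing (x_1 x_2)^N as x_1 (x_2 x_1)^(N-1) x_2, and likewise with the
  indices exchanged, produces the same scalar P on both sides; the opposite signs come from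
  (-1)^(N-1) = -1.\<close>

lemma x_power_relation:
  assumes f: "f \<in> vecs"
  shows "((\<lambda>v. x1 (x2 v)) ^^ N) f p + ((\<lambda>v. x2 (x1 v)) ^^ N) f p = 0"
proof -
  obtain k where k: "N = Suc k" "(-1) ^ k = (-1 :: 'k)" "r * r ^ k = 1"
    by (rule N_pred)
  have lower: "\<forall>s m. m + 2 * t > 2 * N \<longrightarrow>
      ((\<lambda>v. x1 (x2 v)) ^^ t) f (s, m) = 0 \<and> ((\<lambda>v. x2 (x1 v)) ^^ t) f (s, m) = 0" for t
  proof (induction t)
    case 0
    then show ?case using f by (auto simp: vecs_def all_idx_iff)
  next
    case (Suc t)
    show ?case
    proof (intro allI impI)
      fix s m assume m: "m + 2 * Suc t > 2 * N"
      define u where "u = 2 * N - 2 * t"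
      have "((\<lambda>v. x1 (x2 v)) ^^ t) f (s, m) = 0" "((\<lambda>v. x2 (x1 v)) ^^ t) f (s, m) = 0" if "m > u" for s m
        using Suc that by (auto simp: u_def)
      then have "x2 (((\<lambda>v. x1 (x2 v)) ^^ t) f) (s, m) = 0" "x1 (((\<lambda>v. x2 (x1 v)) ^^ t) f) (s, m) = 0"
        if "m > u - 1" for s m
        using that by - ((rule x_lower(2)[where t = u]; simp), (rule x_lower(1)[where t = u]; simp))
      then have "x1 (x2 (((\<lambda>v. x1 (x2 v)) ^^ t) f)) (s, m) = 0" "x2 (x1 (((\<lambda>v. x2 (x1 v)) ^^ t) f)) (s, m) = 0"
        using m by - ((rule x_lower(1)[where t = "u - 1"]; simp add: u_def),
            (rule x_lower(2)[where t = "u - 1"]; simp add: u_def))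
      then show "((\<lambda>v. x1 (x2 v)) ^^ Suc t) f (s, m) = 0 \<and> ((\<lambda>v. x2 (x1 v)) ^^ Suc t) f (s, m) = 0"
        by simp
    qed
  qed
  obtain s m where p: "p = (s, m)" by fastforce
  consider "m > 0" | "m = 0" "s = I2" | "m = 0" "s = I1"
    by (cases s) auto
  then show ?thesis
  proof cases
    case 1
    then show ?thesis using lower[of N] by (simp add: p)
  next
    case 2
    have I2_zero: "x1 g (I2, 0) = 0" "x2 g (I2, 0) = 0" for g
      by (simp_all add: x1_def x2_def)
    show ?thesis unfolding p 2 k(1) funpow_comp_Suc by (simp add: I2_zero[unfolded k(1)])
  next
    case 3
    obtain P where P: "\<And>g. ((\<lambda>v. x2 (x1 v)) ^^ k) g (I1, od 0) = P * g (I1, od k)"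
      "\<And>g. ((\<lambda>v. x1 (x2 v)) ^^ k) g (I2, od 0) = P * g (I2, od k)"
      using x_x_power[of 0 k] k(1) by auto
    have zero: "f (I2, ev (Suc k)) = 0" using vecs_coords(4)[OF f, of "Suc k"] k(1) by simp
    have p0: "p = (I1, ev 0)" by (simp add: p 3 ev_def)
    have "((\<lambda>v. x1 (x2 v)) ^^ N) f p = - ((1 - d) * P * (1 - c) * f (I1, ev (Suc k)))"
      unfolding p0 using k P zero by (simp add: k(1) funpow_comp_Suc op_coords[unfolded k(1)] algebra_simps del: funpow.simps)
    moreover have "((\<lambda>v. x2 (x1 v)) ^^ N) f p = (1 - c) * P * (1 - d) * f (I1, ev (Suc k))"
      unfolding p0 using k P zero by (simp add: k(1) funpow_comp_Suc op_coords[unfolded k(1)] algebra_simps del: funpow.simps)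
    ultimately show ?thesis by simp
  qed
qed

text \<open>The powers raise the degree by 2N, so only the highest weight coefficient survives. It
  arrives at the two words of length 2N, which the model identifies up to sign.\<close>

lemma y_power_relation:
  assumes f: "f \<in> vecs"
  shows "((\<lambda>v. y1 (y2 v)) ^^ N) f p + ((\<lambda>v. y2 (y1 v)) ^^ N) f p = 0"
proof -
  have raise: "\<forall>s m. m < 2 * t \<longrightarrow>
      ((\<lambda>v. y1 (y2 v)) ^^ t) f (s, m) = 0 \<and> ((\<lambda>v. y2 (y1 v)) ^^ t) f (s, m) = 0" for t
  proof (induction t)
    case (Suc t)
    then have "y1 (((\<lambda>v. y2 (y1 v)) ^^ t) f) (s, m) = 0" "y2 (((\<lambda>v. y1 (y2 v)) ^^ t) f) (s, m) = 0"
      if "m < Suc (2 * t)" for s m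
      using that by - ((rule y_raise(1)[where t = "2 * t"]; simp), (rule y_raise(2)[where t = "2 * t"]; simp))
    then have "y1 (y2 (((\<lambda>v. y1 (y2 v)) ^^ t) f)) (s, m) = 0" "y2 (y1 (((\<lambda>v. y2 (y1 v)) ^^ t) f)) (s, m) = 0"
      if "m < Suc (Suc (2 * t))" for s m
      using that by - ((rule y_raise(1)[where t = "Suc (2 * t)"]; simp), (rule y_raise(2)[where t = "Suc (2 * t)"]; simp))
    then show ?case by simp
  qed simp
  have closed: "((\<lambda>v. y1 (y2 v)) ^^ t) f \<in> vecs" "((\<lambda>v. y2 (y1 v)) ^^ t) f \<in> vecs" for t
    using f gop_vecs[of _ "Gy I1"] gop_vecs[of _ "Gy I2"] by (induction t) simp_all
  obtain s m where p: "p = (s, m)" by fastforce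
  consider "m < 2 * N" | "m > 2 * N \<or> m = 2 * N \<and> s = I2" | "m = 2 * N" "s = I1"
    using linorder_less_linear[of m "2 * N"] by (cases s) auto
  then show ?thesis
  proof cases
    case 1
    then show ?thesis using raise[of N] by (simp add: p)
  next
    case 2
    have zero: "g p = 0" if "g \<in> vecs" for g
      using 2 that by (cases s) (auto simp: p vecs_def)
    show ?thesis using zero[OF closed(1)] zero[OF closed(2)] by simp
  next
    case 3
    have "((\<lambda>v. y1 (y2 v)) ^^ t) f (I1, ev t) = f (I1, ev 0)" if "t \<le> N" for t
      using that by (induction t) (simp_all add: op_coords)
    moreover have "((\<lambda>v. y2 (y1 v)) ^^ Suc t) f (I2, ev (Suc t)) = f (I1, ev 0)" if "Suc t < N" for t
      using that by (induction t) (simp_all add: op_coords)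
    moreover obtain t where t: "N = Suc (Suc t)" using N_gt by (metis less_imp_Suc_add add_2_eq_Suc)
    ultimately have "((\<lambda>v. y1 (y2 v)) ^^ N) f (I1, ev N) = f (I1, ev 0)"
      "((\<lambda>v. y2 (y1 v)) ^^ N) f (I1, ev N) = - f (I1, ev 0)"
      by (simp_all add: op_coords[unfolded t] t)
    then show ?thesis by (simp add: p 3 ev_def)
  qed
qed

lemma relations_act:
  assumes f: "f \<in> vecs" and a: "a \<in> uq_relations q N"
  shows "act a f = (\<lambda>p. 0)"
proof -
  have v: "gop g f \<in> vecs" for g using gop_vecs[OF f] .
  note 1 = k_commute k_power_N k_x[OF f] k_y[OF f] x_square[OF f] y_square[OF f]
  have yx: "y1 (x1 f) p + x1 (y1 f) p = f p - k2 f p" "y2 (x2 f) p + x2 (y2 f) p = f p - k1 f p" for p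
    using y_x(1,2)[OF f] by metis+
  have fn: "act (gk I1) = k1" "act (gk I2) = k2" "act (gx I1 * gx I2) = (\<lambda>v. x1 (x2 v))"
    "act (gx I2 * gx I1) = (\<lambda>v. x2 (x1 v))" "act (gy I1 * gy I2) = (\<lambda>v. y1 (y2 v))"
    "act (gy I2 * gy I1) = (\<lambda>v. y2 (y1 v))"
    by (rule ext, simp add: act_simps)+
  have all_idx: "{F a | a. True} = {F I1, F I2}" "{H a b | a b. True} = {H I1 I1, H I1 I2, H I2 I1, H I2 I2}"
    for F :: "idx \<Rightarrow> 'k free_alg" and H :: "idx \<Rightarrow> idx \<Rightarrow> 'k free_alg"
    by (auto, (metis idx.exhaust)+)
  have "act a f p = 0" for p
    using a x_power_relation[OF f, of p] y_power_relation[OF f, of p] yx[of p]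
    unfolding uq_relations_def all_idx
    by (auto simp: act_add act_diff act_power fn) (auto simp: act_simps 1 y_x(3,4)[OF f] numeral_2_eq_2)
  then show ?thesis by auto
qed

text \<open>The elements killing all of \<open>vecs\<close> form a two-sided ideal because
  \<open>vecs\<close> is stable under the action; the annihilator of a single vector would only give
  a left ideal.\<close>

lemma uq_ideal_act:
  assumes "a \<in> uq_ideal q N" and "f \<in> vecs"
  shows "act a f = (\<lambda>p. 0)"
proof -
  let ?K = "{a. \<forall>f\<in>vecs. act a f = (\<lambda>p. 0)}"
  have "uq_ideal q N \<subseteq> ?K"
  proof (rule uq_ideal_minimal)
    show "left_ideal ?K"
      by (auto simp: left_ideal_def act_zero act_add act_mult act_vec_zero)
    show "a * b \<in> ?K" if "a \<in> ?K" for a b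
      using that by (auto simp: act_mult act_vecs)
    show "uq_relations q N \<subseteq> ?K"
      by (auto simp: relations_act)
  qed
  then show ?thesis using assms by auto
qed

section \<open>The highest weight vector of the model\<close>

definition highest_vec :: "'k vec" where
  "highest_vec = (\<lambda>p. if p = (I1, 0) then 1 else 0)"

definition annihilator :: "'k free_alg set" where
  "annihilator = {a. act a highest_vec = (\<lambda>p. 0)}"

lemma highest_vec_in: "highest_vec \<in> vecs"
  by (auto simp: highest_vec_def vecs_def)

sublocale highest_weight q N i j annihilator
proof
  show "left_ideal annihilator"
    by (auto simp: annihilator_def left_ideal_def act_zero act_add act_mult act_vec_zero)
  show "1 \<notin> annihilator"
    by (auto simp: annihilator_def act_one highest_vec_def fun_eq_iff)
  show "uq_ideal q N \<subseteq> annihilator"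
    using uq_ideal_act highest_vec_in by (auto simp: annihilator_def)
  show "gx a \<in> annihilator" for a
    by (cases a) (auto simp: annihilator_def act_gx highest_vec_def x1_def x2_def fun_eq_iff split: idx.split)
  show "gk I1 - scal c \<in> annihilator" "gk I2 - scal d \<in> annihilator"
    by (auto simp: annihilator_def act_simps highest_vec_def k1_def k2_def fun_eq_iff split: idx.split)
qed

section \<open>The unique maximal left ideal\<close>

text \<open>The largest subspace of \<open>vecs\<close> that is stable under the action and on which
  the highest weight coefficient vanishes; \<open>radicalI\<close> is this maximality.\<close>

definition radical :: "'k vec set" where
  "radical = {f \<in> vecs. \<forall>b. act b f (I1, 0) = 0}"

definition maximal_ideal :: "'k free_alg set" where
  "maximal_ideal = {a. act a highest_vec \<in> radical}"

lemma radical_closed: "f \<in> radical \<Longrightarrow> act a f \<in> radical"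
  by (auto simp: radical_def act_vecs simp flip: act_mult)

lemma maximal_ideal_left_ideal: "left_ideal maximal_ideal"
proof -
  have "act (a + b) highest_vec \<in> radical"
    if "act a highest_vec \<in> radical" "act b highest_vec \<in> radical" for a b
    using that by (auto simp: radical_def act_add vecs_add act_vec_add)
  moreover have "act 0 highest_vec \<in> radical"
    by (auto simp: radical_def act_zero act_vec_zero vecs_def)
  ultimately show ?thesis
    by (auto simp: maximal_ideal_def left_ideal_def act_mult radical_closed)
qed

lemma standard_ideal_subset_maximal: "standard_ideal \<subseteq> maximal_ideal"
  using standard_ideal_subset highest_vec_in
  by (auto simp: maximal_ideal_def radical_def annihilator_def act_vec_zero vecs_def)

lemma maximal_ideal_proper: "maximal_ideal \<noteq> UNIV"
proof -
  have "act 1 (act 1 highest_vec) (I1, 0) \<noteq> 0" by (simp add: act_one highest_vec_def)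
  then have "1 \<notin> maximal_ideal"
    unfolding maximal_ideal_def radical_def by blast
  then show ?thesis by blast
qed

section \<open>Reduction to words in y_1 and y_2\<close>

definition y_span :: "nat \<Rightarrow> 'k free_alg set" where
  "y_span m = {a. \<forall>w\<in>Poly_Mapping.keys a. set (letters w) \<subseteq> range Gy \<and> m \<le> length (letters w)}"

lemma y_span_add: "a \<in> y_span m \<Longrightarrow> b \<in> y_span m \<Longrightarrow> a + b \<in> y_span m"
  using keys_add[of a b] by (auto simp: y_span_def)

lemma y_span_mult:
  assumes "a \<in> y_span m" and "b \<in> y_span k"
  shows "a * b \<in> y_span (m + k)"
  unfolding y_span_def
proof (intro CollectI ballI)
  fix w assume "w \<in> Poly_Mapping.keys (a * b)"
  then obtain u v where "u \<in> Poly_Mapping.keys a" "v \<in> Poly_Mapping.keys b" "w = u + v"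
    using keys_mult[of a b] by blast
  then show "set (letters w) \<subseteq> range Gy \<and> m + k \<le> length (letters w)"
    using assms by (fastforce simp: y_span_def plus_word_def)
qed

lemma y_span_gens: "scal t \<in> y_span 0" "gy a \<in> y_span 0" "1 \<in> y_span 0"
  using y_span_def by (auto simp: y_span_def scal_def gy_def zero_word_def simp flip: single_one)

text \<open>The elements that agree modulo J_0 with a combination of words in the y_i. That all
  elements are of this kind, \<open>all_reducible\<close>, is the spanning half of a triangular
  decomposition.\<close>

definition reducible :: "'k free_alg set" where
  "reducible = {a. \<exists>y\<in>y_span 0. a - y \<in> standard_ideal}"

lemmas J0 = left_idealD[OF standard_ideal_left_ideal]

lemma reducible_closed:
  shows reducible_add: "a \<in> reducible \<Longrightarrow> b \<in> reducible \<Longrightarrow> a + b \<in> reducible"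
    and reducible_mult: "y \<in> y_span 0 \<Longrightarrow> a \<in> reducible \<Longrightarrow> y * a \<in> reducible"
    and reducible_cong: "a - b \<in> standard_ideal \<Longrightarrow> b \<in> reducible \<Longrightarrow> a \<in> reducible"
    and y_span_reducible: "y \<in> y_span 0 \<Longrightarrow> y \<in> reducible"
proof -
  show "a + b \<in> reducible" if ab: "a \<in> reducible" "b \<in> reducible"
  proof -
    from ab obtain y z where yz: "y \<in> y_span 0" "z \<in> y_span 0" "a - y \<in> standard_ideal" "b - z \<in> standard_ideal"
      by (auto simp: reducible_def)
    then show ?thesis using J0(2)[OF yz(3,4)] y_span_add[OF yz(1,2)]
      by (auto simp: reducible_def algebra_simps intro!: bexI[of _ "y + z"])
  qed
  show "y * a \<in> reducible" if y: "y \<in> y_span 0" and a: "a \<in> reducible"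
  proof -
    from a obtain z where z: "z \<in> y_span 0" "a - z \<in> standard_ideal" by (auto simp: reducible_def)
    then show ?thesis using J0(3)[OF z(2), of y] y_span_mult[OF y z(1)]
      by (auto simp: reducible_def algebra_simps intro!: bexI[of _ "y * z"])
  qed
  show "a \<in> reducible" if ab: "a - b \<in> standard_ideal" and b: "b \<in> reducible"
  proof -
    from b obtain z where z: "z \<in> y_span 0" "b - z \<in> standard_ideal" by (auto simp: reducible_def)
    then show ?thesis using J0(2)[OF ab z(2)] by (auto simp: reducible_def intro!: bexI[of _ z])
  qed
  show "y \<in> y_span 0 \<Longrightarrow> y \<in> reducible"
    using J0(1) by (auto simp: reducible_def intro!: bexI[of _ y])
qed

lemma relation_right: "a \<in> uq_relations q N \<Longrightarrow> a * w \<in> standard_ideal"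
  using uq_relations_subset uq_ideal_right uq_ideal_subset_standard by blast

definition gen_elem :: "gen \<Rightarrow> 'k free_alg" where
  "gen_elem g = Poly_Mapping.single (Word [g]) 1"

definition word_elem :: "gen list \<Rightarrow> 'k free_alg" where
  "word_elem ls = Poly_Mapping.single (Word ls) 1"

lemma gen_elem_simps: "gen_elem (Gx a) = gx a" "gen_elem (Gy a) = gy a" "gen_elem (Gk a) = gk a"
  by (simp_all add: gen_elem_def gx_def gy_def gk_def)

lemma word_elem_simps:
  "word_elem [] = 1" "word_elem (g # ls) = gen_elem g * word_elem ls"
  "word_elem (ks @ ls) = word_elem ks * word_elem ls"
  by (simp_all add: word_elem_def gen_elem_def mult_single plus_word_def flip: single_one zero_word_def)

lemma y_word_span: "set ls \<subseteq> range Gy \<Longrightarrow> word_elem ls \<in> y_span 0"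
  by (auto simp: word_elem_def y_span_def)

text \<open>Moving \<kappa>_a through the word to the highest weight vector costs one scalar per
  letter, so words in the y_i are weight vectors.\<close>

lemma k_word_reducible:
  assumes "set ls \<subseteq> range Gy"
  shows "\<exists>t. gk a * word_elem ls - scal t * word_elem ls \<in> standard_ideal"
  using assms
proof (induction ls)
  case Nil
  show ?case using standard_ideal_gens(2,3) by (cases a) (auto simp: word_elem_simps)
next
  case (Cons g ls)
  then obtain b t where g: "g = Gy b" and t: "gk a * word_elem ls - scal t * word_elem ls \<in> standard_ideal"
    by auto
  define s where "s = (if a = b then r else 1)"
  have "gk a * gy b - scal s * gy b * gk a \<in> uq_relations q N"
    unfolding uq_relations_def s_def by blast
  then have "(gk a * gy b - scal s * gy b * gk a) * word_elem ls
      + scal s * gy b * (gk a * word_elem ls - scal t * word_elem ls) \<in> standard_ideal"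
    using t by (intro J0(2) J0(3) relation_right)
  moreover have "scal s * gy b * (scal t * word_elem ls) = scal (s * t) * (gy b * word_elem ls)"
    by (simp add: scal_mult mult.assoc) (simp add: scal_commute[of t "gy b"] flip: mult.assoc)
  ultimately show ?case
    by (intro exI[of _ "s * t"]) (simp add: g word_elem_simps gen_elem_simps algebra_simps)
qed

text \<open>Commuting x_a past the first letter brings it closer to the highest weight vector, which
  it kills. For equal indices an extra weight term appears, covered by
  \<open>k_word_reducible\<close>.\<close>

lemma x_word_reducible:
  assumes "set ls \<subseteq> range Gy"
  shows "gx a * word_elem ls \<in> reducible"
  using assms
proof (induction ls)
  case Nil
  have "gx a * word_elem [] - 0 \<in> standard_ideal"
    by (simp add: word_elem_simps standard_ideal_gens)
  then show ?case
    by (rule reducible_cong) (rule y_span_reducible, simp add: y_span_def)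
next
  case (Cons g ls)
  then obtain b where g: "g = Gy b" and ls: "set ls \<subseteq> range Gy" and IH: "gx a * word_elem ls \<in> reducible"
    by auto
  let ?w = "word_elem ls"
  have w: "?w \<in> reducible" "scal t * ?w \<in> reducible" "gk e * ?w \<in> reducible" for t e
  proof -
    show w: "?w \<in> reducible" "scal t * ?w \<in> reducible" for t
      using y_word_span[OF ls] y_span_gens by (auto intro: y_span_reducible reducible_mult)
    show "gk e * ?w \<in> reducible"
      using k_word_reducible[OF ls] w(2) reducible_cong by blast
  qed
  have yx: "scal t * (gy b * (gx a * ?w)) \<in> reducible" for t
    by (intro reducible_mult y_span_gens IH)
  have "gx a * (gy b * ?w) \<in> reducible"
  proof (cases "a = b")
    case True
    \<comment> \<open>The relation between y_a and x_a involves the \<kappa> of the other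
      index.\<close>
    define e where "e = (case a of I1 \<Rightarrow> I2 | I2 \<Rightarrow> I1)"
    have "gy a * gx a + gx a * gy a - (1 - gk e) \<in> uq_relations q N"
      unfolding uq_relations_def e_def by (cases a) auto
    from relation_right[OF this, of ?w]
    have "gx a * (gy b * ?w) - (?w + scal (-1) * (gk e * ?w) + scal (-1) * (gy b * (gx a * ?w))) \<in> standard_ideal"
      by (simp add: True algebra_simps scal_uminus)
    then show ?thesis
      by (rule reducible_cong) (intro reducible_add w yx reducible_mult y_span_gens)
  next
    case False
    then consider "a = I1" "b = I2" | "a = I2" "b = I1" by (cases a; cases b) auto
    then show ?thesis
    proof cases
      case 1
      have "gy I2 * gx I1 - scal q * gx I1 * gy I2 \<in> uq_relations q N"
        unfolding uq_relations_def by blast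
      \<comment> \<open>Multiplying by -1/q solves the relation for x_1 y_2.\<close>
      from J0(3)[OF relation_right[OF this, of ?w], of "scal (- r)"]
      have "scal r * (scal q * (gx I1 * (gy I2 * ?w))) - scal r * (gy I2 * (gx I1 * ?w)) \<in> standard_ideal"
        by (simp add: algebra_simps scal_uminus)
      moreover have "scal r * (scal q * z) = z" for z :: "'k free_alg"
        using q_nonzero by (simp flip: mult.assoc scal_mult)
      ultimately have "gx a * (gy b * ?w) - scal r * (gy b * (gx a * ?w)) \<in> standard_ideal"
        by (simp add: 1)
      then show ?thesis using yx by (rule reducible_cong)
    next
      case 2
      have "gy I1 * gx I2 - gx I2 * gy I1 \<in> uq_relations q N"
        unfolding uq_relations_def by blast
      from J0(4)[OF relation_right[OF this, of ?w]]
      have "gx a * (gy b * ?w) - scal 1 * (gy b * (gx a * ?w)) \<in> standard_ideal"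
        by (simp add: 2 algebra_simps)
      then show ?thesis using yx by (rule reducible_cong)
    qed
  qed
  then show ?case by (simp add: g word_elem_simps gen_elem_simps)
qed

lemma gen_reducible:
  assumes "a \<in> reducible"
  shows "gen_elem g * a \<in> reducible"
proof -
  from assms obtain y where y: "y \<in> y_span 0" and ay: "a - y \<in> standard_ideal"
    by (auto simp: reducible_def)
  have word: "gen_elem g * word_elem ls \<in> reducible" if ls: "set ls \<subseteq> range Gy" for ls
  proof (cases g)
    case (Gx b)
    then show ?thesis using x_word_reducible[OF ls] by (simp add: gen_elem_simps)
  next
    case (Gy b)
    then show ?thesis using y_word_span[OF ls] y_span_gens
      by (auto simp: gen_elem_simps intro: y_span_reducible reducible_mult)
  next
    case (Gk b)
    from k_word_reducible[OF ls] obtain t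
      where "gk b * word_elem ls - scal t * word_elem ls \<in> standard_ideal" by blast
    moreover have "scal t * word_elem ls \<in> reducible"
      using y_word_span[OF ls] y_span_gens by (auto intro: y_span_reducible reducible_mult)
    ultimately show ?thesis
      by (simp add: Gk gen_elem_simps reducible_cong)
  qed
  have zero: "0 \<in> reducible" by (intro y_span_reducible) (simp add: y_span_def)
  have "y = (\<Sum>w\<in>Poly_Mapping.keys y. scal (Poly_Mapping.lookup y w) * word_elem (letters w))"
    by (rule poly_mapping_eqI)
      (auto simp: lookup_sum scal_def word_elem_def mult_single lookup_single when_def in_keys_iff)
  then have "gen_elem g * y =
      (\<Sum>w\<in>Poly_Mapping.keys y. scal (Poly_Mapping.lookup y w) * (gen_elem g * word_elem (letters w)))"
    by (metis (no_types, lifting) mult.assoc scal_commute sum.cong sum_distrib_left)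
  also have "\<dots> \<in> reducible"
    by (rule sum_in_closed) (use y zero word y_span_gens in \<open>auto simp: y_span_def intro: reducible_add reducible_mult\<close>)
  finally have "gen_elem g * y \<in> reducible" .
  moreover have "gen_elem g * a - gen_elem g * y \<in> standard_ideal"
    using J0(3)[OF ay, of "gen_elem g"] by (simp add: algebra_simps)
  ultimately show ?thesis by (rule reducible_cong[rotated])
qed

lemma all_reducible: "a \<in> reducible"
proof (induction a rule: poly_mapping_single_induct)
  case (single w t)
  have "word_elem ls \<in> reducible" for ls
  proof (induction ls)
    case Nil
    then show ?case using y_span_gens by (auto simp: word_elem_simps intro: y_span_reducible)
  qed (simp add: word_elem_simps gen_reducible)
  then have "scal t * word_elem (letters w) \<in> reducible"
    by (intro reducible_mult y_span_gens)
  then show ?case by (simp add: scal_def word_elem_def mult_single)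
qed (rule reducible_add)

section \<open>Nilpotency of the words in the y_i\<close>

fun alternating :: "idx \<Rightarrow> nat \<Rightarrow> gen list" where
  "alternating a 0 = []"
| "alternating a (Suc m) = Gy a # alternating (case a of I1 \<Rightarrow> I2 | I2 \<Rightarrow> I1) m"

lemmas I = left_idealD[OF uq_ideal_left_ideal, where q1 = q and N1 = N]

lemma gy_square_mem: "gy a * (gy a * b) \<in> uq_ideal q N"
proof -
  have "gy a ^ 2 \<in> uq_relations q N" unfolding uq_relations_def by blast
  then have "gy a ^ 2 * b \<in> uq_ideal q N"
    using uq_relations_subset uq_ideal_right by blast
  then show ?thesis by (simp add: power2_eq_square mult.assoc)
qed

text \<open>A word that is not alternating contains two equal neighbours, hence a factor
  y_a^2.\<close>

lemma y_word_cases: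
  assumes "set ls \<subseteq> range Gy"
  shows "word_elem ls \<in> uq_ideal q N \<or> (\<exists>a. ls = alternating a (length ls))"
  using assms
proof (induction ls)
  case (Cons g ls)
  then obtain b where g: "g = Gy b" by auto
  from Cons consider "word_elem ls \<in> uq_ideal q N" | a where "ls = alternating a (length ls)"
    by auto
  then show ?case
  proof cases
    case 1
    then show ?thesis by (simp add: word_elem_simps I(3))
  next
    case (2 a)
    show ?thesis
    proof (cases ls)
      case Nil
      then show ?thesis by (auto simp: g)
    next
      case ls: (Cons h hs)
      show ?thesis
      proof (cases "a = b")
        case True
        then have "word_elem (g # ls) = gy b * (gy b * word_elem hs)"
          using 2 ls by (auto simp: g word_elem_simps gen_elem_simps)
        then show ?thesis by (simp add: gy_square_mem)
      next
        case False
        then have "a = (case b of I1 \<Rightarrow> I2 | I2 \<Rightarrow> I1)" by (cases a; cases b) auto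
        then have "g # ls = alternating b (length (g # ls))" using 2 by (simp add: g)
        then show ?thesis by blast
      qed
    qed
  qed
qed simp

text \<open>With more than 2N letters, the leading (y_a y_b)^N may be traded for -(y_b y_a)^N, whose
  last letter equals the next letter of the word.\<close>

lemma alternating_mem: "word_elem (alternating a (2 * N + Suc m)) \<in> uq_ideal q N"
proof -
  define b where "b = (case a of I1 \<Rightarrow> I2 | I2 \<Rightarrow> I1)"
  have ba: "(case b of I1 \<Rightarrow> I2 | I2 \<Rightarrow> I1) = a" by (cases a) (auto simp: b_def)
  have alt: "word_elem (alternating a (2 * k + m)) = (gy a * gy b) ^ k * word_elem (alternating a m)" for k m
    by (induction k) (simp_all add: word_elem_simps gen_elem_simps ba mult.assoc flip: b_def)
  have w: "word_elem (alternating a (2 * N + Suc m)) = (gy a * gy b) ^ N * (gy a * word_elem (alternating b m))"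
    unfolding alt by (simp add: word_elem_simps gen_elem_simps flip: b_def)
  have "(gy I1 * gy I2) ^ N + (gy I2 * gy I1) ^ N \<in> uq_relations q N"
    unfolding uq_relations_def by blast
  then have "(gy a * gy b) ^ N + (gy b * gy a) ^ N \<in> uq_ideal q N"
    using uq_relations_subset by (cases a) (auto simp: b_def add.commute)
  then have "((gy a * gy b) ^ N + (gy b * gy a) ^ N) * (gy a * word_elem (alternating b m)) \<in> uq_ideal q N"
    by (rule uq_ideal_right)
  moreover obtain k where k: "N = Suc k" by (rule N_pred)
  have "(gy b * gy a) ^ N * (gy a * word_elem (alternating b m)) =
      (gy b * gy a) ^ k * gy b * (gy a * (gy a * word_elem (alternating b m)))"
    by (simp add: k power_Suc2 mult.assoc del: power_Suc)
  then have "(gy b * gy a) ^ N * (gy a * word_elem (alternating b m)) \<in> uq_ideal q N"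
    by (simp add: I(3) gy_square_mem)
  ultimately show ?thesis
    unfolding w using I(5) by (fastforce simp: distrib_right)
qed

lemma long_y_span:
  assumes "y \<in> y_span (Suc (2 * N))"
  shows "y \<in> uq_ideal q N"
proof -
  have word: "word_elem ls \<in> uq_ideal q N" if ls: "set ls \<subseteq> range Gy" "Suc (2 * N) \<le> length ls" for ls
    using y_word_cases[OF ls(1)]
  proof
    assume "\<exists>a. ls = alternating a (length ls)"
    moreover obtain m where "length ls = 2 * N + Suc m"
      using ls(2) by (metis add_Suc_shift le_iff_add)
    ultimately show ?thesis using alternating_mem by metis
  qed
  have "y = (\<Sum>w\<in>Poly_Mapping.keys y. scal (Poly_Mapping.lookup y w) * word_elem (letters w))"
    by (rule poly_mapping_eqI)
      (auto simp: lookup_sum scal_def word_elem_def mult_single lookup_single when_def in_keys_iff)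
  also have "\<dots> \<in> uq_ideal q N"
    by (rule sum_in_closed) (use assms word I in \<open>auto simp: y_span_def\<close>)
  finally show ?thesis .
qed

lemma y_span_1_act:
  assumes "y \<in> y_span 1"
  shows "act y f (I1, 0) = 0"
proof -
  have "word_act gop w f (I1, 0) = 0" if w: "w \<in> Poly_Mapping.keys y" for w
  proof -
    from w assms have "set (letters w) \<subseteq> range Gy" "letters w \<noteq> []"
      by (auto simp: y_span_def)
    then obtain b ls where "letters w = Gy b # ls"
      by (cases "letters w") auto
    then show ?thesis using N_gt by (cases b) (simp_all add: word_act_def y1_def y2_def)
  qed
  then show ?thesis by (simp add: alg_act_def)
qed

lemma y_span_split:
  assumes "y \<in> y_span 0"
  shows "y - scal (Poly_Mapping.lookup y 0) \<in> y_span 1"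
  unfolding y_span_def
proof (intro CollectI ballI)
  fix w assume w: "w \<in> Poly_Mapping.keys (y - scal (Poly_Mapping.lookup y 0))"
  then have "w \<noteq> 0" by (auto simp: in_keys_iff lookup_minus scal_def)
  then have "letters w \<noteq> []" by (cases w) (auto simp: zero_word_def)
  moreover have "w \<in> Poly_Mapping.keys y"
    using w \<open>w \<noteq> 0\<close> by (auto simp: in_keys_iff lookup_minus scal_def lookup_single)
  then have "set (letters w) \<subseteq> range Gy" using assms by (auto simp: y_span_def)
  ultimately show "set (letters w) \<subseteq> range Gy \<and> 1 \<le> length (letters w)"
    by (cases "letters w") auto
qed

lemma proper_left_ideal_subset:
  assumes K: "left_ideal K" and J: "standard_ideal \<subseteq> K" and "K \<noteq> UNIV"
  shows "K \<subseteq> maximal_ideal"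
proof (rule ccontr)
  note K' = left_idealD[OF K]
  assume "\<not> K \<subseteq> maximal_ideal"
  then obtain a b where a: "a \<in> K" and b: "act b (act a highest_vec) (I1, 0) \<noteq> 0"
    using highest_vec_in by (auto simp: maximal_ideal_def radical_def act_vecs)
  \<comment> \<open>Rescaled so that its highest weight coefficient is 1. Modulo J_0 it becomes y,
    and since nonempty words in the y_i never reach that coefficient, y has constant term 1.\<close>
  define e where "e = scal (inverse (act b (act a highest_vec) (I1, 0))) * b * a"
  have e: "e \<in> K" "act e highest_vec (I1, 0) = 1"
    using K'(3)[OF a] b by (auto simp: e_def act_mult act_scal)
  obtain y where y: "y \<in> y_span 0" "e - y \<in> standard_ideal"
    using all_reducible[of e] by (auto simp: reducible_def)
  have yK: "y \<in> K"
    using K'(5)[OF e(1), of "e - y"] y J by auto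
  have "act (e - y) highest_vec = (\<lambda>p. 0)"
    using y standard_ideal_subset by (auto simp: annihilator_def)
  then have "act y highest_vec (I1, 0) = 1"
    using e(2) by (auto simp: act_diff fun_eq_iff)
  moreover define n where "n = y - scal (Poly_Mapping.lookup y 0)"
  have n: "n \<in> y_span 1" unfolding n_def by (rule y_span_split[OF y(1)])
  moreover have "y = scal (Poly_Mapping.lookup y 0) + n" by (simp add: n_def)
  ultimately have "Poly_Mapping.lookup y 0 = 1"
    using y_span_1_act[OF n, of highest_vec] by (metis act_add act_scal add.right_neutral highest_vec_def mult.right_neutral)
  then have y_eq: "y = 1 + n" by (simp add: n_def)
  \<comment> \<open>In place of inverting y = 1 + n, a descent on word length: z = z y - z n, where
    z y lies in K because y does, and z n consists of longer words already known to lie in K. Words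
    of more than 2N letters start the descent.\<close>
  have "y_span (Suc (2 * N) - t) \<subseteq> K" for t
  proof (induction t)
    case 0
    then show ?case using long_y_span uq_ideal_subset_standard J by auto
  next
    case (Suc t)
    show ?case
    proof (cases "t < Suc (2 * N)")
      case True
      then have m: "Suc (2 * N) - t = Suc (Suc (2 * N) - Suc t)" by simp
      show ?thesis
      proof
        fix z assume z: "z \<in> y_span (Suc (2 * N) - Suc t)"
        have "z * n \<in> K" using y_span_mult[OF z n] Suc m by auto
        moreover have "z = z * y - z * n" by (simp add: y_eq algebra_simps)
        ultimately show "z \<in> K" using K'(5)[OF K'(3)[OF yK, of z]] by metis
      qed
    qed (use Suc in simp)
  qed
  from this[of "Suc (2 * N)"] have "1 \<in> K" using y_span_gens by auto
  then show False using left_ideal_eq_UNIV[OF K] \<open>K \<noteq> UNIV\<close> by blast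
qed

lemma simple_quotient_presents:
  "\<exists>\<pi>. presents (uq_class q N) \<pi> (simple_quotient q N i j) maximal_ideal"
  unfolding simple_quotient_def Let_def
  by (rule exI, rule presents_unique_simple_quotient[OF standard_module_presents])
    (use uq_carrier maximal_ideal_left_ideal standard_ideal_subset_maximal maximal_ideal_proper
      proper_left_ideal_subset in auto)

section \<open>The radical in coordinates\<close>

lemma radicalI:
  assumes "V \<subseteq> vecs" and "\<And>g f. f \<in> V \<Longrightarrow> gop g f \<in> V"
    and "\<And>f h. f \<in> V \<Longrightarrow> h \<in> V \<Longrightarrow> (\<lambda>p. f p + h p) \<in> V"
    and "\<And>t f. f \<in> V \<Longrightarrow> (\<lambda>p. t * f p) \<in> V"
    and "\<And>f. f \<in> V \<Longrightarrow> f (I1, ev 0) = 0"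
  shows "V \<subseteq> radical"
proof
  fix f assume f: "f \<in> V"
  have "act b f \<in> V" for b
    by (rule act_closed[OF assms(2-4) f])
  then show "f \<in> radical"
    using f assms(1,5) by (auto simp: radical_def ev_def)
qed

lemma radical_x: "f \<in> radical \<Longrightarrow> x1 f \<in> radical" "f \<in> radical \<Longrightarrow> x2 f \<in> radical"
  using radical_closed[of f "gx I1"] radical_closed[of f "gx I2"] by (simp_all add: act_gx)

lemma radical_top: "f \<in> radical \<Longrightarrow> f (I1, ev 0) = 0"
  by (auto simp: radical_def ev_def act_one dest: spec[of _ 1])

lemma radical_vecs: "f \<in> radical \<Longrightarrow> f \<in> vecs"
  by (simp add: radical_def)

lemma r_power_neq_1: "0 < l \<Longrightarrow> l < N \<Longrightarrow> r ^ l \<noteq> 1"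
  using q_primitive[of l] by (simp add: power_inverse)

lemma q_r_power_eq: "l \<le> t \<Longrightarrow> q ^ t * r ^ l = q ^ (t - l)"
  using q_nonzero by (simp add: power_inverse power_diff field_simps)

lemma q_r_power_neq_1: "l < t \<Longrightarrow> t - l < N \<Longrightarrow> q ^ t * r ^ l \<noteq> 1"
  using q_primitive[of "t - l"] by (simp add: q_r_power_eq)

text \<open>Here d = 1, so y_1 v is singular for the highest weight vector v, and only words ending
  in y_2 survive: the coordinates \<open>(I1, ev l)\<close> and \<open>(I2, od l)\<close>. Applying
  x_1 and x_2 alternately descends this string with factors 1 - r^l and 1 - c r^l, which are nonzero
  in the stated range.\<close>

lemma radical_iff_j_zero:
  assumes j: "j = 0"
  shows "f \<in> radical \<longleftrightarrow>
    f \<in> vecs \<and> (\<forall>l\<le>i. f (I1, ev l) = 0) \<and> (\<forall>l<i. f (I2, od l) = 0)"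
proof
  have d: "d = 1" by (simp add: j)
  assume f: "f \<in> radical"
  have even: "\<forall>f\<in>radical. (l \<le> i \<longrightarrow> f (I1, ev l) = 0) \<and> (l < i \<longrightarrow> f (I2, od l) = 0)" for l
  proof (induction l)
    case 0
    show ?case
    proof (intro ballI conjI impI)
      fix f assume f: "f \<in> radical"
      then show "f (I1, ev 0) = 0" by (rule radical_top)
      assume "0 < i"
      then show "f (I2, od 0) = 0"
        using radical_top[OF radical_x(2)[OF f]] q_r_power_neq_1[of 0 i] i_less by (simp add: op_coords)
    qed
  next
    case (Suc l)
    have ev: "f (I1, ev (Suc l)) = 0" if f: "f \<in> radical" and l: "Suc l \<le> i" for f
    proof -
      have "x1 f (I2, od l) = 0" using Suc radical_x(1)[OF f] l by simp
      then show ?thesis using r_power_neq_1[of "Suc l"] l i_less by (simp add: op_coords d)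
    qed
    moreover have "f (I2, od (Suc l)) = 0" if f: "f \<in> radical" and l: "Suc l < i" for f
    proof -
      have "x2 f (I1, ev (Suc l)) = 0" using ev[OF radical_x(2)[OF f]] l by simp
      then show ?thesis using q_r_power_neq_1[of "Suc l" i] l i_less by (simp add: op_coords)
    qed
    ultimately show ?case by simp
  qed
  then show "f \<in> vecs \<and> (\<forall>l\<le>i. f (I1, ev l) = 0) \<and> (\<forall>l<i. f (I2, od l) = 0)"
    using f radical_vecs by auto
next
  have d: "d = 1" by (simp add: j)
  let ?V = "{f \<in> vecs. (\<forall>l\<le>i. f (I1, ev l) = 0) \<and> (\<forall>l<i. f (I2, od l) = 0)}"
  \<comment> \<open>This ends the string: the coefficient of x_2 from degree 2i + 1 to degree 2i
    vanishes.\<close>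
  have ci: "c * r ^ i = 1" using q_r_power_eq[of i i] by simp
  have "?V \<subseteq> radical"
  proof (rule radicalI)
    fix g f assume f: "f \<in> ?V"
    have "(\<forall>l\<le>i. gop g f (I1, ev l) = 0) \<and> (\<forall>l<i. gop g f (I2, od l) = 0)"
    proof (cases g rule: gop.cases)
      case 2
      have "(1 - c * r ^ l) * f (I2, od l) = 0" if "l \<le> i" for l
        using f ci that by (cases "l = i") auto
      then show ?thesis by (simp add: 2 op_coords)
    qed (use f i_less in \<open>auto simp: op_coords d\<close>)
    then show "gop g f \<in> ?V" using f gop_vecs by simp
  qed (auto simp: vecs_add vecs_scale)
  then show "f \<in> vecs \<and> (\<forall>l\<le>i. f (I1, ev l) = 0) \<and> (\<forall>l<i. f (I2, od l) = 0) \<Longrightarrow> f \<in> radical"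
    by auto
qed

text \<open>The mirror image with c = 1: words ending in y_1 survive. The empty word is stored on
  the side \<open>I1\<close>, whereas the other even degrees now lie on \<open>I2\<close>, so degree
  0 has to be stated separately.\<close>

lemma radical_iff_i_zero:
  assumes i: "i = 0"
  shows "f \<in> radical \<longleftrightarrow> f \<in> vecs \<and> f (I1, ev 0) = 0 \<and>
    (\<forall>l. 0 < l \<and> l \<le> j \<longrightarrow> f (I2, ev l) = 0) \<and> (\<forall>l<j. f (I1, od l) = 0)"
proof
  have c: "c = 1" by (simp add: i)
  assume f: "f \<in> radical"
  have even: "\<forall>f\<in>radical. (0 < l \<and> l \<le> j \<longrightarrow> f (I2, ev l) = 0) \<and> (l < j \<longrightarrow> f (I1, od l) = 0)" for l
  proof (induction l)
    case 0
    show ?case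
    proof (intro ballI conjI impI)
      fix f assume f: "f \<in> radical"
      assume "0 < j"
      then show "f (I1, od 0) = 0"
        using radical_top[OF radical_x(1)[OF f]] q_r_power_neq_1[of 0 j] j_less by (simp add: op_coords)
    qed simp
  next
    case (Suc l)
    have ev: "f (I2, ev (Suc l)) = 0" if f: "f \<in> radical" and l: "Suc l \<le> j" for f
    proof -
      have "x2 f (I1, od l) = 0" using Suc radical_x(2)[OF f] l by simp
      then show ?thesis using r_power_neq_1[of "Suc l"] l j_less by (simp add: op_coords c)
    qed
    moreover have "f (I1, od (Suc l)) = 0" if f: "f \<in> radical" and l: "Suc l < j" for f
    proof -
      have "x1 f (I2, ev (Suc l)) = 0" using ev[OF radical_x(1)[OF f]] l by simp
      then show ?thesis using q_r_power_neq_1[of "Suc l" j] l j_less by (simp add: op_coords)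
    qed
    ultimately show ?case by simp
  qed
  then show "f \<in> vecs \<and> f (I1, ev 0) = 0 \<and>
    (\<forall>l. 0 < l \<and> l \<le> j \<longrightarrow> f (I2, ev l) = 0) \<and> (\<forall>l<j. f (I1, od l) = 0)"
    using f radical_vecs radical_top by auto
next
  have c: "c = 1" by (simp add: i)
  let ?V = "{f \<in> vecs. f (I1, ev 0) = 0 \<and>
    (\<forall>l. 0 < l \<and> l \<le> j \<longrightarrow> f (I2, ev l) = 0) \<and> (\<forall>l<j. f (I1, od l) = 0)}"
  have dj: "d * r ^ j = 1" using q_r_power_eq[of j j] by simp
  have "?V \<subseteq> radical"
  proof (rule radicalI)
    fix g f assume f: "f \<in> ?V"
    have "gop g f (I1, ev 0) = 0 \<and>
      (\<forall>l. 0 < l \<and> l \<le> j \<longrightarrow> gop g f (I2, ev l) = 0) \<and> (\<forall>l<j. gop g f (I1, od l) = 0)"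
    proof (cases g rule: gop.cases)
      case 1
      have *: "(1 - d * r ^ l) * f (I1, od l) = 0" if "l \<le> j" for l
        using f dj that by (cases "l = j") auto
      from *[of 0] have "(1 - d) * f (I1, od 0) = 0" by simp
      with * show ?thesis by (simp add: 1 op_coords)
    qed (use f j_less in \<open>auto simp: op_coords c\<close>)
    then show "gop g f \<in> ?V" using f gop_vecs by simp
  qed (auto simp: vecs_add vecs_scale)
  then show "f \<in> vecs \<and> f (I1, ev 0) = 0 \<and>
    (\<forall>l. 0 < l \<and> l \<le> j \<longrightarrow> f (I2, ev l) = 0) \<and> (\<forall>l<j. f (I1, od l) = 0) \<Longrightarrow> f \<in> radical"
    by auto
qed

text \<open>The coefficients of the singular vector of degree \<open>2s\<close>, \<open>s \<equiv> i + j\<close> modulo \<open>N\<close>, come from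
  the vanishing of the determinant \<open>(1 - r\<^sup>l)(1 - cdr\<^sup>l)\<close> at \<open>l = s\<close>.\<close>

lemma radical_iff_nonzero:
  assumes ij: "i \<noteq> 0" "j \<noteq> 0" and s: "0 < s" "s \<le> N" "c * d = q ^ s"
  shows "f \<in> radical \<longleftrightarrow>
    f \<in> vecs \<and> (\<forall>t. \<forall>l<s. f (t, ev l) = 0 \<and> f (t, od l) = 0) \<and>
    (1 - c) * f (I1, ev s) = (-1) ^ s * (1 - r ^ j) * f (I2, ev s)"
proof -
  have c1: "c \<noteq> 1" and d1: "d \<noteq> 1" using q_primitive ij i_less j_less by auto
  have rr: "c * r ^ i = 1" "d * r ^ j = 1" using q_r_power_eq[of i i] q_r_power_eq[of j j] by auto
  \<comment> \<open>Only q^(i+j) = q^s enters, so s = i + j and s = i + j - N are treated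
    alike.\<close>
  have rs: "r ^ s = r ^ i * r ^ j"
  proof -
    have "q ^ s * r ^ s = 1" using q_r_power_eq[of s s] by simp
    then have "c * d * r ^ s = 1" by (simp add: s)
    then have "(c * r ^ i) * (d * r ^ j) * r ^ s = r ^ i * r ^ j" by (simp add: algebra_simps)
    then show ?thesis by (simp add: rr)
  qed
  have drs: "d * r ^ s = r ^ i" and crs: "c * r ^ s = r ^ j"
    using rr by (simp_all add: rs mult.left_commute mult.assoc[symmetric])
  have sg: "(-1) ^ t * ((-1) ^ t * z) = z" for t and z :: 'k
    by (simp flip: mult.assoc power_add mult_2)
  have det: "(1 - d * r ^ l) * (1 - c * r ^ l) - r ^ l * (1 - d) * (1 - c) = (1 - r ^ l) * (1 - c * d * r ^ l)" for l
    by (simp add: algebra_simps)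
  show ?thesis
  proof
    assume f: "f \<in> radical"
    have odd: "f (t, od l) = 0" if f: "f \<in> radical" and l: "l < N" and IH: "\<forall>f\<in>radical. \<forall>t. f (t, ev l) = 0" for f t l
    proof -
      have "x1 f (I1, ev l) = 0" "x2 f (I2, ev l) = 0" "x2 f (I1, ev l) = 0"
        using IH radical_x[OF f] by auto
      then show ?thesis
        using l d1 c1 q_nonzero by (cases t; cases "l = 0") (auto simp: op_coords)
    qed
    have even: "\<forall>f\<in>radical. \<forall>t. f (t, ev l) = 0" if "l < s" for l
      using that
    proof (induction l)
      case 0
      show ?case
      proof (intro ballI allI)
        fix f t assume "f \<in> radical"
        then show "f (t, ev 0) = 0"
          using radical_top radical_vecs vecs_coords(3) by (cases t) auto
      qed
    next
      case (Suc l)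
      show ?case
      proof (intro ballI allI)
        fix f t assume f: "f \<in> radical"
        let ?A = "f (I1, ev (Suc l))" and ?B = "f (I2, ev (Suc l))"
        have "x1 f (I2, od l) = 0" "x2 f (I1, od l) = 0"
          using odd[OF radical_x(1)[OF f]] odd[OF radical_x(2)[OF f]] Suc s by auto
        then have e: "(1 - d * r ^ Suc l) * ?A + (-1) ^ l * r ^ Suc l * (1 - d) * ?B = 0"
          "(1 - c * r ^ Suc l) * ?B + (-1) ^ l * (1 - c) * ?A = 0"
          using Suc.prems s by (auto simp: op_coords)
        \<comment> \<open>Cramer's rule for the two equations in \<open>e\<close>: eliminating ?B
          here and ?A below leaves the determinant times the remaining unknown.\<close>
        have "((1 - d * r ^ Suc l) * (1 - c * r ^ Suc l) - r ^ Suc l * (1 - d) * (1 - c)) * ?A =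
          (1 - c * r ^ Suc l) * ((1 - d * r ^ Suc l) * ?A + (-1) ^ l * r ^ Suc l * (1 - d) * ?B)
          - (-1) ^ l * r ^ Suc l * (1 - d) * ((1 - c * r ^ Suc l) * ?B + (-1) ^ l * (1 - c) * ?A)"
          using sg[of l] by (simp add: algebra_simps)
        then have A: "(1 - r ^ Suc l) * (1 - c * d * r ^ Suc l) * ?A = 0"
          unfolding e det by simp
        have "((1 - d * r ^ Suc l) * (1 - c * r ^ Suc l) - r ^ Suc l * (1 - d) * (1 - c)) * ?B =
          (1 - d * r ^ Suc l) * ((1 - c * r ^ Suc l) * ?B + (-1) ^ l * (1 - c) * ?A)
          - (-1) ^ l * (1 - c) * ((1 - d * r ^ Suc l) * ?A + (-1) ^ l * r ^ Suc l * (1 - d) * ?B)"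
          using sg[of l] by (simp add: algebra_simps)
        then have B: "(1 - r ^ Suc l) * (1 - c * d * r ^ Suc l) * ?B = 0"
          unfolding e det by simp
        have "r ^ Suc l \<noteq> 1" using r_power_neq_1[of "Suc l"] Suc.prems s by simp
        moreover have "c * d * r ^ Suc l \<noteq> 1"
          using q_r_power_neq_1[of "Suc l" s] Suc.prems s by simp
        ultimately show "f (t, ev (Suc l)) = 0"
          using A B by (cases t) auto
      qed
    qed
    have "(1 - c) * f (I1, ev s) = (-1) ^ s * (1 - r ^ j) * f (I2, ev s)"
    proof -
      obtain l where l: "s = Suc l" using s by (cases s) auto
      have "x1 f (I2, od l) = 0"
        using odd[OF radical_x(1)[OF f], of l] even l s by auto
      then have "(1 - r ^ i) * f (I1, ev s) + (-1) ^ l * r ^ s * (1 - d) * f (I2, ev s) = 0"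
        using s l drs by (simp add: op_coords)
      \<comment> \<open>Multiplying the equation from x_1 by c turns it into the stated one, since c
        r^i = 1 and c r^s = r^j.\<close>
      moreover have "c * ((1 - r ^ i) * f (I1, ev s) + (-1) ^ l * r ^ s * (1 - d) * f (I2, ev s)) =
          c * (1 - r ^ i) * f (I1, ev s) + (-1) ^ l * (c * r ^ s * (1 - d)) * f (I2, ev s)"
        by (simp add: algebra_simps)
      moreover have "c * (1 - r ^ i) = c - 1" using rr by (simp add: algebra_simps)
      moreover have "c * r ^ s * (1 - d) = r ^ j - 1" using rr crs by (simp add: algebra_simps)
      ultimately have "(c - 1) * f (I1, ev s) + (-1) ^ l * (r ^ j - 1) * f (I2, ev s) = 0"
        by simp
      then show ?thesis unfolding l by (simp add: algebra_simps)
    qed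
    then show "f \<in> vecs \<and> (\<forall>t. \<forall>l<s. f (t, ev l) = 0 \<and> f (t, od l) = 0) \<and>
      (1 - c) * f (I1, ev s) = (-1) ^ s * (1 - r ^ j) * f (I2, ev s)"
      using f radical_vecs even odd s by auto
  next
    let ?V = "{f \<in> vecs. (\<forall>t. \<forall>l<s. f (t, ev l) = 0 \<and> f (t, od l) = 0) \<and>
      (1 - c) * f (I1, ev s) = (-1) ^ s * (1 - r ^ j) * f (I2, ev s)}"
    have "?V \<subseteq> radical"
    proof (rule radicalI)
      fix g f assume f: "f \<in> ?V"
      then have z: "\<And>t l. l < s \<Longrightarrow> f (t, ev l) = 0" "\<And>t l. l < s \<Longrightarrow> f (t, od l) = 0" by auto
      from f have top: "(1 - c) * f (I1, ev s) = (-1) ^ s * (1 - r ^ j) * f (I2, ev s)" by simp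
      \<comment> \<open>The equation that x_1 imposes in degree 2s. Because the determinant vanishes
        at s, it is a multiple of the equation imposed by x_2.\<close>
      have top1: "(1 - r ^ i) * f (I1, ev s) = (-1) ^ s * r ^ s * (1 - d) * f (I2, ev s)"
      proof -
        have "(1 - r ^ i) * f (I1, ev s) = - (r ^ i * ((1 - c) * f (I1, ev s)))"
          using rr by (simp add: algebra_simps)
        also have "\<dots> = (-1) ^ s * r ^ s * (1 - d) * f (I2, ev s)"
          unfolding top rs using rr by (simp add: algebra_simps)
        finally show ?thesis .
      qed
      have odd_top: "x1 f (I2, od l) = 0" "x2 f (I1, od l) = 0" if l: "l < s" for l
      proof -
        have "x1 f (I2, od l) = 0 \<and> x2 f (I1, od l) = 0"
        proof (cases "Suc l = s")
          case True
          have "(-1) ^ l * (1 - c) * f (I1, ev s) = (-1) ^ l * ((-1) ^ s * ((1 - r ^ j) * f (I2, ev s)))"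
            using top by (simp add: mult.assoc)
          also have "\<dots> = - ((1 - r ^ j) * f (I2, ev s))"
            using sg[of l] by (simp flip: True)
          finally have x2: "(-1) ^ l * (1 - c) * f (I1, ev s) = - ((1 - r ^ j) * f (I2, ev s))" .
          have "(-1) ^ s = - ((-1 :: 'k) ^ l)" by (simp flip: True)
          then show ?thesis
            using l s x2 top1 drs crs True by (simp add: op_coords)
        next
          case False
          then show ?thesis using l s z[of "Suc l"] by (auto simp: op_coords)
        qed
        then show "x1 f (I2, od l) = 0" "x2 f (I1, od l) = 0" by auto
      qed
      have "(\<forall>t. \<forall>l<s. gop g f (t, ev l) = 0 \<and> gop g f (t, od l) = 0) \<and>
        (1 - c) * gop g f (I1, ev s) = (-1) ^ s * (1 - r ^ j) * gop g f (I2, ev s)"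
      proof (cases g rule: gop.cases)
        case 1
        \<comment> \<open>The vanishing determinant once more, now showing that vectors coming down
          from degree 2s + 1 satisfy the equation in degree 2s.\<close>
        have "(1 - c) * (r ^ s * (1 - d)) = (1 - r ^ j) * (1 - r ^ i)"
          unfolding rs using rr by (simp add: algebra_simps)
        then show ?thesis
          using z odd_top s drs by (auto simp: 1 all_idx_iff op_coords(1-3))
      next
        case 2
        show ?thesis
          using z odd_top s crs sg[of s] by (auto simp: 2 all_idx_iff op_coords(5,7,8))
      qed (use z s top in \<open>auto simp: all_idx_iff op_coords\<close>)
      then show "gop g f \<in> ?V" using f gop_vecs by simp
    next
      fix f h assume "f \<in> ?V" "h \<in> ?V"
      then show "(\<lambda>p. f p + h p) \<in> ?V" by (simp add: vecs_add distrib_left)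
    next
      fix t f assume "f \<in> ?V"
      then show "(\<lambda>p. t * f p) \<in> ?V"
        by (simp add: vecs_scale mult.left_commute[of _ t])
    qed (use s in auto)
    then show "f \<in> vecs \<and> (\<forall>t. \<forall>l<s. f (t, ev l) = 0 \<and> f (t, od l) = 0) \<and>
      (1 - c) * f (I1, ev s) = (-1) ^ s * (1 - r ^ j) * f (I2, ev s) \<Longrightarrow> f \<in> radical"
      by auto
  qed
qed

section \<open>Dimensions and quantum dimensions\<close>

definition unit_vec :: "idx \<times> nat \<Rightarrow> 'k vec" where
  "unit_vec p = (\<lambda>p'. if p' = p then 1 else 0)"

lemma alternating_act:
  assumes "0 < m" and "m < 2 * N \<or> m = 2 * N \<and> a = I1"
  shows "act (word_elem (alternating a m)) highest_vec = unit_vec (a, m)"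
  using assms
proof (induction m arbitrary: a)
  case (Suc m)
  have hv: "highest_vec = unit_vec (I1, 0)" by (simp add: highest_vec_def unit_vec_def)
  have step: "y1 (unit_vec (I2, m)) = unit_vec (I1, Suc m)" if "0 < m"
    using that Suc.prems by (auto simp: fun_eq_iff y1_def unit_vec_def split: idx.splits)
  have step': "y2 (unit_vec (I1, m)) = unit_vec (I2, Suc m)" if "Suc m < 2 * N"
    using that by (auto simp: fun_eq_iff y2_def unit_vec_def split: idx.splits)
  have base: "y1 (unit_vec (I1, 0)) = unit_vec (I1, 1)"
    using N_gt by (auto simp: fun_eq_iff y1_def unit_vec_def split: idx.splits)
  show ?case
  proof (cases "m = 0")
    case True
    then show ?thesis
      using base step' N_gt
      by (cases a) (simp_all add: word_elem_simps gen_elem_simps act_mult act_gens act_one hv)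
  next
    case False
    moreover have "m < 2 * N" using Suc.prems by auto
    ultimately show ?thesis
      using Suc.IH[of I1] Suc.IH[of I2] Suc.prems step step'
      by (cases a) (simp_all add: word_elem_simps gen_elem_simps act_mult act_gens)
  qed
qed simp

lemma q_half: "q ^ (N div 2) = -1"
proof -
  have "(q ^ (N div 2)) ^ 2 = 1"
    using N_even q_N by (simp flip: power_mult)
  moreover have "q ^ (N div 2) \<noteq> 1"
    using q_primitive[of "N div 2"] N_gt by simp
  ultimately show ?thesis by (simp add: power2_eq_1_iff)
qed

text \<open>Each letter y_1 or y_2 contributes r^n = -1, whichever its index, and the highest weight
  vector contributes (q^n)^(i+j).\<close>

lemma nu_act:
  "act (gk I1 ^ (N div 2) * gk I2 ^ (N div 2) * a) f (s, m) = (-1) ^ (i + j + m) * act a f (s, m)"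
proof -
  let ?n = "N div 2"
  have fn: "act (gk I1) = k1" "act (gk I2) = k2"
    by (rule ext, simp add: act_gens)+
  have "r ^ ?n = -1" using q_half by (simp add: power_inverse)
  then have pow: "(q ^ t) ^ ?n = (-1) ^ t" "(r ^ t) ^ ?n = (-1) ^ t" for t
    using q_half by (metis mult.commute power_mult)+
  have div: "Suc m div 2 + m div 2 = m" by presburger
  have "(-1) ^ (Suc m div 2) * (-1) ^ (m div 2) = (-1 :: 'k) ^ m"
    unfolding power_add[symmetric] div ..
  then show ?thesis
    by (cases s) (simp_all add: act_mult act_power fn k_power power_mult_distrib pow power_add ac_simps)
qed

lemma sum_signs: "(\<Sum>m\<le>2 * k. (-1) ^ m) = (1 :: 'k)" "(\<Sum>m = 1..<2 * Suc k. (-1) ^ m) = (-1 :: 'k)"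
proof -
  show "(\<Sum>m\<le>2 * k. (-1) ^ m) = (1 :: 'k)" by (induction k) auto
  have "{Suc 0..<2} = {Suc 0}" by auto
  then show "(\<Sum>m = 1..<2 * Suc k. (-1) ^ m) = (-1 :: 'k)" by (induction k) auto
qed

text \<open>The common part of the cases j = 0 and i = 0: L has one basis word in each degree from 0
  to 2t, on the side chosen by \<open>side\<close>. The signs alternate and begin and end with the
  same one, so a single sign is left in the trace.\<close>

lemma simple_quotient_string:
  assumes side: "\<And>m. m \<le> 2 * t \<Longrightarrow> m = 0 \<Longrightarrow> side m = I1" and t: "t < N"
    and rad: "\<And>f. f \<in> vecs \<Longrightarrow> f \<in> radical \<longleftrightarrow> (\<forall>m\<le>2 * t. f (side m, m) = 0)"
  shows "uq_fin_dim q N (simple_quotient q N i j)"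
    and "uq_dim q N (simple_quotient q N i j) = 2 * t + 1"
    and "uq_qdim q N (simple_quotient q N i j) = (-1) ^ (i + j)"
proof -
  obtain \<pi> where \<pi>: "presents (uq_class q N) \<pi> (simple_quotient q N i j) maximal_ideal"
    using simple_quotient_presents by blast
  define l where "l m a = act a highest_vec (side m, m)" for m a
  define u where "u m = word_elem (alternating (side m) m)" for m
  have u: "act (u m) highest_vec = unit_vec (side m, m)" if "m \<le> 2 * t" for m
    using that t side[of m] alternating_act[of m "side m"]
    by (cases "m = 0") (auto simp: u_def word_elem_simps act_one highest_vec_def unit_vec_def)
  have J: "maximal_ideal = {a. \<forall>m\<in>{..2 * t}. l m a = 0}"
    using rad highest_vec_in by (auto simp: maximal_ideal_def act_vecs l_def)
  have l: "l m (a + b) = l m a + l m b" "l m (scal x * a) = x * l m a"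
    "m \<in> {..2 * t} \<Longrightarrow> m' \<in> {..2 * t} \<Longrightarrow> l m (u m') = (if m = m' then 1 else 0)" for m m' a b x
    using u by (auto simp: l_def act_simps unit_vec_def)
  note dim = presents_dimension[OF \<pi> finite_atMost l(1,2) J l(3)]
  show "uq_fin_dim q N (simple_quotient q N i j)" by (rule dim)
  show "uq_dim q N (simple_quotient q N i j) = 2 * t + 1" using dim(3) by simp
  have "uq_qdim q N (simple_quotient q N i j) = (\<Sum>m\<le>2 * t. (-1) ^ (i + j + m))"
    by (rule dim(4), assumption, assumption) (unfold l_def, rule nu_act)
  also have "\<dots> = (-1) ^ (i + j)"
    by (simp add: power_add sum_signs flip: sum_distrib_left)
  finally show "uq_qdim q N (simple_quotient q N i j) = (-1) ^ (i + j)" .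
qed

lemma simple_quotient_j_zero:
  assumes "j = 0"
  shows "uq_fin_dim q N (simple_quotient q N i j)"
    and "uq_dim q N (simple_quotient q N i j) = 2 * i + 1"
    and "uq_qdim q N (simple_quotient q N i j) = (-1) ^ i"
proof -
  let ?side = "\<lambda>m :: nat. if even m then I1 else I2"
  have rad: "f \<in> radical \<longleftrightarrow> (\<forall>m\<le>2 * i. f (?side m, m) = 0)" if f: "f \<in> vecs" for f
  proof
    assume "f \<in> radical"
    then show "\<forall>m\<le>2 * i. f (?side m, m) = 0"
      by (auto simp: radical_iff_j_zero[OF assms] ev_def od_def elim!: evenE oddE)
  next
    assume *: "\<forall>m\<le>2 * i. f (?side m, m) = 0"
    have "f (I1, ev l) = 0" if "l \<le> i" for l
      using *[rule_format, of "ev l"] that by (simp add: ev_def)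
    moreover have "f (I2, od l) = 0" if "l < i" for l
      using *[rule_format, of "od l"] that by (simp add: od_def)
    ultimately show "f \<in> radical" using f by (simp add: radical_iff_j_zero[OF assms])
  qed
  show "uq_fin_dim q N (simple_quotient q N i j)"
    "uq_dim q N (simple_quotient q N i j) = 2 * i + 1"
    "uq_qdim q N (simple_quotient q N i j) = (-1) ^ i"
    using simple_quotient_string[of i ?side, OF _ i_less rad] assms by simp_all
qed

lemma simple_quotient_i_zero:
  assumes "i = 0"
  shows "uq_fin_dim q N (simple_quotient q N i j)"
    and "uq_dim q N (simple_quotient q N i j) = 2 * j + 1"
    and "uq_qdim q N (simple_quotient q N i j) = (-1) ^ j"
proof -
  let ?side = "\<lambda>m :: nat. if odd m \<or> m = 0 then I1 else I2"
  have rad: "f \<in> radical \<longleftrightarrow> (\<forall>m\<le>2 * j. f (?side m, m) = 0)" if f: "f \<in> vecs" for f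
  proof
    assume "f \<in> radical"
    then show "\<forall>m\<le>2 * j. f (?side m, m) = 0"
      by (auto simp: radical_iff_i_zero[OF assms] ev_def od_def elim!: evenE oddE)
  next
    assume *: "\<forall>m\<le>2 * j. f (?side m, m) = 0"
    have "f (I2, ev l) = 0" if "0 < l" "l \<le> j" for l
      using *[rule_format, of "ev l"] that by (simp add: ev_def)
    moreover have "f (I1, od l) = 0" if "l < j" for l
      using *[rule_format, of "od l"] that by (simp add: od_def)
    moreover have "f (I1, ev 0) = 0"
      using *[rule_format, of 0] by (simp add: ev_def)
    ultimately show "f \<in> radical" using f by (simp add: radical_iff_i_zero[OF assms])
  qed
  show "uq_fin_dim q N (simple_quotient q N i j)"
    "uq_dim q N (simple_quotient q N i j) = 2 * j + 1"
    "uq_qdim q N (simple_quotient q N i j) = (-1) ^ j"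
    using simple_quotient_string[of j ?side, OF _ j_less rad] assms by simp_all
qed

text \<open>The count is 1 + 2(2s - 1) + 1: the empty word, two words in each degree from 1 to 2s -
  1, and one dimension in degree 2s. For s = N the coordinate \<open>(I2, 2 * s)\<close> is a dummy
  and the radical is zero.\<close>

lemma simple_quotient_nonzero:
  assumes ij: "i \<noteq> 0" "j \<noteq> 0" and s: "0 < s" "s \<le> N" "c * d = q ^ s"
  shows "uq_fin_dim q N (simple_quotient q N i j)"
    and "uq_dim q N (simple_quotient q N i j) = 4 * s"
    and "uq_qdim q N (simple_quotient q N i j) = 0"
proof -
  obtain \<pi> where \<pi>: "presents (uq_class q N) \<pi> (simple_quotient q N i j) maximal_ideal"
    using simple_quotient_presents by blast
  have c1: "c \<noteq> 1" using q_primitive ij i_less by auto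
  let ?P1 = "(\<lambda>m. (I1, m)) ` {..2 * s}" and ?P2 = "(\<lambda>m. (I2, m)) ` {1..<2 * s}"
  let ?P = "?P1 \<union> ?P2"
  \<comment> \<open>In degree 2s the coordinate is replaced by the linear form that cuts out the
    radical there; the matching basis word in \<open>u\<close> is rescaled by 1/(1 - c) to make the
    two families dual.\<close>
  define l where "l p a = (let f = act a highest_vec in
    if p = (I1, 2 * s) then (1 - c) * f (I1, 2 * s) - (-1) ^ s * (1 - r ^ j) * f (I2, 2 * s) else f p)"
    for p a
  define u where "u p = (let w = word_elem (alternating (fst p) (snd p)) in
    if p = (I1, 2 * s) then scal (inverse (1 - c)) * w else w)" for p
  have word: "act (word_elem (alternating (fst p) (snd p))) highest_vec = unit_vec p" if "p \<in> ?P" for p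
  proof (cases "snd p = 0")
    case True
    then have "p = (I1, 0)" using that by auto
    then show ?thesis by (simp add: word_elem_simps act_one highest_vec_def unit_vec_def)
  next
    case False
    moreover have "snd p < 2 * N \<or> snd p = 2 * N \<and> fst p = I1"
      using that s by auto
    ultimately show ?thesis using alternating_act[of "snd p" "fst p"] by simp
  qed
  have J: "maximal_ideal = {a. \<forall>p\<in>?P. l p a = 0}"
  proof -
    have "f \<in> radical \<longleftrightarrow> (\<forall>p\<in>?P. (if p = (I1, 2 * s)
        then (1 - c) * f (I1, 2 * s) - (-1) ^ s * (1 - r ^ j) * f (I2, 2 * s) else f p) = 0)"
      (is "_ \<longleftrightarrow> ?R") if f: "f \<in> vecs" for f
    proof -
      have split: "(\<forall>m<2 * s. f (t, m) = 0) \<longleftrightarrow> (\<forall>l<s. f (t, ev l) = 0 \<and> f (t, od l) = 0)" for t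
      proof
        assume *: "\<forall>l<s. f (t, ev l) = 0 \<and> f (t, od l) = 0"
        show "\<forall>m<2 * s. f (t, m) = 0"
        proof (intro allI impI)
          fix m assume "m < 2 * s"
          with * show "f (t, m) = 0"
            by (cases m rule: even_odd_cases) (auto simp: ev_def od_def)
        qed
      qed (auto simp: ev_def od_def)
      have "?R \<longleftrightarrow> (\<forall>m<2 * s. f (I1, m) = 0) \<and> (\<forall>m\<in>{1..<2 * s}. f (I2, m) = 0) \<and>
          (1 - c) * f (I1, 2 * s) = (-1) ^ s * (1 - r ^ j) * f (I2, 2 * s)"
        by (auto simp: ball_Un le_less)
      also have "(\<forall>m\<in>{1..<2 * s}. f (I2, m) = 0) \<longleftrightarrow> (\<forall>m<2 * s. f (I2, m) = 0)"
        using f by (auto simp: vecs_def Suc_le_eq)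
      finally have "?R \<longleftrightarrow> (\<forall>t. \<forall>l<s. f (t, ev l) = 0 \<and> f (t, od l) = 0) \<and>
          (1 - c) * f (I1, ev s) = (-1) ^ s * (1 - r ^ j) * f (I2, ev s)"
        unfolding all_idx_iff ev_def[of s] split by blast
      then show ?thesis
        unfolding radical_iff_nonzero[OF ij s] using f by blast
    qed
    then show ?thesis
      using highest_vec_in by (simp add: maximal_ideal_def act_vecs l_def Let_def)
  qed
  have l: "l p (a + b) = l p a + l p b" "l p (scal x * a) = x * l p a" for p a b x
    by (auto simp: l_def Let_def act_simps algebra_simps)
  have lu: "l p (u p') = (if p = p' then 1 else 0)" if "p \<in> ?P" "p' \<in> ?P" for p p'
    using that word[OF that(2)] c1
    by (auto simp: l_def u_def Let_def act_mult act_scal unit_vec_def split: if_splits)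
  note dim = presents_dimension[OF \<pi> _ l J lu]
  have fin: "finite ?P" by simp
  have disj: "?P1 \<inter> ?P2 = {}" by auto
  have inj: "inj_on (\<lambda>m. (t, m)) A" for t :: idx and A :: "nat set" by (auto simp: inj_on_def)
  show "uq_fin_dim q N (simple_quotient q N i j)" by (rule dim(2)[OF fin])
  have "card ?P = 4 * s"
    using s by (subst card_Un_disjoint) (auto simp: card_image inj)
  then show "uq_dim q N (simple_quotient q N i j) = 4 * s" using dim(3)[OF fin] by simp
  have nu: "l p (gk I1 ^ (N div 2) * gk I2 ^ (N div 2) * a) = (-1) ^ (i + j + snd p) * l p a" for p a
    unfolding l_def Let_def by (cases p, simp only: nu_act snd_conv) (auto simp: algebra_simps)
  have "uq_qdim q N (simple_quotient q N i j) = (\<Sum>p\<in>?P. (-1) ^ (i + j + snd p))"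
    by (rule dim(4)[OF fin], assumption, assumption) (rule nu)
  \<comment> \<open>The side \<open>I1\<close> covers degrees 0 to 2s and sums to 1; the side
    \<open>I2\<close> covers degrees 1 to 2s - 1 and sums to -1.\<close>
  also have "\<dots> = (-1) ^ (i + j) * ((\<Sum>m\<le>2 * s. (-1) ^ m) + (\<Sum>m = 1..<2 * s. (-1) ^ m))"
    using disj by (subst sum.union_disjoint) (auto simp: sum.reindex inj power_add sum_distrib_left algebra_simps)
  also have "\<dots> = 0"
    using s sum_signs(1)[of s] sum_signs(2)[of "s - 1"] by simp
  finally show "uq_qdim q N (simple_quotient q N i j) = 0" .
qed

end

theorem corollary6p10:
  fixes q :: "'k::{alg_closed_field, field_char_0}"
    and N n i j :: nat
  assumes "N = 2 * n" and "N > 2"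
    and "q ^ N = 1" and "\<And>m. 0 < m \<Longrightarrow> m < N \<Longrightarrow> q ^ m \<noteq> 1"
    and "i < N" and "j < N"
  shows "uq_fin_dim q N (simple_quotient q N i j)
    \<and> (j = 0 \<longrightarrow> uq_dim q N (simple_quotient q N i j) = 2 * i + 1)
    \<and> (i = 0 \<longrightarrow> uq_dim q N (simple_quotient q N i j) = 2 * j + 1)
    \<and> (i \<noteq> 0 \<and> j \<noteq> 0 \<and> 1 < i + j \<and> i + j \<le> N \<longrightarrow>
         uq_dim q N (simple_quotient q N i j) = 4 * (i + j))
    \<and> (i \<noteq> 0 \<and> j \<noteq> 0 \<and> N < i + j \<and> i + j < 2 * N \<longrightarrow>
         uq_dim q N (simple_quotient q N i j) = 4 * (i + j - N))
    \<and> (j = 0 \<longrightarrow> uq_qdim q N (simple_quotient q N i j) = (- 1) ^ i)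
    \<and> (i = 0 \<longrightarrow> uq_qdim q N (simple_quotient q N i j) = (- 1) ^ j)
    \<and> (i \<noteq> 0 \<and> j \<noteq> 0 \<longrightarrow> uq_qdim q N (simple_quotient q N i j) = 0)"
proof -
  interpret verma q N i j
    using assms by unfold_locales auto
  \<comment> \<open>For nonzero i and j this is the representative of i + j modulo N between 1 and
    N; i + j = N stays N, which gives dimension 4N.\<close>
  define s where "s = (if i + j \<le> N then i + j else i + j - N)"
  have "q ^ i * q ^ j = q ^ s"
  proof (cases "i + j \<le> N")
    case False
    then have "i + j = N + s" by (simp add: s_def)
    then show ?thesis using q_N by (metis mult_1 power_add)
  qed (simp add: s_def power_add)
  then have nonzero: "uq_fin_dim q N (simple_quotient q N i j)"
    "uq_dim q N (simple_quotient q N i j) = 4 * s" "uq_qdim q N (simple_quotient q N i j) = 0"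
    if "i \<noteq> 0" "j \<noteq> 0"
    using that simple_quotient_nonzero[of s] assms(5,6) by (auto simp: s_def split: if_splits)
  show ?thesis
    using nonzero simple_quotient_j_zero simple_quotient_i_zero
    by (cases "j = 0"; cases "i = 0") (simp_all add: s_def)
qed

end
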